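(* Let $\mathfrak{H}$ be a finite-dimensional complex Hilbert space, $h=h^*\in\mathcal{L}(\mathfrak{H})$, $L\in\mathcal{L}(\mathfrak{H})$, and let $W=W^*\in\mathcal{L}(\mathfrak{H}\otimes\mathfrak{H})$ satisfy $\mathsf{S}W\mathsf{S}=W$, where $\mathsf{S}(u\otimes v)=v\otimes u$. Assume $LL^*=L^*L$, and let $\gamma_0\in\mathcal{D}(\mathfrak{H})$ satisfy $\gamma_0\ge m_0\mathbf 1$ for some $m_0>0$. For $N\ge2$ let $$H_N=\sum_{j=1}^Nh_j+\frac1{N-1}\sum_{1\le i<j\le N}W_{ij}.$$ Let $\Gamma_t^N$ be a sufficiently regular solution of the $N$-body Lindblad equation $$\partial_t\Gamma_t^N=-\mathrm{i}[H_N,\Gamma_t^N]+\sum_{j=1}^N\mathcal{L}_{L_j}(\Gamma_t^N)$$ with initial datum $\Gamma_0^N\in\mathcal{D}_s(\mathfrak{H}^{\otimes N})$, and let $\gamma_t$ be a sufficiently regular solution of the Hartree–Lindblad equation $$\partial_t\gamma_t=-\mathrm{i}[h+V^{\gamma_t},\gamma_t]+\mathcal{L}_L(\gamma_t),\qquad V^\gamma:=\mathrm{Tr}_2\big((\mathbf 1\otimes\gamma)W\big),$$ with initial datum $\gamma_0$. Define $$C_W^{(m_0)}:=\sup_{\gamma\in\mathcal{D}(\mathfrak{H}),\ \gamma\ge m_0\mathbf 1}\left\|-\mathrm{i}\left[W-\mathrm{Tr}_2((\mathbf 1\otimes\gamma)W)\otimes\mathbf 1,\ (\log\gamma)\otimes\mathbf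 1\right]\right\|_{\rm op}.$$ Then $C_W^{(m_0)}<\infty$, and for any $t\ge0$ $$S(\Gamma_t^N,\gamma_t^{\otimes N})\le e^{32C_W^{(m_0)}t}\Big(S(\Gamma_0^N,\gamma_0^{\otimes N})+\log2\Big).$$ Moreover $C_W^{(m_0)}\le 4\|W\|_{\rm op}/m_0$, and consequently $$S(\Gamma_t^N,\gamma_t^{\otimes N})\le e^{128\|W\|_{\rm op}t/m_0}\Big(S(\Gamma_0^N,\gamma_0^{\otimes N})+\log2\Big).$$
   Context: $\mathcal{L}(\cdot)$ denotes (bounded) linear operators; $\mathcal{D}(\cdot)$ denotes density operators (self-adjoint, nonnegative, trace one); $\mathcal{D}_s(\mathfrak{H}^{\otimes N})$ denotes density operators on $\mathfrak{H}^{\otimes N}$ invariant under conjugation by the unitaries permuting the $N$ tensor factors. For a one-body operator $A$, $A_j$ denotes $A$ acting on the $j$-th tensor factor; $W_{ij}$ denotes $W$ acting on the $i$-th and $j$-th factors. The dissipator is $\mathcal{L}_L(A)=LAL^*-\frac12(L^*LA+AL^*L)$. $\mathrm{Tr}_2$ is the partial trace over the second factor. Quantum relative entropy: $S(\Gamma,\Gamma')=\mathrm{Tr}(\Gamma(\log\Gamma-\log\Gamma'))$ if $\mathrm{Ker}(\Gamma')\subset\mathrm{Ker}(\Gamma)$, and $+\infty$ otherwise. The equations are ODEs in a finite-dimensional space; "sufficiently regular" may be read as continuously differentiable in $t\ge0$. *)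

theory Defs
  imports "HOL-Analysis.Analysis"
begin

text \<open>
  A finite-dimensional complex Hilbert space is taken in coordinates, as \<^typ>\<open>complex^'d\<close>; operators
  on it are square matrices.  With \<open>'d\<close> indexing an orthonormal basis of the one-body space, the
  two-body space has basis indexed by \<^typ>\<open>'d \<times> 'd\<close>, and the \<open>N\<close>-body space has basis indexed by
  \<^typ>\<open>'n \<Rightarrow> 'd\<close>, where \<open>'n\<close> is a linearly ordered type of \<open>N\<close> particle labels.
\<close>

type_synonym 'a op = "complex^'a^'a"

definition cscale :: "complex \<Rightarrow> 'a::finite op \<Rightarrow> 'a op" (infixr "*\<^sub>C" 75)
  where "c *\<^sub>C A = (\<chi> i j. c * A $ i $ j)"

definition adj :: "'a::finite op \<Rightarrow> 'a op"
  where "adj A = (\<chi> i j. cnj (A $ j $ i))"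

definition comm :: "'a::finite op \<Rightarrow> 'a op \<Rightarrow> 'a op"
  where "comm A B = A ** B - B ** A"

text \<open>The norm on \<^typ>\<open>complex^'a\<close> is the Hilbert space norm.\<close>

definition op_norm :: "'a::finite op \<Rightarrow> real"
  where "op_norm A = onorm (\<lambda>x. A *v x)"

definition self_adjoint :: "'a::finite op \<Rightarrow> bool"
  where "self_adjoint A \<longleftrightarrow> adj A = A"

text \<open>The library inner product on \<^typ>\<open>complex^'a\<close> is the real part of the Hermitian one; for
  self-adjoint \<open>A\<close> the form \<open>x \<bullet> (A *v x)\<close> therefore is the full quadratic form.\<close>

definition nonneg_op :: "'a::finite op \<Rightarrow> bool"
  where "nonneg_op A \<longleftrightarrow> self_adjoint A \<and> (\<forall>x. 0 \<le> x \<bullet> (A *v x))"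

definition op_le :: "'a::finite op \<Rightarrow> 'a op \<Rightarrow> bool" (infix "\<preceq>" 50)
  where "A \<preceq> B \<longleftrightarrow> nonneg_op (B - A)"

definition density_op :: "'a::finite op \<Rightarrow> bool"
  where "density_op A \<longleftrightarrow> nonneg_op A \<and> trace A = 1"

text \<open>Functional calculus of a self-adjoint \<open>A\<close>: \<open>f(A)\<close> is the operator acting as \<open>f r\<close> on the
  eigenspace of \<open>A\<close> for \<open>r\<close>.  It exists and is unique because the eigenvectors of \<open>A\<close> span.\<close>

definition op_fun :: "(real \<Rightarrow> real) \<Rightarrow> 'a::finite op \<Rightarrow> 'a op"
  where "op_fun f A = (THE B. \<forall>r v. A *v v = complex_of_real r *s v \<longrightarrow>
                                     B *v v = complex_of_real (f r) *s v)"

text \<open>Since \<open>ln 0 = 0\<close> in \<^typ>\<open>real\<close>, the logarithm vanishes on the kernel.  This gives the convention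
  \<open>0 log 0 = 0\<close> in the relative entropy, where the value of \<open>log \<Gamma>'\<close> on the kernel of \<open>\<Gamma>'\<close> is
  immaterial as soon as that kernel is contained in the kernel of \<open>\<Gamma>\<close>.\<close>

definition op_log :: "'a::finite op \<Rightarrow> 'a op"
  where "op_log A = op_fun ln A"

definition op_ker :: "'a::finite op \<Rightarrow> (complex^'a) set"
  where "op_ker A = {v. A *v v = 0}"

definition rel_entropy :: "'a::finite op \<Rightarrow> 'a op \<Rightarrow> ereal"
  where "rel_entropy \<Gamma> \<Gamma>' =
    (if op_ker \<Gamma>' \<subseteq> op_ker \<Gamma> then ereal (Re (trace (\<Gamma> ** (op_log \<Gamma> - op_log \<Gamma>')))) else \<infinity>)"

definition tensor2 :: "'d::finite op \<Rightarrow> 'd op \<Rightarrow> ('d \<times> 'd) op" (infixr "\<otimes>\<^sub>2" 70)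
  where "A \<otimes>\<^sub>2 B = (\<chi> p q. A $ fst p $ fst q * B $ snd p $ snd q)"

definition ptrace2 :: "('d \<times> 'd) op \<Rightarrow> 'd::finite op"
  where "ptrace2 M = (\<chi> a b. \<Sum>c\<in>UNIV. M $ (a, c) $ (b, c))"

definition swap_op :: "('d::finite \<times> 'd) op"
  where "swap_op = (\<chi> p q. if q = prod.swap p then 1 else 0)"

definition one_body :: "'n \<Rightarrow> 'd::finite op \<Rightarrow> ('n::finite \<Rightarrow> 'd) op"
  where "one_body j A = (\<chi> x y. if \<forall>k. k \<noteq> j \<longrightarrow> x k = y k then A $ x j $ y j else 0)"

definition two_body :: "'n \<Rightarrow> 'n \<Rightarrow> ('d::finite \<times> 'd) op \<Rightarrow> ('n::finite \<Rightarrow> 'd) op"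
  where "two_body i j W =
    (\<chi> x y. if \<forall>k. k \<noteq> i \<and> k \<noteq> j \<longrightarrow> x k = y k then W $ (x i, x j) $ (y i, y j) else 0)"

definition tensor_power :: "'d::finite op \<Rightarrow> ('n::finite \<Rightarrow> 'd) op"
  where "tensor_power A = (\<chi> x y. \<Prod>k\<in>UNIV. A $ x k $ y k)"

text \<open>\<open>(perm_op \<sigma> \<psi>)(x) = \<psi>(x \<circ> \<sigma>)\<close>: the vector in factor \<open>k\<close> is moved to factor \<open>\<sigma> k\<close>.\<close>

definition perm_op :: "('n \<Rightarrow> 'n) \<Rightarrow> ('n::finite \<Rightarrow> 'd::finite) op"
  where "perm_op \<sigma> = (\<chi> x y. if y = x \<circ> \<sigma> then 1 else 0)"

definition sym_density :: "('n::finite \<Rightarrow> 'd::finite) op \<Rightarrow> bool"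
  where "sym_density \<Gamma> \<longleftrightarrow>
    density_op \<Gamma> \<and> (\<forall>\<sigma>. bij \<sigma> \<longrightarrow> perm_op \<sigma> ** \<Gamma> ** adj (perm_op \<sigma>) = \<Gamma>)"

definition dissipator :: "'a::finite op \<Rightarrow> 'a op \<Rightarrow> 'a op"
  where "dissipator L A = L ** A ** adj L - (1/2) *\<^sub>R (adj L ** L ** A + A ** adj L ** L)"

definition hamiltonian ::
    "'d::finite op \<Rightarrow> ('d \<times> 'd) op \<Rightarrow> ('n::{finite,linorder} \<Rightarrow> 'd) op"
  where "hamiltonian h W = (\<Sum>j\<in>UNIV. one_body j h)
    + (1 / (real CARD('n) - 1)) *\<^sub>R (\<Sum>(i, j)\<in>{(i, j). i < j}. two_body i j W)"

definition mean_field :: "('d \<times> 'd) op \<Rightarrow> 'd::finite op \<Rightarrow> 'd op"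
  where "mean_field W \<gamma> = ptrace2 ((mat 1 \<otimes>\<^sub>2 \<gamma>) ** W)"

text \<open>At \<open>t = 0\<close> the derivative is one-sided.  Continuity of the derivative is automatic in both
  equations, their right-hand sides being polynomial in the unknown.\<close>

definition lindblad_solution ::
    "'d::finite op \<Rightarrow> 'd op \<Rightarrow> ('d \<times> 'd) op \<Rightarrow> (real \<Rightarrow> ('n::{finite,linorder} \<Rightarrow> 'd) op) \<Rightarrow> bool"
  where "lindblad_solution h L W \<Gamma> \<longleftrightarrow> (\<forall>t\<ge>0.
    (\<Gamma> has_vector_derivative
       ((- \<i>) *\<^sub>C comm (hamiltonian h W) (\<Gamma> t) + (\<Sum>j\<in>UNIV. dissipator (one_body j L) (\<Gamma> t))))
    (at t within {0..}))"

definition hartree_lindblad_solution ::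
    "'d::finite op \<Rightarrow> 'd op \<Rightarrow> ('d \<times> 'd) op \<Rightarrow> (real \<Rightarrow> 'd op) \<Rightarrow> bool"
  where "hartree_lindblad_solution h L W \<gamma> \<longleftrightarrow> (\<forall>t\<ge>0.
    (\<gamma> has_vector_derivative
       ((- \<i>) *\<^sub>C comm (h + mean_field W (\<gamma> t)) (\<gamma> t) + dissipator L (\<gamma> t)))
    (at t within {0..}))"

definition C_const :: "('d::finite \<times> 'd) op \<Rightarrow> real \<Rightarrow> ereal"
  where "C_const W m = (SUP \<gamma>\<in>{\<gamma>. density_op \<gamma> \<and> m *\<^sub>R mat 1 \<preceq> \<gamma>}.
    ereal (op_norm ((- \<i>) *\<^sub>C comm (W - mean_field W \<gamma> \<otimes>\<^sub>2 mat 1) (op_log \<gamma> \<otimes>\<^sub>2 mat 1))))"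

end

theory Submission
  imports Defs "HOL-Real_Asymp.Real_Asymp"
begin

text \<open>
  Let \<open>\<rho> = \<gamma>\<^sub>t\<^sup>\<otimes>\<^sup>N\<close>.  It follows the same Lindblad flow as \<open>\<Gamma>\<close> up to a Hamiltonian difference \<open>K\<close>, so by data
  processing the upper derivative of \<open>S(\<Gamma>, \<rho>)\<close> is at most \<open>tr \<Gamma> (- \<i> [K, log \<rho>])\<close>.  This commutator is
  \<open>1/(N-1) \<Sum>\<^sub>i\<^sub>\<noteq>\<^sub>j R\<^sub>i\<^sub>j\<close> with \<open>R = - \<i> [W - V \<otimes> 1, log \<gamma> \<otimes> 1]\<close>, both of whose partial traces against \<open>\<gamma>\<close> vanish.
  The Gibbs inequality bounds the expectation by \<open>32 C (S + log (tr \<rho> exp (1/(32 C (N-1)) \<Sum> R\<^sub>i\<^sub>j)))\<close>;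
  expanding the exponential, the two cancellations leave so few words that the trace is at most 2.  Gronwall
  concludes.

  Data processing and the Gibbs inequality both come from a representation of the relative entropy as an
  integral of suprema of functionals linear in the two states.  Because \<open>L\<close> is normal, the identity
  is stationary: lower bounds on the states are preserved, and \<open>\<Gamma>\<close> may be mixed with the identity to make it
  invertible.
\<close>

section \<open>Matrix algebra\<close>

text \<open>The obstacle is that the two states do not commute and that the logarithm of a moving
  operator has no convenient derivative. It is never differentiated: the test operator that is
  optimal at the later time is carried back to the earlier one. This bounds upper right difference
  quotients only, so the Gronwall lemma is stated for those. The logarithm of the product state is
  used at a fixed time, where it is a sum of one-body logarithms. The nonlinear Hartree equation is
  at each instant a Lindblad equation whose Hamiltonian is frozen at
  \<open>h + mean_field W (\<gamma> t)\<close>. The mean field has one term per particle; spread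
  over the N - 1 partners of that particle, it meets the prefactor 1/(N-1) of the interaction
  exactly. The two cancellations have different origins: the partial trace over the second factor
  vanishes because the mean field is the average of W in the state \<gamma>, the one over the first
  because \<gamma> commutes with its logarithm. A product of pair operators then has expectation
  zero as soon as some label occurs in it exactly once. The additive log 2 is the logarithm of the
  bound on the exponential moment.\<close>

lemma matrix_add_rdistrib: "(A + B) ** C = A ** C + B ** (C::'a::finite op)"
  by (simp add: matrix_matrix_mult_def vec_eq_iff distrib_right sum.distrib)

lemma matrix_diff_rdistrib: "(A - B) ** C = A ** C - B ** (C::'a::finite op)"
  by (simp add: matrix_matrix_mult_def vec_eq_iff left_diff_distrib sum_subtractf)

lemma matrix_diff_ldistrib: "C ** (A - B) = C ** A - C ** (B::'a::finite op)"
  by (simp add: matrix_matrix_mult_def vec_eq_iff right_diff_distrib sum_subtractf)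

lemma matrix_minus_left: "(- A) ** B = - (A ** (B::'a::finite op))"
  by (simp add: matrix_matrix_mult_def vec_eq_iff sum_negf)

lemma matrix_minus_right: "A ** (- B) = - (A ** (B::'a::finite op))"
  by (simp add: matrix_matrix_mult_def vec_eq_iff sum_negf)

lemma matrix_scaleR_left: "(r *\<^sub>R A) ** B = r *\<^sub>R (A ** (B::'a::finite op))"
  by (simp add: matrix_matrix_mult_def vec_eq_iff scaleR_sum_right)

lemma matrix_scaleR_right: "A ** (r *\<^sub>R B) = r *\<^sub>R (A ** (B::'a::finite op))"
  by (simp add: matrix_matrix_mult_def vec_eq_iff scaleR_sum_right)

lemma matrix_zero_left: "0 ** B = (0::'a::finite op)"
  by (simp add: matrix_matrix_mult_def vec_eq_iff)

lemma matrix_zero_right: "B ** 0 = (0::'a::finite op)"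
  by (simp add: matrix_matrix_mult_def vec_eq_iff)

lemma matrix_sum_left: "(\<Sum>i\<in>I. A i) ** B = (\<Sum>i\<in>I. A i ** (B::'a::finite op))"
  by (induction I rule: infinite_finite_induct) (auto simp: matrix_zero_left matrix_add_rdistrib)

lemma matrix_sum_right: "B ** (\<Sum>i\<in>I. A i) = (\<Sum>i\<in>I. B ** (A i :: 'a::finite op))"
  by (induction I rule: infinite_finite_induct) (auto simp: matrix_zero_right matrix_add_ldistrib)

lemma cscale_left: "(c *\<^sub>C A) ** B = c *\<^sub>C (A ** B)"
  by (simp add: cscale_def matrix_matrix_mult_def vec_eq_iff sum_distrib_left mult.assoc)

lemma cscale_right: "A ** (c *\<^sub>C B) = c *\<^sub>C (A ** B)"
  by (simp add: cscale_def matrix_matrix_mult_def vec_eq_iff sum_distrib_left algebra_simps)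

lemma cscale_add: "c *\<^sub>C (A + B) = c *\<^sub>C A + c *\<^sub>C B"
  by (simp add: cscale_def vec_eq_iff algebra_simps)

lemma cscale_diff: "c *\<^sub>C (A - B) = c *\<^sub>C A - c *\<^sub>C B"
  by (simp add: cscale_def vec_eq_iff algebra_simps)

lemma cscale_minus: "c *\<^sub>C (- A) = - (c *\<^sub>C A)"
  by (simp add: cscale_def vec_eq_iff)

lemma cscale_neg: "(- c) *\<^sub>C A = - (c *\<^sub>C A)"
  by (simp add: cscale_def vec_eq_iff)

lemma cscale_zero [simp]: "c *\<^sub>C 0 = (0 :: 'a::finite op)"
  by (simp add: cscale_def vec_eq_iff)

lemma cscale_sum: "c *\<^sub>C (\<Sum>i\<in>I. A i) = (\<Sum>i\<in>I. c *\<^sub>C A i)"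
  by (induction I rule: infinite_finite_induct) (auto simp: cscale_add)

lemma cscale_scaleR: "c *\<^sub>C (r *\<^sub>R A) = r *\<^sub>R (c *\<^sub>C A)"
  by (simp add: cscale_def vec_eq_iff)

lemma cscale_cscale: "c *\<^sub>C (d *\<^sub>C A) = (c * d) *\<^sub>C A"
  by (simp add: cscale_def vec_eq_iff)

lemmas op_linear = matrix_add_rdistrib matrix_add_ldistrib matrix_diff_rdistrib matrix_diff_ldistrib
  matrix_minus_left matrix_minus_right matrix_scaleR_left matrix_scaleR_right
  cscale_left cscale_right cscale_add cscale_diff cscale_minus cscale_neg cscale_scaleR
  scaleR_add_right scaleR_diff_right matrix_zero_left matrix_zero_right

lemma adj_nth [simp]: "adj A $ i $ j = cnj (A $ j $ i)"
  by (simp add: adj_def)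

lemma adj_adj [simp]: "adj (adj A) = A"
  by (simp add: vec_eq_iff)

lemma adj_add: "adj (A + B) = adj A + adj B"
  by (simp add: vec_eq_iff)

lemma adj_diff: "adj (A - B) = adj A - adj B"
  by (simp add: vec_eq_iff)

lemma adj_minus: "adj (- A) = - adj A"
  by (simp add: vec_eq_iff)

lemma adj_zero [simp]: "adj 0 = 0"
  by (simp add: vec_eq_iff)

lemma adj_scaleR: "adj (r *\<^sub>R A) = r *\<^sub>R adj A"
  by (simp add: vec_eq_iff)

lemma adj_cscale: "adj (c *\<^sub>C A) = cnj c *\<^sub>C adj A"
  by (simp add: vec_eq_iff cscale_def)

lemma adj_sum: "adj (\<Sum>i\<in>I. A i) = (\<Sum>i\<in>I. adj (A i))"
  by (induction I rule: infinite_finite_induct) (auto simp: adj_add)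

lemma adj_mult: "adj (A ** B) = adj B ** adj A"
  by (simp add: vec_eq_iff matrix_matrix_mult_def mult.commute)

lemma adj_mat [simp]: "adj (mat 1) = mat 1"
  by (auto simp: vec_eq_iff mat_def)

lemmas adj_simps = adj_add adj_diff adj_minus adj_scaleR adj_cscale adj_mult adj_sum

text \<open>The Euclidean inner product of matrices is the real part of the Hilbert-Schmidt product.
  All trace estimates below are written with it, so Cauchy-Schwarz and the calculus of inner
  products apply directly.\<close>

lemma inner_op_eq: "A \<bullet> B = Re (trace (adj A ** (B :: 'a::finite op)))"
proof -
  have "A \<bullet> B = (\<Sum>i\<in>UNIV. \<Sum>j\<in>UNIV. Re (cnj (A $ i $ j) * B $ i $ j))"
    by (simp add: inner_vec_def inner_complex_def)
  also have "\<dots> = (\<Sum>j\<in>UNIV. \<Sum>i\<in>UNIV. Re (cnj (A $ i $ j) * B $ i $ j))"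
    by (rule sum.swap)
  finally show ?thesis
    by (simp add: trace_def matrix_matrix_mult_def)
qed

lemma trace_adj: "trace (adj A) = cnj (trace A)"
  by (simp add: trace_def)

lemma trace_scaleR: "trace (r *\<^sub>R A) = r *\<^sub>R trace (A :: 'a::finite op)"
  by (simp add: trace_def scaleR_sum_right)

lemma trace_cscale: "trace (c *\<^sub>C A) = c * trace A"
  by (simp add: trace_def cscale_def sum_distrib_left)

lemma trace_sum: "trace (\<Sum>i\<in>I. A i) = (\<Sum>i\<in>I. trace (A i :: 'a::finite op))"
  by (induction I rule: infinite_finite_induct) (auto simp: trace_add, simp_all add: trace_def)

lemma inner_mult_left: "X \<bullet> (A ** Y) = (adj A ** X) \<bullet> (Y :: 'a::finite op)"
  by (simp add: inner_op_eq adj_mult matrix_mul_assoc)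

lemma inner_mult_right: "X \<bullet> (Y ** A) = (X ** adj A) \<bullet> (Y :: 'a::finite op)"
proof -
  have "trace (adj X ** Y ** A) = trace (A ** (adj X ** Y))"
    by (rule trace_mul_sym)
  then show ?thesis
    by (simp only: inner_op_eq adj_mult adj_adj matrix_mul_assoc)
qed

lemma inner_adj: "adj X \<bullet> adj Y = X \<bullet> Y"
proof -
  have "adj X \<bullet> adj Y = Re (trace (Y ** adj X))"
    using trace_adj[of "Y ** adj X"] by (simp add: inner_op_eq adj_mult)
  also have "\<dots> = Re (trace (adj X ** Y))"
    by (simp only: trace_mul_sym[of Y "adj X"])
  finally show ?thesis by (simp add: inner_op_eq)
qed

lemma norm_adj [simp]: "norm (adj X) = norm X"
  by (simp add: norm_eq_sqrt_inner inner_adj)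

text \<open>The library norm of a matrix is the Frobenius norm, which is submultiplicative by
  Cauchy-Schwarz in each entry of the product.\<close>

lemma matrix_norm_mult: "norm (A ** B) \<le> norm (A :: 'a::finite op) * norm (B :: 'a op)"
proof -
  have e: "cmod ((A ** B) $ i $ j) \<le> norm (A $ i) * norm (adj B $ j)" for i j
  proof -
    have "cmod ((A ** B) $ i $ j) \<le> (\<Sum>k\<in>UNIV. cmod (A $ i $ k) * cmod (adj B $ j $ k))"
      using norm_sum[of "\<lambda>k. A $ i $ k * B $ k $ j" UNIV]
      by (simp add: matrix_matrix_mult_def norm_mult)
    also have "\<dots> \<le> L2_set (\<lambda>k. cmod (A $ i $ k)) UNIV * L2_set (\<lambda>k. cmod (adj B $ j $ k)) UNIV"
      using L2_set_mult_ineq[of "\<lambda>k. cmod (A $ i $ k)" "\<lambda>k. cmod (adj B $ j $ k)" UNIV] by simp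
    finally show ?thesis by (simp add: norm_vec_def)
  qed
  have sq: "(norm X)\<^sup>2 = (\<Sum>i\<in>UNIV. (norm (X $ i))\<^sup>2)" for X :: "'a op"
    unfolding norm_vec_def[of X] L2_set_def by (simp add: sum_nonneg)
  have sq': "(norm X)\<^sup>2 = (\<Sum>i\<in>UNIV. (norm (X $ i))\<^sup>2)" for X :: "complex^'a"
    unfolding norm_vec_def[of X] L2_set_def by (simp add: sum_nonneg)
  have "(norm (A ** B))\<^sup>2 = (\<Sum>i\<in>UNIV. \<Sum>j\<in>UNIV. (cmod ((A ** B) $ i $ j))\<^sup>2)"
    by (simp add: sq sq')
  also have "\<dots> \<le> (\<Sum>i\<in>UNIV. \<Sum>j\<in>UNIV. (norm (A $ i) * norm (adj B $ j))\<^sup>2)"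
    by (intro sum_mono power_mono e) auto
  also have "\<dots> = (\<Sum>i\<in>UNIV. (norm (A $ i))\<^sup>2) * (\<Sum>j\<in>UNIV. (norm (adj B $ j))\<^sup>2)"
    by (simp add: power_mult_distrib sum_product)
  also have "\<dots> = (norm A * norm B)\<^sup>2"
    by (simp add: sq[symmetric] power_mult_distrib)
  finally show ?thesis
    by (rule power2_le_imp_le) simp
qed

lemma bounded_bilinear_op_mult: "bounded_bilinear ((**) :: 'a::finite op \<Rightarrow> 'a op \<Rightarrow> 'a op)"
  by unfold_locales (auto simp: op_linear intro!: exI[of _ 1] matrix_norm_mult)

lemma bounded_linear_adj: "bounded_linear (adj :: 'a::finite op \<Rightarrow> _)"
  by unfold_locales (auto simp: adj_simps intro!: exI[of _ 1])

lemma bounded_linear_trace: "bounded_linear (trace :: 'a::finite op \<Rightarrow> complex)"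
  unfolding linear_conv_bounded_linear[symmetric]
  by unfold_locales (auto simp: trace_add trace_scaleR)

lemma cinner_Re: "a \<bullet> b = Re (cnj a * b)"
  by (simp add: inner_complex_def)

lemma inner_adj_vec: "x \<bullet> (A *v y) = (adj A *v x) \<bullet> y"
proof -
  have "x \<bullet> (A *v y) = (\<Sum>i\<in>UNIV. \<Sum>j\<in>UNIV. Re (cnj (x $ i) * A $ i $ j * y $ j))"
    by (simp add: inner_vec_def cinner_Re matrix_vector_mult_def
        sum_distrib_left mult.assoc del: times_complex.sel)
  also have "\<dots> = (\<Sum>j\<in>UNIV. \<Sum>i\<in>UNIV. Re (cnj (x $ i) * A $ i $ j * y $ j))"
    by (rule sum.swap)
  also have "\<dots> = (adj A *v x) \<bullet> y"
    by (simp add: inner_vec_def cinner_Re matrix_vector_mult_def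
        sum_distrib_right sum_distrib_left mult_ac del: times_complex.sel)
  finally show ?thesis .
qed

section \<open>Diagonal and unitary matrices\<close>

definition diag :: "('a \<Rightarrow> complex) \<Rightarrow> 'a::finite op"
  where "diag d = (\<chi> i j. if i = j then d i else 0)"

lemma diag_nth [simp]: "diag d $ i $ j = (if i = j then d i else 0)"
  by (simp add: diag_def)

lemma diag_mult_nth: "(diag d ** A) $ i $ j = d i * A $ i $ j"
  by (simp add: matrix_matrix_mult_def if_distrib if_distribR cong: if_cong)

lemma mult_diag_nth: "(A ** diag d) $ i $ j = A $ i $ j * d j"
  by (simp add: matrix_matrix_mult_def if_distrib if_distribR cong: if_cong)

lemma diag_vec_nth: "(diag d *v x) $ i = d i * x $ i"
  by (simp add: matrix_vector_mult_def if_distrib if_distribR cong: if_cong)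

lemma diag_mult: "diag d ** diag e = diag (\<lambda>i. d i * e i)"
  by (simp add: vec_eq_iff diag_mult_nth)

lemma diag_one: "diag (\<lambda>_. 1) = mat 1"
  by (auto simp: vec_eq_iff mat_def)

lemma adj_diag: "adj (diag d) = diag (\<lambda>i. cnj (d i))"
  by (auto simp: vec_eq_iff)

lemma trace_diag: "trace (diag d) = (\<Sum>i\<in>UNIV. d i)"
  by (simp add: trace_def)

lemma diag_add: "diag d + diag e = diag (\<lambda>i. d i + e i)"
  by (simp add: vec_eq_iff)

definition unitary :: "'a::finite op \<Rightarrow> bool"
  where "unitary Q \<longleftrightarrow> adj Q ** Q = mat 1 \<and> Q ** adj Q = mat 1"

lemma mult_left_cancel_unitary: "unitary Q \<Longrightarrow> adj Q ** (Q ** A) = A"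
  by (simp add: matrix_mul_assoc unitary_def)

lemma unitary_left: "adj Q ** Q = mat 1 \<Longrightarrow> unitary Q"
  unfolding unitary_def using matrix_left_right_inverse by blast

lemma unitary_adj: "unitary Q \<Longrightarrow> unitary (adj Q)"
  by (simp add: unitary_def)

lemma unitary_mult: "unitary P \<Longrightarrow> unitary Q \<Longrightarrow> unitary (P ** Q)"
proof (rule unitary_left)
  assume "unitary P" "unitary Q"
  then have "adj Q ** (adj P ** P) ** Q = mat 1"
    by (simp add: unitary_def)
  then show "adj (P ** Q) ** (P ** Q) = mat 1"
    by (simp add: adj_mult matrix_mul_assoc)
qed

lemma unitary_diag: "(\<And>i. cmod (d i) = 1) \<Longrightarrow> unitary (diag d)"
proof (rule unitary_left)
  assume *: "\<And>i. cmod (d i) = 1"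
  have "cnj (d i) * d i = 1" for i
    using complex_norm_square[of "d i"] * by (simp add: mult.commute)
  then show "adj (diag d) ** diag d = mat 1"
    by (simp add: adj_diag diag_mult flip: diag_one)
qed

lemma inner_unitary:
  fixes P Q X Y :: "'a::finite op"
  assumes "unitary P" "unitary Q"
  shows "(P ** X ** Q) \<bullet> (P ** Y ** Q) = X \<bullet> Y"
proof -
  have "(P ** X ** Q) \<bullet> (P ** Y ** Q) = ((adj P ** P) ** X ** (Q ** adj Q)) \<bullet> Y"
    unfolding inner_mult_right[of _ "P ** Y" Q] inner_mult_left[of _ P Y] by (simp add: matrix_mul_assoc)
  then show ?thesis using assms by (simp add: unitary_def)
qed

lemma norm_unitary_vec:
  assumes "unitary Q" shows "norm (Q *v x) = norm x"
  using assms by (simp add: norm_eq_sqrt_inner inner_adj_vec matrix_vector_mul_assoc unitary_def)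

section \<open>Spectral theorem and functional calculus\<close>

definition unit_op :: "'a \<Rightarrow> 'a \<Rightarrow> 'a::finite op"
  where "unit_op p q = (\<chi> a b. if a = p \<and> b = q then 1 else 0)"

lemma unit_op_nth [simp]: "unit_op p q $ a $ b = (if a = p \<and> b = q then 1 else 0)"
  by (simp add: unit_op_def)

lemma adj_unit_op: "adj (unit_op p q) = unit_op q p"
  by (auto simp: vec_eq_iff)

lemma unit_op_mult_nth: "(unit_op p q ** M) $ a $ b = (if a = p then M $ q $ b else 0)"
  by (auto simp: matrix_matrix_mult_def if_distrib if_distribR sum.delta' cong: if_cong)

lemma unit_op_mult: "unit_op p q ** unit_op r s = (if q = r then unit_op p s else 0)"
  by (auto simp: vec_eq_iff unit_op_mult_nth)

lemma trace_unit_op_mult: "trace (unit_op p q ** M) = M $ q $ p"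
  unfolding trace_def unit_op_mult_nth by simp

lemma norm_unitary_sq:
  assumes "unitary (Q :: 'a::finite op)" shows "(norm Q)\<^sup>2 = real CARD('a)"
  using assms by (simp add: power2_norm_eq_inner inner_op_eq unitary_def trace_I)

lemma compact_unitary: "compact {Q :: 'a::finite op. unitary Q}"
proof (unfold compact_eq_bounded_closed, intro conjI)
  have "norm Q \<le> sqrt (real CARD('a))" if "unitary Q" for Q :: "'a op"
    using norm_unitary_sq[OF that] by (simp add: real_le_rsqrt)
  then show "bounded {Q :: 'a op. unitary Q}"
    unfolding bounded_iff by blast
  have "continuous_on UNIV (\<lambda>Q :: 'a op. adj Q ** Q)"
    by (intro bounded_bilinear.continuous_on[OF bounded_bilinear_op_mult]
        bounded_linear.continuous_on[OF bounded_linear_adj] continuous_on_id)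
  then have "closed ((\<lambda>Q :: 'a op. adj Q ** Q) -` {mat 1})"
    by (intro continuous_closed_vimage) (auto simp: continuous_on_eq_continuous_at)
  moreover have "(\<lambda>Q :: 'a op. adj Q ** Q) -` {mat 1} = {Q. unitary Q}"
    by (auto simp: unitary_left) (simp add: unitary_def)
  ultimately show "closed {Q :: 'a op. unitary Q}"
    by simp
qed

text \<open>The matrix is exp (\<theta> J) in closed form: \<open>J\<close> is skew-adjoint and its
  square is \<open>- P\<close>, so the exponential series collapses to cosine and sine. These curves
  through the identity are the variations used in the spectral theorem.\<close>

lemma unitary_rotation:
  fixes i j :: "'a::finite" and z :: complex and \<theta> :: real
  assumes ij: "i \<noteq> j" and z: "cmod z = 1"
  defines "J \<equiv> z *\<^sub>C unit_op j i - cnj z *\<^sub>C unit_op i j"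
    and "P \<equiv> unit_op i i + unit_op j j"
  shows "unitary (mat 1 + (cos \<theta> - 1) *\<^sub>R P + sin \<theta> *\<^sub>R J)"
proof (rule unitary_left)
  have zz: "z * cnj z = 1" "cnj z * z = 1"
    using complex_norm_square[of z] z by (auto simp: mult.commute)
  have one: "1 *\<^sub>C A = A" for A :: "'a op"
    by (simp add: cscale_def vec_eq_iff)
  have J: "adj J = - J" "J ** J = - P" "P ** J = J" "J ** P = J" "P ** P = P" "adj P = P"
    using ij by (simp_all add: J_def P_def adj_simps adj_unit_op op_linear unit_op_mult
        cscale_cscale zz one)
  define a b where "a = cos \<theta> - 1" and "b = sin \<theta>"
  have "adj (mat 1 + a *\<^sub>R P + b *\<^sub>R J) ** (mat 1 + a *\<^sub>R P + b *\<^sub>R J)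
      = mat 1 + (2 * a + a\<^sup>2 + b\<^sup>2) *\<^sub>R P"
    by (simp add: adj_simps J op_linear)
      (simp add: vec_eq_iff scaleR_conv_of_real algebra_simps power2_eq_square)
  also have "2 * a + a\<^sup>2 + b\<^sup>2 = 0"
    using sin_cos_squared_add[of \<theta>] by (simp add: a_def b_def power2_eq_square algebra_simps)
  finally show "adj (mat 1 + (cos \<theta> - 1) *\<^sub>R P + sin \<theta> *\<^sub>R J)
      ** (mat 1 + (cos \<theta> - 1) *\<^sub>R P + sin \<theta> *\<^sub>R J) = mat 1"
    by (simp add: a_def b_def)
qed

text \<open>Eigenvalues are indexed by the basis type itself, with repetitions allowed. Every
  self-adjoint operator is brought to this form, on which the functional calculus acts
  entrywise.\<close>

definition spec :: "'a::finite op \<Rightarrow> ('a \<Rightarrow> real) \<Rightarrow> 'a op"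
  where "spec Q d = Q ** diag (\<lambda>i. complex_of_real (d i)) ** adj Q"

text \<open>For a diagonal matrix \<open>D\<close> with distinct entries, a maximiser \<open>Q\<close> of \<open>tr (D Q\<^sup>* A Q)\<close>
  over the unitary group diagonalises \<open>A\<close>: stationarity forces \<open>Q\<^sup>* A Q\<close> to commute with \<open>D\<close>.\<close>

theorem spectral:
  fixes A :: "'a::finite op"
  assumes A: "self_adjoint A"
  obtains Q d where "unitary Q" "A = spec Q d"
proof -
  obtain w :: "'a \<Rightarrow> nat" where w: "inj w"
    using finite_imp_inj_to_nat_seg[of "UNIV :: 'a set"] by auto
  define D where "D = diag (\<lambda>k. complex_of_real (real (w k)))"
  define f where "f = (\<lambda>Q. D \<bullet> (adj Q ** A ** Q))"
  have cont: "continuous_on {Q. unitary Q} f"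
    unfolding f_def
    by (intro bounded_bilinear.continuous_on[OF bounded_bilinear_op_mult] continuous_on_inner
        bounded_linear.continuous_on[OF bounded_linear_adj] continuous_on_id continuous_on_const)
  have "unitary (mat 1 :: 'a op)"
    by (simp add: unitary_def)
  then obtain Q where Q: "unitary Q" and max: "\<And>P. unitary P \<Longrightarrow> f P \<le> f Q"
    using continuous_attains_sup[OF compact_unitary _ cont] by auto
  define B where "B = adj Q ** A ** Q"
  have adjB: "adj B = B"
    using A by (simp add: B_def adj_simps self_adjoint_def matrix_mul_assoc)
  have re0: "Re (z * B $ i $ j) = 0" if ij: "i \<noteq> j" and z: "cmod z = 1" for i j z
  proof -
    define J where "J = z *\<^sub>C unit_op j i - cnj z *\<^sub>C unit_op i j"
    define P where "P = unit_op i i + (unit_op j j :: 'a op)"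
    define G where "G = (\<lambda>\<theta>. mat 1 + (cos \<theta> - 1) *\<^sub>R P + sin \<theta> *\<^sub>R J)"
    have uG: "unitary (G \<theta>)" for \<theta>
      unfolding G_def J_def P_def by (rule unitary_rotation[OF ij z])
    have G': "(G has_vector_derivative J) (at 0)"
      unfolding G_def
      by (auto intro!: derivative_eq_intros has_vector_derivative_real_field simp: has_vector_derivative_def)
    have G0: "G 0 = mat 1"
      by (simp add: G_def)
    define g where "g = (\<lambda>\<theta>. D \<bullet> (adj (G \<theta>) ** B ** G \<theta>))"
    have "((\<lambda>\<theta>. adj (G \<theta>)) has_vector_derivative adj J) (at 0)"
      by (rule bounded_linear.has_vector_derivative[OF bounded_linear_adj G'])
    then have "((\<lambda>\<theta>. adj (G \<theta>) ** B) has_vector_derivative adj J ** B) (at 0)"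
      by (rule bounded_linear.has_vector_derivative[OF bounded_bilinear.bounded_linear_left[OF bounded_bilinear_op_mult]])
    then have "((\<lambda>\<theta>. adj (G \<theta>) ** B ** G \<theta>) has_vector_derivative
        (adj (G 0) ** B ** J + adj J ** B ** G 0)) (at 0)"
      by (rule bounded_bilinear.has_vector_derivative[OF bounded_bilinear_op_mult _ G'])
    then have "(g has_vector_derivative (D \<bullet> (B ** J + adj J ** B))) (at 0)"
      unfolding g_def G0
      using bounded_linear.has_vector_derivative[OF bounded_linear_inner_right] by fastforce
    then have "(g has_real_derivative (D \<bullet> (B ** J + adj J ** B))) (at 0)"
      by (simp add: has_real_derivative_iff_has_vector_derivative)
    moreover have "g \<theta> \<le> g 0" for \<theta>
    proof -
      have "f (Q ** G \<theta>) \<le> f Q"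
        by (intro max unitary_mult Q uG)
      then show ?thesis
        by (simp add: f_def g_def B_def G0 adj_mult matrix_mul_assoc)
    qed
    ultimately have "D \<bullet> (B ** J + adj J ** B) = 0"
      using DERIV_local_max[of g _ 0 1] by auto
    moreover have "adj J = - J"
      by (simp add: J_def adj_simps adj_unit_op op_linear)
    ultimately have "D \<bullet> (B ** J - J ** B) = 0"
      by (simp add: op_linear)
    moreover have "D \<bullet> (B ** J) = Re (trace (J ** (D ** B)))"
    proof -
      have "trace (D ** B ** J) = trace (J ** (D ** B))"
        by (rule trace_mul_sym)
      then show ?thesis by (simp add: inner_op_eq D_def adj_diag matrix_mul_assoc)
    qed
    moreover have "D \<bullet> (J ** B) = Re (trace (J ** (B ** D)))"
    proof -
      have "trace (D ** (J ** B)) = trace (J ** B ** D)"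
        by (rule trace_mul_sym)
      then show ?thesis by (simp add: inner_op_eq D_def adj_diag matrix_mul_assoc)
    qed
    moreover have "trace (J ** M) = z * M $ i $ j - cnj z * M $ j $ i" for M
      unfolding J_def by (simp add: op_linear trace_sub trace_cscale trace_unit_op_mult)
    ultimately have "Re (z * (w i * B $ i $ j) - cnj z * (w j * B $ j $ i))
       = Re (z * (B $ i $ j * w j) - cnj z * (B $ j $ i * w i))"
      by (simp add: inner_diff_right D_def diag_mult_nth mult_diag_nth)
    moreover have "B $ j $ i = cnj (B $ i $ j)"
      using adjB by (metis adj_nth)
    \<comment> \<open>The two summands on each side are conjugates of each other up to the weights,
      so the equation reads 2 (w i - w j) Re (z B_ij) = 0. The phase z is free: the values 1 and
      \<open>\<i>\<close> kill the real and the imaginary part.\<close>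
    ultimately have "(real (w i) - real (w j)) * Re (z * B $ i $ j) = 0"
      by (simp add: algebra_simps)
    moreover have "w i \<noteq> w j"
      using w ij by (auto dest: injD)
    ultimately show ?thesis by simp
  qed
  have "B $ i $ j = 0" if "i \<noteq> j" for i j
    using re0[OF that, of 1] re0[OF that, of "\<i>"] by (simp add: complex_eq_iff)
  moreover have "B $ i $ i = complex_of_real (Re (B $ i $ i))" for i
  proof -
    have "cnj (B $ i $ i) = B $ i $ i" using adjB by (metis adj_nth)
    then show ?thesis by (simp add: complex_eq_iff)
  qed
  ultimately have B: "B = diag (\<lambda>i. complex_of_real (Re (B $ i $ i)))"
    by (simp add: vec_eq_iff)
  have "A = Q ** B ** adj Q"
    using Q unfolding B_def by (metis matrix_mul_assoc matrix_mul_lid matrix_mul_rid unitary_def)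
  then have "A = spec Q (\<lambda>i. Re (B $ i $ i))"
    using B by (simp add: spec_def)
  then show thesis using that Q by blast
qed

lemma adj_spec [simp]: "adj (spec Q d) = spec Q d"
  by (simp add: spec_def adj_simps adj_diag matrix_mul_assoc)

lemma self_adjoint_spec [simp]: "self_adjoint (spec Q d)"
  by (simp add: self_adjoint_def)

lemma spec_mult:
  assumes "unitary Q" shows "spec Q d ** spec Q e = spec Q (\<lambda>i. d i * e i)"
proof -
  have "spec Q d ** spec Q e = Q ** diag (\<lambda>i. complex_of_real (d i)) ** (adj Q ** Q)
      ** diag (\<lambda>i. complex_of_real (e i)) ** adj Q"
    by (simp add: spec_def matrix_mul_assoc)
  also have "\<dots> = Q ** (diag (\<lambda>i. complex_of_real (d i)) ** diag (\<lambda>i. complex_of_real (e i))) ** adj Q"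
    using assms by (simp add: unitary_def matrix_mul_assoc)
  finally show ?thesis by (simp add: spec_def diag_mult)
qed

lemma spec_add: "spec Q d + spec Q e = spec Q (\<lambda>i. d i + e i)"
  by (simp add: spec_def diag_add[symmetric] op_linear)

lemma spec_scaleR: "r *\<^sub>R spec Q d = spec Q (\<lambda>i. r * d i)"
proof -
  have "diag (\<lambda>i. complex_of_real (r * d i)) = r *\<^sub>R diag (\<lambda>i. complex_of_real (d i))"
    by (simp add: vec_eq_iff) (simp add: scaleR_conv_of_real)
  then show ?thesis by (simp add: spec_def op_linear)
qed

lemma spec_one: "unitary Q \<Longrightarrow> spec Q (\<lambda>_. 1) = mat 1"
  by (simp add: spec_def diag_one unitary_def)

lemma trace_spec:
  assumes "unitary Q" shows "trace (spec Q d) = complex_of_real (\<Sum>i\<in>UNIV. d i)"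
proof -
  have "trace (spec Q d) = trace (adj Q ** (Q ** diag (\<lambda>i. complex_of_real (d i))))"
    unfolding spec_def by (rule trace_mul_sym)
  then show ?thesis using assms by (simp add: mult_left_cancel_unitary trace_diag)
qed

lemma unitary_conj_spec: "P ** spec Q d ** adj P = spec (P ** Q) d"
  by (simp add: spec_def adj_mult matrix_mul_assoc)

lemma spec_vec: "spec Q d *v x = Q *v (diag (\<lambda>i. complex_of_real (d i)) *v (adj Q *v x))"
  by (simp add: spec_def matrix_vector_mul_assoc matrix_mul_assoc)

lemma quadform_spec: "x \<bullet> (spec Q d *v x) = (\<Sum>i\<in>UNIV. d i * (cmod ((adj Q *v x) $ i))\<^sup>2)"
proof -
  have "x \<bullet> (spec Q d *v x) = (adj Q *v x) \<bullet> (diag (\<lambda>i. complex_of_real (d i)) *v (adj Q *v x))"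
    by (simp add: spec_vec inner_adj_vec)
  also have "\<dots> = (\<Sum>i\<in>UNIV. d i * (cmod ((adj Q *v x) $ i))\<^sup>2)"
    unfolding inner_vec_def diag_vec_nth cmod_power2
    by (simp add: inner_complex_def power2_eq_square algebra_simps)
  finally show ?thesis .
qed

lemma quadform_axis: "(\<Sum>k\<in>UNIV. d k * (cmod (axis i 1 $ k))\<^sup>2) = d (i :: 'a::finite)"
proof -
  have "d k * (cmod (axis i 1 $ k))\<^sup>2 = (if k = i then d k else 0)" for k :: 'a
    by (simp add: axis_def)
  then have "(\<Sum>k\<in>UNIV. d k * (cmod (axis i 1 $ k))\<^sup>2) = (\<Sum>k\<in>UNIV. if k = i then d k else 0)"
    by (rule sum.cong[OF refl])
  then show ?thesis by simp
qed

lemma op_vec_axis: "((A :: 'a::finite op) *v axis i 1) $ a = A $ a $ i"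
  by (simp add: matrix_vector_mult_def axis_def if_distrib cong: if_cong)

lemma norm_vec_sq: "(norm (x :: complex^'a))\<^sup>2 = (\<Sum>i\<in>UNIV. (cmod (x $ i))\<^sup>2)"
  unfolding norm_vec_def L2_set_def by (simp add: sum_nonneg)

lemma scaleR_op_vec: "(r *\<^sub>R A) *v x = r *\<^sub>R (A *v (x :: complex^'a::finite))"
  by (simp add: vec_eq_iff matrix_vector_mult_def scaleR_sum_right)

text \<open>The working form of the order. A bound by a multiple of the identity carries
  self-adjointness with it, so it also feeds \<open>spectral\<close>; the multiple 0 expresses
  nonnegativity.\<close>

lemma op_le_scaleR_iff:
  "m *\<^sub>R mat 1 \<preceq> A \<longleftrightarrow> self_adjoint A \<and> (\<forall>x. m * (norm x)\<^sup>2 \<le> x \<bullet> (A *v x))"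
  by (simp add: op_le_def nonneg_op_def self_adjoint_def adj_simps algebra_simps
      scaleR_op_vec power2_norm_eq_inner inner_diff_right)

lemma nonneg_op_iff: "nonneg_op A \<longleftrightarrow> 0 *\<^sub>R mat 1 \<preceq> A"
  by (simp add: op_le_def)

lemma op_le_spec_iff:
  assumes Q: "unitary (Q :: 'a::finite op)" shows "m *\<^sub>R mat 1 \<preceq> spec Q d \<longleftrightarrow> (\<forall>i. m \<le> d i)"
proof
  assume "\<forall>i. m \<le> d i"
  then have "m * (norm (adj Q *v x))\<^sup>2 \<le> x \<bullet> (spec Q d *v x)" for x
    unfolding quadform_spec norm_vec_sq sum_distrib_left by (intro sum_mono mult_right_mono) auto
  then show "m *\<^sub>R mat 1 \<preceq> spec Q d"
    by (simp add: op_le_scaleR_iff norm_unitary_vec[OF unitary_adj[OF Q]])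
next
  assume *: "m *\<^sub>R mat 1 \<preceq> spec Q d"
  show "\<forall>i. m \<le> d i"
  proof
    fix i
    define x where "x = Q *v axis i 1"
    have a: "adj Q *v x = axis i 1"
      using Q by (simp add: x_def matrix_vector_mul_assoc unitary_def)
    have "norm x = 1"
      using norm_unitary_vec[OF Q] by (simp add: x_def)
    then have "m \<le> x \<bullet> (spec Q d *v x)"
      using * by (auto simp: op_le_scaleR_iff dest!: spec[of _ x])
    also have "\<dots> = d i"
      by (simp add: quadform_spec a quadform_axis)
    finally show "m \<le> d i" .
  qed
qed

lemma op_norm_spec_le:
  assumes Q: "unitary (Q :: 'a::finite op)" and C: "\<And>i. \<bar>d i\<bar> \<le> C"
  shows "op_norm (spec Q d) \<le> C"
proof (unfold op_norm_def, rule onorm_le)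
  fix x
  have "0 \<le> C" using C[of undefined] by linarith
  have "(norm (spec Q d *v x))\<^sup>2 = (norm (diag (\<lambda>i. complex_of_real (d i)) *v (adj Q *v x)))\<^sup>2"
    using norm_unitary_vec[OF Q] by (simp add: spec_vec)
  also have "\<dots> = (\<Sum>i\<in>UNIV. \<bar>d i\<bar>\<^sup>2 * (cmod ((adj Q *v x) $ i))\<^sup>2)"
    by (simp add: norm_vec_sq diag_vec_nth norm_mult power_mult_distrib)
  also have "\<dots> \<le> (\<Sum>i\<in>UNIV. C\<^sup>2 * (cmod ((adj Q *v x) $ i))\<^sup>2)"
    by (intro sum_mono mult_right_mono power_mono C) auto
  also have "\<dots> = C\<^sup>2 * (norm (adj Q *v x))\<^sup>2"
    by (simp only: norm_vec_sq sum_distrib_left)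
  also have "\<dots> = (C * norm x)\<^sup>2"
    by (simp add: norm_unitary_vec[OF unitary_adj[OF Q]] power_mult_distrib)
  finally show "norm (spec Q d *v x) \<le> C * norm x"
    by (rule power2_le_imp_le) (use \<open>0 \<le> C\<close> in auto)
qed

lemma norm_op_vec_le: "norm (A *v x) \<le> op_norm A * norm (x :: complex^'a::finite)"
  unfolding op_norm_def by (rule onorm) (rule matrix_vector_mul_bounded_linear)

lemma spec_bound_op_norm:
  assumes Q: "unitary (Q :: 'a::finite op)" shows "\<bar>d i\<bar> \<le> op_norm (spec Q d)"
proof -
  define x where "x = Q *v axis i 1"
  have a: "adj Q *v x = axis i 1"
    using Q by (simp add: x_def matrix_vector_mul_assoc unitary_def)
  have x: "norm x = 1"
    using norm_unitary_vec[OF Q] by (simp add: x_def)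
  have "\<bar>d i\<bar> = \<bar>x \<bullet> (spec Q d *v x)\<bar>"
    by (simp add: quadform_spec a quadform_axis)
  also have "\<dots> \<le> norm x * norm (spec Q d *v x)"
    by (rule Cauchy_Schwarz_ineq2)
  also have "\<dots> \<le> op_norm (spec Q d)"
    using norm_op_vec_le[of "spec Q d" x] x by simp
  finally show ?thesis .
qed

lemma spec_eigen:
  assumes Q: "unitary Q"
  shows "spec Q d *v v = complex_of_real r *s v \<longleftrightarrow> (\<forall>i. (adj Q *v v) $ i \<noteq> 0 \<longrightarrow> d i = r)"
proof -
  have "spec Q d *v v = complex_of_real r *s v \<longleftrightarrow> adj Q *v (spec Q d *v v) = adj Q *v (complex_of_real r *s v)"
    by (metis Q matrix_vector_mul_assoc matrix_vector_mul_lid unitary_def)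
  also have "\<dots> \<longleftrightarrow> diag (\<lambda>i. complex_of_real (d i)) *v (adj Q *v v) = complex_of_real r *s (adj Q *v v)"
    using Q by (simp add: spec_vec matrix_vector_mul_assoc matrix_mul_assoc unitary_def vector_scalar_commute)
  also have "\<dots> \<longleftrightarrow> (\<forall>i. (adj Q *v v) $ i \<noteq> 0 \<longrightarrow> d i = r)"
    by (auto simp: vec_eq_iff diag_vec_nth)
  finally show ?thesis .
qed

text \<open>Existence: an eigenvector for r lives, in the basis Q, on the coordinates with d i = r.
  Uniqueness: the columns of Q are eigenvectors and form a basis, so they determine the
  operator.\<close>

lemma op_fun_spec:
  assumes Q: "unitary (Q :: 'a::finite op)" shows "op_fun f (spec Q d) = spec Q (\<lambda>i. f (d i))"
  unfolding op_fun_def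
proof (rule the_equality)
  show "\<forall>r v. spec Q d *v v = complex_of_real r *s v \<longrightarrow>
      spec Q (\<lambda>i. f (d i)) *v v = complex_of_real (f r) *s v"
    by (auto simp: spec_eigen[OF Q])
next
  fix B
  assume B: "\<forall>r v. spec Q d *v v = complex_of_real r *s v \<longrightarrow> B *v v = complex_of_real (f r) *s v"
  have "B *v (Q *v axis i 1) = spec Q (\<lambda>i. f (d i)) *v (Q *v axis i 1)" for i
  proof -
    have "adj Q *v (Q *v axis i 1) = axis i 1"
      using Q by (simp add: matrix_vector_mul_assoc unitary_def)
    then have "spec Q e *v (Q *v axis i 1) = complex_of_real (e i) *s (Q *v axis i 1)" for e
      by (auto simp: spec_eigen[OF Q] axis_def)
    then show ?thesis using B by auto
  qed
  then have "(B ** Q) $ a $ i = (spec Q (\<lambda>i. f (d i)) ** Q) $ a $ i" for a i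
    by (metis matrix_vector_mul_assoc op_vec_axis)
  then have "B ** Q = spec Q (\<lambda>i. f (d i)) ** Q"
    by (simp add: vec_eq_iff)
  then have "B ** Q ** adj Q = spec Q (\<lambda>i. f (d i)) ** Q ** adj Q"
    by simp
  then show "B = spec Q (\<lambda>i. f (d i))"
    using Q by (simp add: unitary_def flip: matrix_mul_assoc)
qed

lemma op_log_spec: "unitary Q \<Longrightarrow> op_log (spec Q d) = spec Q (\<lambda>i. ln (d i))"
  by (simp add: op_log_def op_fun_spec)

section \<open>Variational formulas for the relative entropy\<close>

lemma inner_op_entries: "A \<bullet> B = (\<Sum>a\<in>UNIV. \<Sum>i\<in>UNIV. Re (cnj (A $ a $ i) * (B :: 'a::finite op) $ a $ i))"
  by (simp add: inner_vec_def cinner_Re)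

lemma unitary_row: 
  assumes "unitary (U :: 'a::finite op)" shows "(\<Sum>i\<in>UNIV. (cmod (U $ a $ i))\<^sup>2) = 1"
proof -
  have "complex_of_real (\<Sum>i\<in>UNIV. (cmod (U $ a $ i))\<^sup>2) = (U ** adj U) $ a $ a"
    by (simp add: matrix_matrix_mult_def complex_norm_square del: of_real_power)
  also have "\<dots> = complex_of_real 1"
    using assms by (simp add: unitary_def mat_def)
  finally show ?thesis
    using of_real_eq_iff by blast
qed

lemma unitary_column:
  assumes "unitary (U :: 'a::finite op)" shows "(\<Sum>a\<in>UNIV. (cmod (U $ a $ i))\<^sup>2) = 1"
  using unitary_row[OF unitary_adj[OF assms], of i] by simp

text \<open>Two operators with different eigenbases are written between the same outer unitaries P
  and \<open>adj Q\<close>. These cancel in inner products, and only the overlap matrix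
  \<open>adj P ** Q\<close> remains.\<close>

lemma spec_rotate:
  assumes P: "unitary P" and Q: "unitary Q"
  shows "spec P e = P ** (diag (\<lambda>i. complex_of_real (e i)) ** (adj P ** Q)) ** adj Q"
    and "spec Q e = P ** ((adj P ** Q) ** diag (\<lambda>i. complex_of_real (e i))) ** adj Q"
proof -
  have "spec P e ** (Q ** adj Q) = P ** (diag (\<lambda>i. complex_of_real (e i)) ** (adj P ** Q)) ** adj Q"
    unfolding spec_def by (simp only: matrix_mul_assoc)
  then show "spec P e = P ** (diag (\<lambda>i. complex_of_real (e i)) ** (adj P ** Q)) ** adj Q"
    using Q by (simp add: unitary_def)
  have "(P ** adj P) ** spec Q e = P ** ((adj P ** Q) ** diag (\<lambda>i. complex_of_real (e i))) ** adj Q"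
    unfolding spec_def by (simp only: matrix_mul_assoc)
  then show "spec Q e = P ** ((adj P ** Q) ** diag (\<lambda>i. complex_of_real (e i))) ** adj Q"
    using P by (simp add: unitary_def)
qed

text \<open>The quantum pairing becomes a classical double sum with weights given by the squared
  overlaps, a doubly stochastic matrix by \<open>unitary_row\<close> and
  \<open>unitary_column\<close>.\<close>

lemma inner_spec:
  assumes P: "unitary (P :: 'a::finite op)" and Q: "unitary Q"
  shows "spec Q p \<bullet> spec P e = (\<Sum>a\<in>UNIV. \<Sum>i\<in>UNIV. (cmod ((adj P ** Q) $ a $ i))\<^sup>2 * (p i * e a))"
proof -
  define U where "U = adj P ** Q"
  have "spec Q p \<bullet> spec P e = (U ** diag (\<lambda>i. complex_of_real (p i))) \<bullet> (diag (\<lambda>i. complex_of_real (e i)) ** U)"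
    unfolding spec_rotate(1)[OF P Q] spec_rotate(2)[OF P Q] U_def
    by (rule inner_unitary[OF P unitary_adj[OF Q]])
  also have "\<dots> = (\<Sum>a\<in>UNIV. \<Sum>i\<in>UNIV. (cmod (U $ a $ i))\<^sup>2 * (p i * e a))"
    unfolding inner_op_entries diag_mult_nth mult_diag_nth cmod_power2
    by (intro sum.cong refl) (simp add: power2_eq_square algebra_simps)
  finally show ?thesis by (simp add: U_def)
qed

lemma inner_spec_same:
  assumes Q: "unitary (Q :: 'a::finite op)" shows "spec Q p \<bullet> spec Q e = (\<Sum>i\<in>UNIV. p i * e i)"
proof -
  have "spec Q p \<bullet> spec Q e = Re (trace (spec Q (\<lambda>i. p i * e i)))"
    by (simp add: inner_op_eq spec_mult[OF Q])
  then show ?thesis by (simp add: trace_spec[OF Q])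
qed

text \<open>Only the diagonal of M in the basis V enters; for a density operator M this diagonal is
  the distribution of outcomes of a measurement in that basis.\<close>

lemma inner_spec_op:
  "spec V x \<bullet> M = (\<Sum>k\<in>UNIV. x k * ((V *v axis k 1) \<bullet> ((M :: 'a::finite op) *v (V *v axis k 1))))"
proof -
  have q: "(V *v axis k 1) \<bullet> (M *v (V *v axis k 1)) = Re ((adj V ** M ** V) $ k $ k)" for k
  proof -
    have "(V *v axis k 1) \<bullet> (M *v (V *v axis k 1)) = axis k 1 \<bullet> ((adj V ** M ** V) *v axis k 1)"
      using inner_adj_vec[of "axis k 1" "adj V" "(M ** V) *v axis k 1"]
      by (simp add: matrix_vector_mul_assoc matrix_mul_assoc)
    also have "\<dots> = Re ((adj V ** M ** V) $ k $ k)"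
      by (simp add: inner_axis' op_vec_axis cinner_Re)
    finally show ?thesis .
  qed
  have "spec V x \<bullet> M = diag (\<lambda>i. complex_of_real (x i)) \<bullet> (adj V ** M ** V)"
    unfolding spec_def inner_mult_right[of _ "adj V ** M" V] inner_mult_left[of _ "adj V" M]
    by (simp add: matrix_mul_assoc)
  also have "\<dots> = (\<Sum>k\<in>UNIV. x k * Re ((adj V ** M ** V) $ k $ k))"
    by (simp add: inner_op_entries if_distrib if_distribR cong: if_cong)
  finally show ?thesis by (simp add: q)
qed

text \<open>The scalar case of the integral representation. With c = p + u (q - p) the integrand
  equals (q - p) - p (q - p) / c, and u (q - p) - p ln c is an antiderivative.\<close>

lemma relative_entropy_density_integral:
  fixes p q :: real
  assumes p: "p > 0" and q: "q > 0"
  shows "((\<lambda>u. u * ((q - p)\<^sup>2 / (u * q + (1 - u) * p))) has_integral (q - p - p * (ln q - ln p))) {0..1}"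
proof -
  have pos: "p + u * (q - p) > 0" if "u \<in> {0..1}" for u
  proof -
    have "p + u * (q - p) = u * q + (1 - u) * p"
      by (simp add: algebra_simps)
    also have "\<dots> > 0"
      using that p q by (cases "u = 0") (auto intro!: add_pos_nonneg)
    finally show ?thesis .
  qed
  have "((\<lambda>u. (q - p) - p * ((q - p) / (p + u * (q - p)))) has_integral
      (1 * (q - p) - p * ln (p + 1 * (q - p))) - (0 * (q - p) - p * ln (p + 0 * (q - p)))) {0..1}"
    using pos
    by (intro fundamental_theorem_of_calculus)
      (auto intro!: derivative_eq_intros simp: has_real_derivative_iff_has_vector_derivative[symmetric])
  also have "(1 * (q - p) - p * ln (p + 1 * (q - p))) - (0 * (q - p) - p * ln (p + 0 * (q - p)))
      = q - p - p * (ln q - ln p)"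
    by (simp add: algebra_simps)
  finally show ?thesis
  proof (rule has_integral_eq[rotated])
    fix u :: real assume u: "u \<in> {0..1}"
    have e: "u * q + (1 - u) * p = p + u * (q - p)"
      by (simp add: algebra_simps)
    show "(q - p) - p * ((q - p) / (p + u * (q - p))) = u * ((q - p)\<^sup>2 / (u * q + (1 - u) * p))"
      unfolding e using pos[OF u] by (simp add: field_simps power2_eq_square)
  qed
qed

text \<open>The finite branch of \<open>rel_entropy\<close> as a real number, so that calculus
  applies. The two agree for a lower bounded second argument by
  \<open>rel_entropy_eq\<close>.\<close>

definition rel_ent :: "'a::finite op \<Rightarrow> 'a op \<Rightarrow> real"
  where "rel_ent \<Gamma> \<rho> = \<Gamma> \<bullet> (op_log \<Gamma> - op_log \<rho>)"

text \<open>Lesniewski--Ruskai: the relative entropy is an integral over \<open>u \<in> [0,1]\<close> of the suprema over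
  \<open>X\<close> of the following functionals, which are jointly linear in \<open>(\<Gamma>, \<rho>)\<close>.\<close>

definition ent_fun :: "real \<Rightarrow> 'a::finite op \<Rightarrow> 'a op \<Rightarrow> 'a op \<Rightarrow> real"
  where "ent_fun u \<Gamma> \<rho> X = 2 * (X \<bullet> (\<rho> - \<Gamma>)) - u * (X \<bullet> (\<rho> ** X)) - (1 - u) * (X \<bullet> (X ** \<Gamma>))"

text \<open>Writing the test operator as \<open>P ** Z ** adj Q\<close> decouples the functional
  into one scalar quadratic polynomial per entry of Z, which can be maximised separately.\<close>

lemma ent_fun_spec:
  assumes P: "unitary (P :: 'a::finite op)" and Q: "unitary Q"
  shows "ent_fun u (spec Q p) (spec P q) (P ** Z ** adj Q) =
    (\<Sum>a\<in>UNIV. \<Sum>i\<in>UNIV. 2 * ((q a - p i) * Re (cnj (Z $ a $ i) * (adj P ** Q) $ a $ i))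
        - (u * q a + (1 - u) * p i) * (cmod (Z $ a $ i))\<^sup>2)"
proof -
  define U where "U = adj P ** Q"
  let ?D = "\<lambda>d. diag (\<lambda>i. complex_of_real (d i))"
  have d: "spec P q - spec Q p = P ** (?D q ** U - U ** ?D p) ** adj Q"
    unfolding spec_rotate(1)[OF P Q, of q] spec_rotate(2)[OF P Q, of p] U_def by (simp add: op_linear)
  have "spec P q ** (P ** Z ** adj Q) = P ** ?D q ** (adj P ** P) ** Z ** adj Q"
    unfolding spec_def by (simp only: matrix_mul_assoc)
  then have r: "spec P q ** (P ** Z ** adj Q) = P ** (?D q ** Z) ** adj Q"
    unfolding P[unfolded unitary_def, THEN conjunct1] matrix_mul_rid by (simp only: matrix_mul_assoc)
  have "(P ** Z ** adj Q) ** spec Q p = P ** Z ** (adj Q ** Q) ** ?D p ** adj Q"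
    unfolding spec_def by (simp only: matrix_mul_assoc)
  then have g: "(P ** Z ** adj Q) ** spec Q p = P ** (Z ** ?D p) ** adj Q"
    unfolding Q[unfolded unitary_def, THEN conjunct1] matrix_mul_rid by (simp only: matrix_mul_assoc)
  have "ent_fun u (spec Q p) (spec P q) (P ** Z ** adj Q) =
      2 * (Z \<bullet> (?D q ** U - U ** ?D p)) - u * (Z \<bullet> (?D q ** Z)) - (1 - u) * (Z \<bullet> (Z ** ?D p))"
    unfolding ent_fun_def d r g inner_unitary[OF P unitary_adj[OF Q]] ..
  also have "\<dots> = (\<Sum>a\<in>UNIV. \<Sum>i\<in>UNIV. 2 * ((q a - p i) * Re (cnj (Z $ a $ i) * U $ a $ i))
        - (u * q a + (1 - u) * p i) * (cmod (Z $ a $ i))\<^sup>2)"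
    unfolding inner_op_entries sum_distrib_left sum_subtractf[symmetric] cmod_power2
      vector_minus_component diag_mult_nth mult_diag_nth
    by (intro sum.cong refl) (simp add: power2_eq_square algebra_simps)
  finally show ?thesis by (simp add: U_def)
qed

text \<open>The maximum over z is attained at (c / k) w, the point inserted in
  \<open>complete_square_eq\<close>. It is used with c = q a - p i and k = u q a + (1 - u) p
  i.\<close>

lemma complete_square:
  fixes z w :: complex and c k :: real
  assumes "k > 0"
  shows "2 * (c * Re (cnj z * w)) - k * (cmod z)\<^sup>2 \<le> (cmod w)\<^sup>2 * (c\<^sup>2 / k)"
proof -
  have "0 \<le> (k * Re z - c * Re w)\<^sup>2 + (k * Im z - c * Im w)\<^sup>2"
    by simp
  also have "\<dots> = k * ((cmod w)\<^sup>2 * (c\<^sup>2 / k) - (2 * (c * Re (cnj z * w)) - k * (cmod z)\<^sup>2))"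
    unfolding cmod_power2 using assms by (simp add: power2_eq_square field_simps)
  finally show ?thesis
    using assms by (simp add: zero_le_mult_iff)
qed

lemma complete_square_eq:
  fixes w :: complex and c k :: real
  assumes "k > 0"
  shows "2 * (c * Re (cnj (complex_of_real (c / k) * w) * w)) - k * (cmod (complex_of_real (c / k) * w))\<^sup>2
     = (cmod w)\<^sup>2 * (c\<^sup>2 / k)"
  unfolding cmod_power2 using assms by (simp add: power2_eq_square field_simps)

text \<open>The integrand is an explicit finite sum, so its integrability comes from the scalar
  formula. That the supremum is attained is part of the conclusion because
  \<open>rel_ent_step\<close> works with a maximiser.\<close>

lemma relative_entropy_variational:
  fixes \<Gamma> \<rho> :: "'a::finite op"
  assumes m: "m > 0" and G: "m *\<^sub>R mat 1 \<preceq> \<Gamma>" and r: "m *\<^sub>R mat 1 \<preceq> \<rho>"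
  obtains \<phi> where "((\<lambda>u. u * \<phi> u) has_integral (rel_ent \<Gamma> \<rho> + Re (trace \<rho>) - Re (trace \<Gamma>))) {0..1}"
    and "\<And>u X. u \<in> {0..1} \<Longrightarrow> ent_fun u \<Gamma> \<rho> X \<le> \<phi> u"
    and "\<And>u. u \<in> {0..1} \<Longrightarrow> \<exists>X. ent_fun u \<Gamma> \<rho> X = \<phi> u"
proof -
  obtain Q p where Q: "unitary Q" and Gs: "\<Gamma> = spec Q p"
    using G spectral[of \<Gamma>] unfolding op_le_scaleR_iff by blast
  obtain P q where P: "unitary P" and rs: "\<rho> = spec P q"
    using r spectral[of \<rho>] unfolding op_le_scaleR_iff by blast
  have p: "p i > 0" and q: "q i > 0" for i
    using G r less_le_trans[OF m] by (auto simp: Gs rs op_le_spec_iff Q P)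
  define U where "U = adj P ** Q"
  have U: "unitary U"
    unfolding U_def by (intro unitary_mult unitary_adj P Q)
  have k: "u * q a + (1 - u) * p i > 0" if "u \<in> {0..1}" for u a i
    using that p[of i] q[of a] by (cases "u = 0") (auto intro!: add_pos_nonneg)
  define \<phi> where "\<phi> = (\<lambda>u. \<Sum>a\<in>UNIV. \<Sum>i\<in>UNIV. (cmod (U $ a $ i))\<^sup>2 * ((q a - p i)\<^sup>2 / (u * q a + (1 - u) * p i)))"
  have "((\<lambda>u. \<Sum>a\<in>UNIV. \<Sum>i\<in>UNIV. (cmod (U $ a $ i))\<^sup>2 * (u * ((q a - p i)\<^sup>2 / (u * q a + (1 - u) * p i)))) has_integral
     (\<Sum>a\<in>UNIV. \<Sum>i\<in>UNIV. (cmod (U $ a $ i))\<^sup>2 * (q a - p i - p i * (ln (q a) - ln (p i))))) {0..1}"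
    by (intro has_integral_sum has_integral_mult_right relative_entropy_density_integral p q) auto
  \<comment> \<open>The weights have row and column sums one, so the terms depending on one index
    only become traces and the entropy of \<Gamma>; only the cross term p i ln (q a) keeps the
    weights.\<close>
  also have "(\<Sum>a\<in>UNIV. \<Sum>i\<in>UNIV. (cmod (U $ a $ i))\<^sup>2 * (q a - p i - p i * (ln (q a) - ln (p i))))
      = (\<Sum>a\<in>UNIV. q a * (\<Sum>i\<in>UNIV. (cmod (U $ a $ i))\<^sup>2))
        - (\<Sum>i\<in>UNIV. (p i - p i * ln (p i)) * (\<Sum>a\<in>UNIV. (cmod (U $ a $ i))\<^sup>2))
        - (\<Sum>a\<in>UNIV. \<Sum>i\<in>UNIV. (cmod (U $ a $ i))\<^sup>2 * (p i * ln (q a)))"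
    unfolding sum_distrib_left
    by (subst (3) sum.swap, unfold sum_subtractf[symmetric]) (intro sum.cong refl, simp add: algebra_simps)
  also have "\<dots> = rel_ent \<Gamma> \<rho> + Re (trace \<rho>) - Re (trace \<Gamma>)"
    by (simp add: rel_ent_def Gs rs op_log_spec P Q inner_diff_right inner_spec_same trace_spec
        inner_spec unitary_row[OF U] unitary_column[OF U] sum_subtractf flip: U_def)
  finally have 1: "((\<lambda>u. u * \<phi> u) has_integral (rel_ent \<Gamma> \<rho> + Re (trace \<rho>) - Re (trace \<Gamma>))) {0..1}"
    by (simp add: \<phi>_def sum_distrib_left mult.left_commute)
  have 2: "ent_fun u \<Gamma> \<rho> X \<le> \<phi> u" if u: "u \<in> {0..1}" for u X
  proof -
    define Z where "Z = adj P ** X ** Q"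
    have "P ** Z ** adj Q = (P ** adj P) ** X ** (Q ** adj Q)"
      unfolding Z_def by (simp only: matrix_mul_assoc)
    then have X: "X = P ** Z ** adj Q"
      using P Q by (simp add: unitary_def)
    show ?thesis
      unfolding X Gs rs ent_fun_spec[OF P Q] \<phi>_def U_def
      by (intro sum_mono complete_square k u)
  qed
  have 3: "\<exists>X. ent_fun u \<Gamma> \<rho> X = \<phi> u" if u: "u \<in> {0..1}" for u
  proof
    define Z :: "'a op" where "Z = (\<chi> a i. complex_of_real ((q a - p i) / (u * q a + (1 - u) * p i)) * U $ a $ i)"
    show "ent_fun u \<Gamma> \<rho> (P ** Z ** adj Q) = \<phi> u"
      unfolding Gs rs ent_fun_spec[OF P Q] \<phi>_def U_def[symmetric] Z_def vec_lambda_beta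
      by (intro sum.cong refl complete_square_eq k u)
  qed
  show thesis using that 1 2 3 by blast
qed

lemma trace_inner: "Re (trace A) = mat 1 \<bullet> (A :: 'a::finite op)"
  by (simp add: inner_op_eq)

text \<open>Klein's inequality: the test operator 0 shows that the integrand is nonnegative.\<close>

lemma rel_ent_nonneg:
  assumes m: "m > 0" and G: "m *\<^sub>R mat 1 \<preceq> \<Gamma>" and r: "m *\<^sub>R mat 1 \<preceq> \<rho>"
    and tr: "Re (trace \<Gamma>) = Re (trace \<rho>)"
  shows "0 \<le> rel_ent \<Gamma> \<rho>"
proof -
  obtain \<phi> where \<phi>: "((\<lambda>u. u * \<phi> u) has_integral (rel_ent \<Gamma> \<rho> + Re (trace \<rho>) - Re (trace \<Gamma>))) {0..1}"
    and le: "\<And>u X. u \<in> {0..1} \<Longrightarrow> ent_fun u \<Gamma> \<rho> X \<le> \<phi> u"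
    using relative_entropy_variational[OF m G r] by metis
  have "0 \<le> \<phi> u" if "u \<in> {0..1}" for u
    using le[OF that, of 0] by (simp add: ent_fun_def op_linear)
  then show ?thesis
    using has_integral_nonneg[OF \<phi>] tr by simp
qed

text \<open>Restricting the supremum to functions of \<open>A\<close> gives the relative entropy of the outcomes of a
  measurement of \<open>A\<close>; the classical Gibbs inequality then applies, and no Golden--Thompson
  inequality is needed.\<close>

lemma gibbs_variational:
  fixes \<Gamma> \<rho> V :: "'a::finite op"
  assumes m: "m > 0" and G: "m *\<^sub>R mat 1 \<preceq> \<Gamma>" and r: "m *\<^sub>R mat 1 \<preceq> \<rho>"
    and trG: "trace \<Gamma> = 1" and trr: "trace \<rho> = 1" and V: "unitary V"
  shows "spec V a \<bullet> \<Gamma> \<le> rel_ent \<Gamma> \<rho> + ln (spec V (\<lambda>k. exp (a k)) \<bullet> \<rho>)"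
proof -
  obtain \<phi> where \<phi>: "((\<lambda>u. u * \<phi> u) has_integral (rel_ent \<Gamma> \<rho> + Re (trace \<rho>) - Re (trace \<Gamma>))) {0..1}"
    and le: "\<And>u X. u \<in> {0..1} \<Longrightarrow> ent_fun u \<Gamma> \<rho> X \<le> \<phi> u"
    using relative_entropy_variational[OF m G r] by metis
  define e where "e = (\<lambda>k. V *v axis k 1)"
  have ne: "norm (e k) = 1" for k
    unfolding e_def by (simp add: norm_unitary_vec[OF V])
  define p where "p = (\<lambda>k. e k \<bullet> (\<Gamma> *v e k))"
  define q where "q = (\<lambda>k. e k \<bullet> (\<rho> *v e k))"
  have p: "p k > 0" and q: "q k > 0" for k
    using G r m ne[of k] unfolding op_le_scaleR_iff p_def q_def
    by (metis less_le_trans mult.right_neutral power_one)+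
  have ip: "spec V x \<bullet> \<Gamma> = (\<Sum>k\<in>UNIV. x k * p k)" and iq: "spec V x \<bullet> \<rho> = (\<Sum>k\<in>UNIV. x k * q k)" for x
    unfolding inner_spec_op p_def q_def e_def by auto
  have sp: "(\<Sum>k\<in>UNIV. p k) = 1" and sq: "(\<Sum>k\<in>UNIV. q k) = 1"
    using ip[of "\<lambda>_. 1"] iq[of "\<lambda>_. 1"] trG trr trace_inner[of \<Gamma>] trace_inner[of \<rho>] by (simp_all add: spec_one[OF V])
  have "((\<lambda>u. \<Sum>k\<in>UNIV. u * ((q k - p k)\<^sup>2 / (u * q k + (1 - u) * p k))) has_integral
     (\<Sum>k\<in>UNIV. q k - p k - p k * (ln (q k) - ln (p k)))) {0..1}"
    by (intro has_integral_sum relative_entropy_density_integral p q) auto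
  then have "(\<Sum>k\<in>UNIV. q k - p k - p k * (ln (q k) - ln (p k))) \<le> rel_ent \<Gamma> \<rho> + Re (trace \<rho>) - Re (trace \<Gamma>)"
  proof (rule has_integral_le[OF _ \<phi>])
    fix u :: real assume u: "u \<in> {0..1}"
    have k: "u * q k + (1 - u) * p k > 0" for k
      using u p[of k] q[of k] by (cases "u = 0") (auto intro!: add_pos_nonneg)
    \<comment> \<open>The maximiser of the scalar problem for the outcome distributions p and q.
      Products of functions in the basis V stay functions in that basis, so the functional at this
      operator sees only p and q.\<close>
    define x where "x = (\<lambda>k. (q k - p k) / (u * q k + (1 - u) * p k))"
    have "spec V x \<bullet> (\<rho> ** spec V x) = spec V (\<lambda>k. x k * x k) \<bullet> \<rho>"
      unfolding inner_mult_right by (simp add: spec_mult[OF V])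
    moreover have "spec V x \<bullet> (spec V x ** \<Gamma>) = spec V (\<lambda>k. x k * x k) \<bullet> \<Gamma>"
      unfolding inner_mult_left by (simp add: spec_mult[OF V])
    ultimately have "ent_fun u \<Gamma> \<rho> (spec V x) = 2 * ((\<Sum>k\<in>UNIV. x k * q k) - (\<Sum>k\<in>UNIV. x k * p k))
        - u * (\<Sum>k\<in>UNIV. x k * x k * q k) - (1 - u) * (\<Sum>k\<in>UNIV. x k * x k * p k)"
      by (simp add: ent_fun_def inner_diff_right ip iq)
    also have "\<dots> = (\<Sum>k\<in>UNIV. 2 * x k * (q k - p k) - (u * q k + (1 - u) * p k) * (x k)\<^sup>2)"
      unfolding sum_distrib_left sum_subtractf[symmetric]
      by (intro sum.cong refl) (simp add: power2_eq_square algebra_simps)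
    also have "\<dots> = (\<Sum>k\<in>UNIV. (q k - p k)\<^sup>2 / (u * q k + (1 - u) * p k))"
    proof (rule sum.cong[OF refl])
      fix k
      have "2 * ((q k - p k) / c) * (q k - p k) - c * ((q k - p k) / c)\<^sup>2 = (q k - p k)\<^sup>2 / c" if "c > 0" for c
        using that by (simp add: field_simps power2_eq_square)
      then show "2 * x k * (q k - p k) - (u * q k + (1 - u) * p k) * (x k)\<^sup>2 = (q k - p k)\<^sup>2 / (u * q k + (1 - u) * p k)"
        unfolding x_def using k by blast
    qed
    finally have "(\<Sum>k\<in>UNIV. (q k - p k)\<^sup>2 / (u * q k + (1 - u) * p k)) \<le> \<phi> u"
      using le[OF u] by metis
    then show "(\<Sum>k\<in>UNIV. u * ((q k - p k)\<^sup>2 / (u * q k + (1 - u) * p k))) \<le> u * \<phi> u"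
      using u unfolding sum_distrib_left[symmetric] by (intro mult_left_mono) auto
  qed
  then have S: "(\<Sum>k\<in>UNIV. p k * (ln (p k) - ln (q k))) \<le> rel_ent \<Gamma> \<rho>"
    using sp sq trG trr by (simp add: sum_subtractf sum.distrib algebra_simps)
  define z where "z = (\<Sum>k\<in>UNIV. exp (a k) * q k)"
  have z: "z > 0"
    unfolding z_def by (intro sum_pos mult_pos_pos q) auto
  \<comment> \<open>The relative entropy of p with respect to the tilted distribution exp (a k) q k
    / z is nonnegative; this follows from ln y \<le> y - 1 in each term.\<close>
  have "(\<Sum>k\<in>UNIV. p k * (a k + ln (q k) - ln (p k) - ln z)) \<le> (\<Sum>k\<in>UNIV. exp (a k) * q k / z - p k)"
  proof (rule sum_mono)
    fix k
    have "a k + ln (q k) - ln (p k) - ln z = ln (exp (a k) * q k / (z * p k))"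
      using p[of k] q[of k] z by (simp add: ln_div ln_mult)
    also have "\<dots> \<le> exp (a k) * q k / (z * p k) - 1"
      using p[of k] q[of k] z by (intro ln_le_minus_one) auto
    finally have "p k * (a k + ln (q k) - ln (p k) - ln z) \<le> p k * (exp (a k) * q k / (z * p k) - 1)"
      using p[of k] by (intro mult_left_mono) auto
    also have "p k * (exp (a k) * q k / (z * p k) - 1) = exp (a k) * q k / z - p k"
      using p[of k] z by (simp add: field_simps)
    finally show "p k * (a k + ln (q k) - ln (p k) - ln z) \<le> exp (a k) * q k / z - p k" .
  qed
  also have "\<dots> = 0"
    using z sp by (simp add: sum_subtractf z_def[symmetric] flip: sum_divide_distrib)
  finally have "(\<Sum>k\<in>UNIV. a k * p k) - (\<Sum>k\<in>UNIV. p k * (ln (p k) - ln (q k))) - ln z * (\<Sum>k\<in>UNIV. p k) \<le> 0"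
    unfolding sum_distrib_left sum_subtractf[symmetric] by (simp add: algebra_simps)
  then show ?thesis
    using S sp by (simp add: ip iq z_def)
qed

section \<open>Lindblad generators and data processing\<close>

text \<open>The family of jump operators has a free index set: all particles for the N-body
  equation, a singleton for the Hartree equation, the empty set for a purely Hamiltonian
  flow.\<close>

definition gen :: "'a::finite op \<Rightarrow> 'k set \<Rightarrow> ('k \<Rightarrow> 'a op) \<Rightarrow> 'a op \<Rightarrow> 'a op"
  where "gen H J L A = (- \<i>) *\<^sub>C comm H A + (\<Sum>k\<in>J. dissipator (L k) A)"

text \<open>The generator in the Heisenberg picture; \<open>inner_gen\<close> is the
  duality.\<close>

definition gen_dual :: "'a::finite op \<Rightarrow> 'k set \<Rightarrow> ('k \<Rightarrow> 'a op) \<Rightarrow> 'a op \<Rightarrow> 'a op"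
  where "gen_dual H J L X = \<i> *\<^sub>C comm H X
    + (\<Sum>k\<in>J. adj (L k) ** X ** L k - (1/2) *\<^sub>R (adj (L k) ** L k ** X + X ** adj (L k) ** L k))"

lemma dissipator_linear:
  "dissipator L (A + B) = dissipator L A + dissipator L B"
  "dissipator L (A - B) = dissipator L A - dissipator L B"
  "dissipator L (r *\<^sub>R A) = r *\<^sub>R dissipator L A"
  by (simp_all add: dissipator_def op_linear algebra_simps)

lemma gen_add: "gen H J L (A + B) = gen H J L A + gen H J L B"
  by (simp add: gen_def comm_def dissipator_linear op_linear sum.distrib algebra_simps)

lemma gen_diff: "gen H J L (A - B) = gen H J L A - gen H J L B"
  by (simp add: gen_def comm_def dissipator_linear op_linear sum_subtractf algebra_simps)

lemma gen_scaleR: "gen H J L (r *\<^sub>R A) = r *\<^sub>R gen H J L A"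
  by (simp add: gen_def comm_def dissipator_linear op_linear scaleR_sum_right algebra_simps)

lemma bounded_linear_gen: "bounded_linear (gen H J L :: 'a::finite op \<Rightarrow> _)"
  unfolding linear_conv_bounded_linear[symmetric]
  by unfold_locales (auto simp: gen_add gen_scaleR)

lemma bounded_linear_gen_dual: "bounded_linear (gen_dual H J L :: 'a::finite op \<Rightarrow> _)"
  unfolding linear_conv_bounded_linear[symmetric]
  by unfold_locales (auto simp: gen_dual_def comm_def op_linear sum.distrib scaleR_sum_right sum_subtractf algebra_simps)

lemma adj_dissipator: "adj (dissipator L A) = dissipator L (adj A)"
  by (simp add: dissipator_def adj_simps matrix_mul_assoc add.commute)

lemma adj_gen: "adj H = H \<Longrightarrow> adj (gen H J L A) = gen H J L (adj A)"
  by (simp add: gen_def comm_def adj_simps adj_dissipator op_linear)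

lemma adj_gen_dual: "adj H = H \<Longrightarrow> adj (gen_dual H J L X) = gen_dual H J L (adj X)"
  by (simp add: gen_dual_def comm_def adj_simps matrix_mul_assoc op_linear add.commute)

text \<open>Normality of the jump operators enters through this lemma: the dissipator of the
  identity is \<open>L ** adj L - adj L ** L\<close>.\<close>

lemma gen_one:
  assumes "\<And>k. k \<in> J \<Longrightarrow> L k ** adj (L k) = adj (L k) ** L k"
  shows "gen H J L (mat 1) = 0"
  using assms by (simp add: gen_def comm_def dissipator_def scaleR_2[symmetric])

lemma trace_dissipator: "trace (dissipator L A) = 0"
proof -
  have "trace (L ** (A ** adj L)) = trace ((A ** adj L) ** L)"
    "trace ((adj L ** L) ** A) = trace (A ** (adj L ** L))"
    by (rule trace_mul_sym)+
  then show ?thesis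
    by (simp add: dissipator_def trace_sub trace_scaleR trace_add matrix_mul_assoc scaleR_2[symmetric])
qed

lemma trace_gen: "trace (gen H J L A) = 0"
  using trace_mul_sym[of H A]
  by (simp add: gen_def trace_add trace_cscale comm_def trace_sub trace_sum trace_dissipator)

lemma inner_cscale: "(c *\<^sub>C X) \<bullet> Y = X \<bullet> (cnj c *\<^sub>C (Y :: 'a::finite op))"
  by (simp add: inner_op_eq adj_cscale op_linear)

lemma inner_gen:
  assumes "adj H = H"
  shows "X \<bullet> gen H J L A = gen_dual H J L X \<bullet> (A :: 'a::finite op)"
proof -
  have d: "X \<bullet> dissipator K A = (adj K ** X ** K - (1/2) *\<^sub>R (adj K ** K ** X + X ** adj K ** K)) \<bullet> A" for K
  proof -
    have "X \<bullet> (K ** A ** adj K) = (adj K ** X ** K) \<bullet> A"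
      unfolding inner_mult_right[of X "K ** A"] inner_mult_left[of _ K] by (simp add: matrix_mul_assoc)
    moreover have "X \<bullet> (adj K ** K ** A) = (adj K ** K ** X) \<bullet> A"
      unfolding inner_mult_left[of X "adj K ** K"] by (simp add: adj_mult)
    moreover have "X \<bullet> (A ** adj K ** K) = (X ** adj K ** K) \<bullet> A"
      unfolding inner_mult_right[of X "A ** adj K"] inner_mult_right[of _ A] by simp
    ultimately show ?thesis
      by (simp add: dissipator_def inner_diff_left inner_diff_right inner_add_left inner_add_right)
  qed
  have "X \<bullet> ((- \<i>) *\<^sub>C comm H A) = (\<i> *\<^sub>C X) \<bullet> comm H A"
    by (simp add: inner_cscale)
  also have "\<dots> = (\<i> *\<^sub>C comm H X) \<bullet> A"
    using assms by (simp add: comm_def inner_diff_right inner_mult_left[of _ H] inner_mult_right[of _ _ H] op_linear inner_diff_left)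
  finally show ?thesis
    by (simp add: gen_def gen_dual_def inner_add_left inner_add_right inner_sum_left inner_sum_right d)
qed

text \<open>The Hamiltonian part is a derivation and drops out. Each jump operator leaves the square
  of its commutator with Y, which is the source of dissipativity.\<close>

lemma gen_dual_carre_du_champ:
  fixes H Y :: "'a::finite op"
  assumes "adj H = H"
  shows "gen_dual H J L (adj Y ** Y) - gen_dual H J L (adj Y) ** Y - adj Y ** gen_dual H J L Y
    = (\<Sum>k\<in>J. adj (Y ** L k - L k ** Y) ** (Y ** L k - L k ** Y))"
proof -
  define D where "D = (\<lambda>K X. adj K ** X ** K - (1/2) *\<^sub>R (adj K ** K ** X + X ** adj K ** K) :: 'a op)"
  have e: "adj (Y ** K - K ** Y) ** (Y ** K - K ** Y) = D K (adj Y ** Y) - D K (adj Y) ** Y - adj Y ** D K Y" for K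
    by (simp add: D_def adj_simps op_linear matrix_mul_assoc)
  have g: "gen_dual H J L X = \<i> *\<^sub>C comm H X + (\<Sum>k\<in>J. D (L k) X)" for X
    by (simp add: gen_dual_def D_def)
  show ?thesis
    unfolding g e sum_subtractf
    by (simp add: comm_def op_linear matrix_sum_left matrix_sum_right matrix_mul_assoc)
qed

lemma op_le_square:
  assumes "m *\<^sub>R mat 1 \<preceq> (A :: 'a::finite op)"
  obtains Z where "A = m *\<^sub>R mat 1 + adj Z ** Z"
proof -
  obtain Q d where Q: "unitary Q" and A: "A = spec Q d"
    using assms spectral[of A] unfolding op_le_scaleR_iff by blast
  have d: "m \<le> d i" for i
    using assms by (simp add: A op_le_spec_iff[OF Q])
  define Z where "Z = spec Q (\<lambda>i. sqrt (d i - m))"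
  have "m *\<^sub>R mat 1 + adj Z ** Z = spec Q (\<lambda>i. m * 1 + (d i - m))"
    using d by (simp add: Z_def spec_mult[OF Q] spec_one[OF Q, symmetric] spec_scaleR spec_add)
  then show thesis using that[of Z] A by simp
qed

lemma inner_op_le:
  assumes "m *\<^sub>R mat 1 \<preceq> (A :: 'a::finite op)"
  shows "m * (norm X)\<^sup>2 \<le> X \<bullet> (A ** X)" "m * (norm X)\<^sup>2 \<le> X \<bullet> (X ** A)"
proof -
  obtain Z where Z: "A = m *\<^sub>R mat 1 + adj Z ** Z"
    using op_le_square[OF assms] .
  have "X \<bullet> (A ** X) = m * (norm X)\<^sup>2 + (norm (Z ** X))\<^sup>2"
    by (simp add: Z op_linear inner_add_right power2_norm_eq_inner inner_mult_left[of X "adj Z"]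
        flip: matrix_mul_assoc)
  then show "m * (norm X)\<^sup>2 \<le> X \<bullet> (A ** X)"
    by simp
  have "X \<bullet> (X ** A) = m * (norm X)\<^sup>2 + (norm (X ** adj Z))\<^sup>2"
    by (simp add: Z op_linear inner_add_right power2_norm_eq_inner inner_mult_right[of X _ Z]
        matrix_mul_assoc)
  then show "m * (norm X)\<^sup>2 \<le> X \<bullet> (X ** A)"
    by simp
qed

lemma op_le_zero_mono: "0 \<le> m \<Longrightarrow> m *\<^sub>R mat 1 \<preceq> A \<Longrightarrow> 0 *\<^sub>R mat 1 \<preceq> A"
  unfolding op_le_scaleR_iff by (metis mult_zero_left order_trans zero_le_mult_iff zero_le_power2)

text \<open>Infinitesimal Kadison-Schwarz inequality, tested against a nonnegative state: the defect
  is a sum of squares.\<close>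

lemma gen_dual_dissipative:
  assumes H: "adj H = H" and r: "0 *\<^sub>R mat 1 \<preceq> (\<rho> :: 'a::finite op)"
  shows "(gen_dual H J L (adj Y) ** Y + adj Y ** gen_dual H J L Y) \<bullet> \<rho> \<le> gen_dual H J L (adj Y ** Y) \<bullet> \<rho>"
proof -
  have "0 \<le> (adj Z ** Z) \<bullet> \<rho>" for Z
    using inner_op_le(2)[OF r, of Z] inner_mult_left[of Z Z \<rho>] by simp
  then have "0 \<le> (\<Sum>k\<in>J. adj (Y ** L k - L k ** Y) ** (Y ** L k - L k ** Y)) \<bullet> \<rho>"
    unfolding inner_sum_left by (intro sum_nonneg)
  then show ?thesis
    unfolding gen_dual_carre_du_champ[OF H, symmetric] by (simp add: inner_diff_left inner_add_left)
qed

text \<open>Infinitesimal data processing: moving the states forward by the generator is dominated by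
  moving the test operator forward by its dual.\<close>

lemma ent_fun_gen_le:
  fixes \<Gamma> \<rho> X :: "'a::finite op" and J :: "'k set" and L :: "'k \<Rightarrow> 'a op"
  assumes H: "adj H = H" and r: "0 *\<^sub>R mat 1 \<preceq> \<rho>" and G: "0 *\<^sub>R mat 1 \<preceq> \<Gamma>"
    and u: "u \<in> {0..1}" and \<delta>: "0 \<le> \<delta>"
  defines "Y \<equiv> gen_dual H J L X"
  shows "ent_fun u (\<Gamma> + \<delta> *\<^sub>R gen H J L \<Gamma>) (\<rho> + \<delta> *\<^sub>R gen H J L \<rho>) X
    \<le> ent_fun u \<Gamma> \<rho> (X + \<delta> *\<^sub>R Y) + \<delta>\<^sup>2 * (u * (Y \<bullet> (\<rho> ** Y)) + (1 - u) * (Y \<bullet> (Y ** \<Gamma>)))"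
proof -
  have 1: "X \<bullet> gen H J L A = Y \<bullet> A" for A
    unfolding Y_def by (rule inner_gen[OF H])
  have "X \<bullet> (gen H J L \<rho> ** X) = gen_dual H J L (X ** adj X) \<bullet> \<rho>"
    by (simp add: inner_mult_right inner_gen[OF H])
  \<comment> \<open>In the functional \<rho> is paired with \<open>X ** adj X\<close> and \<Gamma>
    with \<open>adj X ** X\<close>. Hence dissipativity is applied to \<open>adj X\<close> here and
    to X below.\<close>
  moreover have "(Y ** adj X + X ** adj Y) \<bullet> \<rho> \<le> gen_dual H J L (X ** adj X) \<bullet> \<rho>"
    using gen_dual_dissipative[OF H r, of J L "adj X"] by (simp add: adj_gen_dual[OF H] Y_def)
  moreover have "(Y ** adj X + X ** adj Y) \<bullet> \<rho> = Y \<bullet> (\<rho> ** X) + X \<bullet> (\<rho> ** Y)"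
    by (simp add: inner_add_left inner_mult_right)
  ultimately have 2: "Y \<bullet> (\<rho> ** X) + X \<bullet> (\<rho> ** Y) \<le> X \<bullet> (gen H J L \<rho> ** X)"
    by simp
  have "X \<bullet> (X ** gen H J L \<Gamma>) = gen_dual H J L (adj X ** X) \<bullet> \<Gamma>"
    by (simp add: inner_mult_left inner_gen[OF H])
  moreover have "(adj Y ** X + adj X ** Y) \<bullet> \<Gamma> \<le> gen_dual H J L (adj X ** X) \<bullet> \<Gamma>"
    using gen_dual_dissipative[OF H G, of J L X] by (simp add: adj_gen_dual[OF H] Y_def)
  moreover have "(adj Y ** X + adj X ** Y) \<bullet> \<Gamma> = X \<bullet> (Y ** \<Gamma>) + Y \<bullet> (X ** \<Gamma>)"
    by (simp add: inner_add_left inner_mult_left)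
  ultimately have 3: "X \<bullet> (Y ** \<Gamma>) + Y \<bullet> (X ** \<Gamma>) \<le> X \<bullet> (X ** gen H J L \<Gamma>)"
    by simp
  have "\<delta> * (u * (Y \<bullet> (\<rho> ** X) + X \<bullet> (\<rho> ** Y)) + (1 - u) * (X \<bullet> (Y ** \<Gamma>) + Y \<bullet> (X ** \<Gamma>)))
      \<le> \<delta> * (u * (X \<bullet> (gen H J L \<rho> ** X)) + (1 - u) * (X \<bullet> (X ** gen H J L \<Gamma>)))"
    using u \<delta> by (intro mult_left_mono add_mono 2 3) auto
  then show ?thesis
    by (simp add: ent_fun_def op_linear inner_add_left inner_add_right inner_diff_right 1
        power2_eq_square algebra_simps)
qed

text \<open>The linear terms cost 2 B \<epsilon> for each state, and the two quadratic terms
  together a convex combination of \<open>B\<^sup>2\<close> \<epsilon> with itself.\<close>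

lemma ent_fun_perturb:
  fixes \<Gamma> \<rho> X :: "'a::finite op"
  assumes u: "u \<in> {0..1}" and G: "norm (\<Gamma>' - \<Gamma>) \<le> \<epsilon>" and r: "norm (\<rho>' - \<rho>) \<le> \<epsilon>" and X: "norm X \<le> B"
  shows "ent_fun u \<Gamma>' \<rho>' X \<le> ent_fun u \<Gamma> \<rho> X + (4 * B + B\<^sup>2) * \<epsilon>"
proof -
  have B: "0 \<le> B" and e: "0 \<le> \<epsilon>" using X G norm_ge_zero order_trans by blast+
  have i: "\<bar>X \<bullet> D\<bar> \<le> B * \<epsilon>" if "norm D \<le> \<epsilon>" for D
  proof -
    have "\<bar>X \<bullet> D\<bar> \<le> norm X * norm D" by (rule Cauchy_Schwarz_ineq2)
    also have "\<dots> \<le> B * \<epsilon>" using that X B by (intro mult_mono) auto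
    finally show ?thesis .
  qed
  have l: "\<bar>X \<bullet> (D ** X)\<bar> \<le> B\<^sup>2 * \<epsilon>" "\<bar>X \<bullet> (X ** D)\<bar> \<le> B\<^sup>2 * \<epsilon>" if D: "norm D \<le> \<epsilon>" for D
  proof -
    have "\<bar>X \<bullet> (D ** X)\<bar> \<le> norm X * norm (D ** X)" by (rule Cauchy_Schwarz_ineq2)
    also have "\<dots> \<le> B * (\<epsilon> * B)"
      using X D B e by (intro mult_mono order_trans[OF matrix_norm_mult]) auto
    finally show "\<bar>X \<bullet> (D ** X)\<bar> \<le> B\<^sup>2 * \<epsilon>" by (simp add: power2_eq_square algebra_simps)
    have "\<bar>X \<bullet> (X ** D)\<bar> \<le> norm X * norm (X ** D)" by (rule Cauchy_Schwarz_ineq2)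
    also have "\<dots> \<le> B * (B * \<epsilon>)"
      using X D B e by (intro mult_mono order_trans[OF matrix_norm_mult]) auto
    finally show "\<bar>X \<bullet> (X ** D)\<bar> \<le> B\<^sup>2 * \<epsilon>" by (simp add: power2_eq_square algebra_simps)
  qed
  have "ent_fun u \<Gamma>' \<rho>' X - ent_fun u \<Gamma> \<rho> X = 2 * (X \<bullet> (\<rho>' - \<rho>)) - 2 * (X \<bullet> (\<Gamma>' - \<Gamma>))
      - u * (X \<bullet> ((\<rho>' - \<rho>) ** X)) - (1 - u) * (X \<bullet> (X ** (\<Gamma>' - \<Gamma>)))"
    by (simp add: ent_fun_def op_linear inner_diff_right algebra_simps)
  also have "\<dots> \<le> 2 * (B * \<epsilon>) + 2 * (B * \<epsilon>) + u * (B\<^sup>2 * \<epsilon>) + (1 - u) * (B\<^sup>2 * \<epsilon>)"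
  proof -
    have "- (u * (X \<bullet> ((\<rho>' - \<rho>) ** X))) \<le> u * (B\<^sup>2 * \<epsilon>)"
      using mult_left_mono[of "- (X \<bullet> ((\<rho>' - \<rho>) ** X))" "B\<^sup>2 * \<epsilon>" u] l(1)[OF r] u by auto
    moreover have "- ((1 - u) * (X \<bullet> (X ** (\<Gamma>' - \<Gamma>)))) \<le> (1 - u) * (B\<^sup>2 * \<epsilon>)"
      using mult_left_mono[of "- (X \<bullet> (X ** (\<Gamma>' - \<Gamma>)))" "B\<^sup>2 * \<epsilon>" "1 - u"] l(2)[OF G] u by auto
    ultimately show ?thesis
      using i[OF r] i[OF G] by linarith
  qed
  also have "\<dots> = (4 * B + B\<^sup>2) * \<epsilon>"
    by (simp add: algebra_simps)
  finally show ?thesis by simp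
qed

text \<open>A nonnegative value means that the quadratic part, at least m times the squared norm of
  X, is dominated by the linear part. Every maximiser qualifies since X = 0 has value 0; the bound
  is uniform in u.\<close>

lemma ent_fun_maximiser_bound:
  fixes \<Gamma> \<rho> X :: "'a::finite op"
  assumes m: "m > 0" and G: "m *\<^sub>R mat 1 \<preceq> \<Gamma>" and r: "m *\<^sub>R mat 1 \<preceq> \<rho>"
    and u: "u \<in> {0..1}" and X: "0 \<le> ent_fun u \<Gamma> \<rho> X"
  shows "norm X \<le> 2 * norm (\<rho> - \<Gamma>) / m"
proof -
  have "m * (norm X)\<^sup>2 = u * (m * (norm X)\<^sup>2) + (1 - u) * (m * (norm X)\<^sup>2)"
    by (simp add: algebra_simps)
  also have "\<dots> \<le> u * (X \<bullet> (\<rho> ** X)) + (1 - u) * (X \<bullet> (X ** \<Gamma>))"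
    using u by (intro add_mono mult_left_mono inner_op_le G r) auto
  also have "\<dots> \<le> 2 * (X \<bullet> (\<rho> - \<Gamma>))"
    using X by (simp add: ent_fun_def)
  also have "\<dots> \<le> 2 * (norm X * norm (\<rho> - \<Gamma>))"
    using norm_cauchy_schwarz by auto
  finally have "norm X * (m * norm X) \<le> norm X * (2 * norm (\<rho> - \<Gamma>))"
    by (simp add: power2_eq_square algebra_simps)
  then have "m * norm X \<le> 2 * norm (\<rho> - \<Gamma>)"
    by (cases "X = 0") (auto simp: mult_le_cancel_left)
  then show ?thesis
    using m by (simp add: field_simps)
qed

text \<open>One time step without differentiating a logarithm. For each u a maximiser X for the
  later pair is taken, and X shifted by \<delta> times the dual generator competes for the earlier
  pair. The loss is the deviation \<epsilon> from an Euler step plus a term of second order in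
  \<delta>.\<close>

lemma rel_ent_step:
  fixes \<Gamma> \<rho> \<Gamma>' \<rho>' :: "'a::finite op"
  assumes m: "m > 0" and G: "m *\<^sub>R mat 1 \<preceq> \<Gamma>" and r: "m *\<^sub>R mat 1 \<preceq> \<rho>"
    and G': "m *\<^sub>R mat 1 \<preceq> \<Gamma>'" and r': "m *\<^sub>R mat 1 \<preceq> \<rho>'"
    and tr: "trace \<Gamma> = 1" "trace \<rho> = 1" "trace \<Gamma>' = 1" "trace \<rho>' = 1"
    and H: "adj H = H" and \<delta>: "0 \<le> \<delta>"
    and eG: "norm (\<Gamma>' - (\<Gamma> + \<delta> *\<^sub>R gen H J L \<Gamma>)) \<le> \<epsilon>"
    and er: "norm (\<rho>' - (\<rho> + \<delta> *\<^sub>R gen H J L \<rho>)) \<le> \<epsilon>"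
    and B: "2 * norm (\<rho>' - \<Gamma>') / m \<le> B"
    and c: "\<And>X. norm (gen_dual H J L X) \<le> c * norm X"
    and M: "norm \<Gamma> \<le> M" "norm \<rho> \<le> M"
  shows "rel_ent \<Gamma>' \<rho>' \<le> rel_ent \<Gamma> \<rho> + ((4 * B + B\<^sup>2) * \<epsilon> + \<delta>\<^sup>2 * (M * (\<bar>c\<bar> * B)\<^sup>2))"
proof -
  obtain \<phi> where \<phi>: "((\<lambda>u. u * \<phi> u) has_integral (rel_ent \<Gamma> \<rho> + Re (trace \<rho>) - Re (trace \<Gamma>))) {0..1}"
    and le: "\<And>u X. u \<in> {0..1} \<Longrightarrow> ent_fun u \<Gamma> \<rho> X \<le> \<phi> u"
    using relative_entropy_variational[OF m G r] by metis
  obtain \<psi> where \<psi>: "((\<lambda>u. u * \<psi> u) has_integral (rel_ent \<Gamma>' \<rho>' + Re (trace \<rho>') - Re (trace \<Gamma>'))) {0..1}"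
    and le': "\<And>u X. u \<in> {0..1} \<Longrightarrow> ent_fun u \<Gamma>' \<rho>' X \<le> \<psi> u"
    and eq': "\<And>u. u \<in> {0..1} \<Longrightarrow> \<exists>X. ent_fun u \<Gamma>' \<rho>' X = \<psi> u"
    using relative_entropy_variational[OF m G' r'] by metis
  define E where "E = (4 * B + B\<^sup>2) * \<epsilon> + \<delta>\<^sup>2 * (M * (\<bar>c\<bar> * B)\<^sup>2)"
  have B0: "0 \<le> B" using B m by (smt (verit) divide_nonneg_pos norm_ge_zero)
  have E0: "0 \<le> E"
  proof -
    have "0 \<le> \<epsilon>" "0 \<le> M"
      using eG M norm_ge_zero order_trans by blast+
    then show ?thesis
      unfolding E_def using B0 by simp
  qed
  have key: "\<psi> u \<le> \<phi> u + E" if u: "u \<in> {0..1}" for u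
  proof -
    obtain X where X: "ent_fun u \<Gamma>' \<rho>' X = \<psi> u"
      using eq'[OF u] by blast
    have "0 \<le> \<psi> u"
      using le'[OF u, of 0] by (simp add: ent_fun_def op_linear)
    then have nX: "norm X \<le> B"
      using ent_fun_maximiser_bound[OF m G' r' u, of X] X B by linarith
    define Y where "Y = gen_dual H J L X"
    have nY: "norm Y \<le> \<bar>c\<bar> * B"
      unfolding Y_def using nX by (intro order_trans[OF c] mult_mono) auto
    have q: "Y \<bullet> Z \<le> M * (\<bar>c\<bar> * B)\<^sup>2" if "norm Z \<le> M * norm Y" for Z
    proof -
      have "Y \<bullet> Z \<le> norm Y * (M * norm Y)"
        using that by (intro order_trans[OF norm_cauchy_schwarz] mult_left_mono) auto
      also have "\<dots> = M * (norm Y)\<^sup>2"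
        by (simp add: power2_eq_square)
      also have "\<dots> \<le> M * (\<bar>c\<bar> * B)\<^sup>2"
        using nY order_trans[OF norm_ge_zero M(1)] by (intro mult_left_mono power_mono) auto
      finally show ?thesis .
    qed
    have "norm (\<rho> ** Y) \<le> M * norm Y" "norm (Y ** \<Gamma>) \<le> M * norm Y"
      using matrix_norm_mult[of \<rho> Y] matrix_norm_mult[of Y \<Gamma>] mult_right_mono[OF M(1), of "norm Y"]
        mult_right_mono[OF M(2), of "norm Y"] by (auto simp: mult.commute)
    then have "u * (Y \<bullet> (\<rho> ** Y)) + (1 - u) * (Y \<bullet> (Y ** \<Gamma>)) \<le> u * (M * (\<bar>c\<bar> * B)\<^sup>2) + (1 - u) * (M * (\<bar>c\<bar> * B)\<^sup>2)"
      using u by (intro add_mono mult_left_mono q) auto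
    then have q': "u * (Y \<bullet> (\<rho> ** Y)) + (1 - u) * (Y \<bullet> (Y ** \<Gamma>)) \<le> M * (\<bar>c\<bar> * B)\<^sup>2"
      by (simp add: algebra_simps)
    have "\<psi> u \<le> ent_fun u (\<Gamma> + \<delta> *\<^sub>R gen H J L \<Gamma>) (\<rho> + \<delta> *\<^sub>R gen H J L \<rho>) X + (4 * B + B\<^sup>2) * \<epsilon>"
      unfolding X[symmetric] by (rule ent_fun_perturb[OF u eG er nX])
    also have "ent_fun u (\<Gamma> + \<delta> *\<^sub>R gen H J L \<Gamma>) (\<rho> + \<delta> *\<^sub>R gen H J L \<rho>) X
        \<le> ent_fun u \<Gamma> \<rho> (X + \<delta> *\<^sub>R Y) + \<delta>\<^sup>2 * (u * (Y \<bullet> (\<rho> ** Y)) + (1 - u) * (Y \<bullet> (Y ** \<Gamma>)))"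
      unfolding Y_def using m
      by (intro ent_fun_gen_le H u \<delta> op_le_zero_mono[OF _ r] op_le_zero_mono[OF _ G]) auto
    also have "\<dots> \<le> \<phi> u + \<delta>\<^sup>2 * (M * (\<bar>c\<bar> * B)\<^sup>2)"
      by (intro add_mono le u mult_left_mono q') auto
    finally show ?thesis by (simp add: E_def)
  qed
  have "((\<lambda>u. E) has_integral (1 - 0) *\<^sub>R E) {0..1::real}"
    using has_integral_const_real[of E 0 1] by simp
  then have "((\<lambda>u. u * \<phi> u + E) has_integral (rel_ent \<Gamma> \<rho> + Re (trace \<rho>) - Re (trace \<Gamma>) + (1 - 0) *\<^sub>R E)) {0..1}"
    by (intro has_integral_add \<phi>)
  from \<psi> this have "rel_ent \<Gamma>' \<rho>' + Re (trace \<rho>') - Re (trace \<Gamma>') \<le> rel_ent \<Gamma> \<rho> + Re (trace \<rho>) - Re (trace \<Gamma>) + (1 - 0) *\<^sub>R E"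
  proof (rule has_integral_le)
    fix u :: real assume u: "u \<in> {0..1}"
    have "u * \<psi> u \<le> u * (\<phi> u + E)"
      using u by (intro mult_left_mono key) auto
    also have "\<dots> \<le> u * \<phi> u + E"
      using u E0 mult_left_le_one_le[of E u] by (simp add: algebra_simps)
    finally show "u * \<psi> u \<le> u * \<phi> u + E" .
  qed
  then show ?thesis
    using tr by (simp add: E_def)
qed

section \<open>Dini derivatives and invariance of positivity\<close>

lemma has_vector_derivative_right_approx:
  fixes f :: "real \<Rightarrow> 'b::real_normed_vector"
  assumes f: "(f has_vector_derivative D) (at t within {0..})" and t: "0 \<le> t" and e: "0 < e"
  obtains d where "0 < d" "\<And>\<delta>. 0 \<le> \<delta> \<Longrightarrow> \<delta> < d \<Longrightarrow> norm (f (t + \<delta>) - f t - \<delta> *\<^sub>R D) \<le> e * \<delta>"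
proof -
  obtain d where d: "0 < d"
    "\<forall>y\<in>{0..}. norm (y - t) < d \<longrightarrow> norm (f y - f t - (y - t) *\<^sub>R D) \<le> e * norm (y - t)"
    using f e unfolding has_vector_derivative_def has_derivative_within_alt by metis
  have "norm (f (t + \<delta>) - f t - \<delta> *\<^sub>R D) \<le> e * \<delta>" if "0 \<le> \<delta>" "\<delta> < d" for \<delta>
    using d(2)[rule_format, of "t + \<delta>"] that t by simp
  then show thesis using that d(1) by blast
qed

text \<open>Only a bound on upper right difference quotients with arbitrarily small slack is
  assumed, as the entropy and the lowest eigenvalue need not be differentiable. The times up to
  which g stays below a comparison function have supremum T.\<close>

lemma dini_gronwall:
  fixes g :: "real \<Rightarrow> real"
  assumes T: "0 \<le> T" and cont: "continuous_on {0..T} g" and \<kappa>: "0 \<le> \<kappa>" and g0: "0 \<le> g 0"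
    and dini: "\<And>t e. 0 \<le> t \<Longrightarrow> t < T \<Longrightarrow> 0 < e \<Longrightarrow>
       \<exists>d>0. \<forall>\<delta>. 0 < \<delta> \<longrightarrow> \<delta> < d \<longrightarrow> g (t + \<delta>) \<le> g t + \<delta> * (\<kappa> * g t + e)"
  shows "g T \<le> exp (\<kappa> * T) * g 0"
proof -
  have main: "g T \<le> exp (\<kappa> * T) * (g 0 + e * (1 + T))" if e: "0 < e" for e
  proof -
    \<comment> \<open>The derivative of h is \<kappa> h + e exp (\<kappa> s), which is at least
      \<kappa> h + e; this absorbs the slack e in the bound on g.\<close>
    define h where "h = (\<lambda>s. exp (\<kappa> * s) * (g 0 + e * (1 + s)))"
    have hc: "continuous_on {0..T} h"
      unfolding h_def by (intro continuous_intros)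
    define A where "A = {s \<in> {0..T}. \<forall>r\<in>{0..s}. g r \<le> h r}"
    have A0: "0 \<in> A"
      using T e by (simp add: A_def h_def)
    have bdd: "bdd_above A"
      unfolding A_def by (rule bdd_aboveI[of _ T]) auto
    define s0 where "s0 = Sup A"
    have "0 \<le> s0"
      unfolding s0_def by (rule cSup_upper[OF A0 bdd])
    moreover have "s0 \<le> T"
      unfolding s0_def by (rule cSup_least) (use A0 in blast, simp add: A_def)
    ultimately have s0: "0 \<le> s0" "s0 \<le> T" .
    have below: "g r \<le> h r" if "0 \<le> r" "r < s0" for r
    proof -
      obtain s where "s \<in> A" "r < s"
        using \<open>r < s0\<close> A0 less_cSup_iff[OF _ bdd, of r] unfolding s0_def by blast
      then show ?thesis using \<open>0 \<le> r\<close> by (auto simp: A_def)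
    qed
    have upto: "g r \<le> h r" if r: "r \<in> {0..s0}" for r
    proof (cases "s0 = 0")
      case True
      then show ?thesis using r A0 by (auto simp: A_def)
    next
      case False
      have "continuous_on {0..T} (\<lambda>r. h r - g r)"
        by (intro continuous_intros hc cont)
      then have "closed ({0..T} \<inter> (\<lambda>r. h r - g r) -` {0..})"
        by (intro continuous_closed_preimage) auto
      moreover have "{0..<s0} \<subseteq> {0..T} \<inter> (\<lambda>r. h r - g r) -` {0..}"
        using below s0 by auto
      ultimately have "closure {0..<s0} \<subseteq> {0..T} \<inter> (\<lambda>r. h r - g r) -` {0..}"
        by (rule closure_minimal[rotated])
      then show ?thesis
        using r s0 False by auto
    qed
    have "s0 = T"
    proof (rule ccontr)
      assume "s0 \<noteq> T"
      then have sT: "s0 < T" using s0 by simp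
      obtain d where d: "d > 0" "\<And>\<delta>. 0 < \<delta> \<Longrightarrow> \<delta> < d \<Longrightarrow> g (s0 + \<delta>) \<le> g s0 + \<delta> * (\<kappa> * g s0 + e)"
        using dini[OF s0(1) sT e] by blast
      define c where "c = g 0 + e * (1 + s0)"
      have c: "0 \<le> c"
        unfolding c_def using g0 e s0 by simp
      have step: "g (s0 + \<delta>) \<le> h (s0 + \<delta>)" if \<delta>: "0 < \<delta>" "\<delta> < d" for \<delta>
      proof -
        have "g (s0 + \<delta>) \<le> (1 + \<delta> * \<kappa>) * g s0 + \<delta> * e"
          using d(2)[OF \<delta>] by (simp add: algebra_simps)
        also have "\<dots> \<le> (1 + \<delta> * \<kappa>) * h s0 + \<delta> * e"
          using upto[of s0] s0 \<delta> \<kappa> by (intro add_mono mult_left_mono) auto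
        \<comment> \<open>Enlarging e by a factor of at least one lets 1 + \<delta> \<kappa> be
          factored out and then replaced by exp (\<delta> \<kappa>).\<close>
        also have "\<dots> \<le> (1 + \<delta> * \<kappa>) * (exp (\<kappa> * s0) * c) + \<delta> * (e * exp (\<kappa> * s0) * (1 + \<delta> * \<kappa>))"
        proof -
          have "1 * 1 \<le> exp (\<kappa> * s0) * (1 + \<delta> * \<kappa>)"
            using \<kappa> s0 \<delta> by (intro mult_mono) auto
          then have "e * 1 \<le> e * (exp (\<kappa> * s0) * (1 + \<delta> * \<kappa>))"
            using e by (intro mult_left_mono) auto
          then show ?thesis
            using \<delta> \<kappa> by (intro add_mono mult_left_mono) (auto simp: h_def c_def mult.assoc)
        qed
        also have "\<dots> = (1 + \<delta> * \<kappa>) * (exp (\<kappa> * s0) * (c + e * \<delta>))"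
          by (simp add: algebra_simps)
        also have "\<dots> \<le> exp (\<delta> * \<kappa>) * (exp (\<kappa> * s0) * (c + e * \<delta>))"
          using c e \<delta> by (intro mult_right_mono exp_ge_add_one_self mult_nonneg_nonneg add_nonneg_nonneg) auto
        also have "\<dots> = h (s0 + \<delta>)"
          by (simp add: h_def c_def exp_add algebra_simps)
        finally show ?thesis .
      qed
      define s1 where "s1 = min (s0 + d / 2) T"
      have "s1 \<in> A"
      proof -
        have "g r \<le> h r" if "r \<in> {0..s1}" for r
        proof (cases "r \<le> s0")
          case True
          then show ?thesis using upto that by auto
        next
          case False
          then show ?thesis using step[of "r - s0"] that d(1) by (auto simp: s1_def)
        qed
        then show ?thesis using s0 d(1) sT T by (auto simp: A_def s1_def)
      qed
      then have "s1 \<le> s0"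
        unfolding s0_def by (rule cSup_upper[OF _ bdd])
      then show False
        using d(1) sT by (auto simp: s1_def)
    qed
    then show ?thesis
      using upto[of T] T by (auto simp: h_def)
  qed
  show ?thesis
  proof (rule field_le_epsilon)
    fix e' :: real assume e': "0 < e'"
    define e where "e = e' / (exp (\<kappa> * T) * (1 + T))"
    have "0 < e" and "exp (\<kappa> * T) * (e * (1 + T)) = e'"
      using e' T by (simp_all add: e_def)
    then show "g T \<le> exp (\<kappa> * T) * g 0 + e'"
      using main[of e] by (simp add: distrib_left)
  qed
qed

text \<open>Gronwall for the squared norm. Conservation of trace and of self-adjointness is reduced
  to it. The constant K serves [0, T] only, since for the Hartree equation it depends on a bound of
  the solution there.\<close>

lemma ode_zero_unique:
  fixes D :: "real \<Rightarrow> 'b::real_inner"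
  assumes T: "0 \<le> T" and D: "\<And>t. 0 \<le> t \<Longrightarrow> (D has_vector_derivative D' t) (at t within {0..})"
    and K: "\<And>t. 0 \<le> t \<Longrightarrow> t \<le> T \<Longrightarrow> norm (D' t) \<le> K * norm (D t)"
    and D0: "D 0 = 0"
  shows "D T = 0"
proof -
  have der: "((\<lambda>t. D t \<bullet> D t) has_vector_derivative 2 * (D t \<bullet> D' t)) (at t within {0..})" if "0 \<le> t" for t
    using bounded_bilinear.has_vector_derivative[OF bounded_bilinear_inner D[OF that] D[OF that]]
    by (simp add: inner_commute)
  have "continuous_on {0..} (\<lambda>t. D t \<bullet> D t)"
    using der by (auto simp: continuous_on_eq_continuous_within intro: has_vector_derivative_continuous)
  then have cont: "continuous_on {0..T} (\<lambda>t. D t \<bullet> D t)"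
    by (rule continuous_on_subset) auto
  have "D T \<bullet> D T \<le> exp (2 * \<bar>K\<bar> * T) * (D 0 \<bullet> D 0)"
  proof (rule dini_gronwall[OF T cont])
    fix t e :: real assume t: "0 \<le> t" "t < T" and e: "0 < e"
    obtain d where d: "0 < d" "\<And>\<delta>. 0 \<le> \<delta> \<Longrightarrow> \<delta> < d \<Longrightarrow>
        norm (D (t + \<delta>) \<bullet> D (t + \<delta>) - D t \<bullet> D t - \<delta> *\<^sub>R (2 * (D t \<bullet> D' t))) \<le> e * \<delta>"
      using has_vector_derivative_right_approx[OF der[OF t(1)] t(1) e] by blast
    have "D t \<bullet> D' t \<le> norm (D t) * (\<bar>K\<bar> * norm (D t))"
      using K[of t] t by (intro order_trans[OF norm_cauchy_schwarz] mult_left_mono)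
        (auto intro: order_trans[OF _ mult_right_mono])
    then have i: "D t \<bullet> D' t \<le> \<bar>K\<bar> * (D t \<bullet> D t)"
      by (simp add: power2_norm_eq_inner[symmetric] power2_eq_square algebra_simps)
    have "D (t + \<delta>) \<bullet> D (t + \<delta>) \<le> D t \<bullet> D t + \<delta> * (2 * \<bar>K\<bar> * (D t \<bullet> D t) + e)" if "0 < \<delta>" "\<delta> < d" for \<delta>
    proof -
      have "D (t + \<delta>) \<bullet> D (t + \<delta>) \<le> D t \<bullet> D t + \<delta> * (2 * (D t \<bullet> D' t)) + e * \<delta>"
        using d(2)[of \<delta>] that by (simp add: abs_le_iff)
      also have "\<dots> \<le> D t \<bullet> D t + \<delta> * (2 * (\<bar>K\<bar> * (D t \<bullet> D t))) + e * \<delta>"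
        using i that e by (intro add_mono mult_left_mono) auto
      finally show ?thesis by (simp add: algebra_simps)
    qed
    then show "\<exists>d>0. \<forall>\<delta>. 0 < \<delta> \<longrightarrow> \<delta> < d \<longrightarrow>
        D (t + \<delta>) \<bullet> D (t + \<delta>) \<le> D t \<bullet> D t + \<delta> * (2 * \<bar>K\<bar> * (D t \<bullet> D t) + e)"
      using d(1) by blast
  qed auto
  then have "D T \<bullet> D T = 0"
    using inner_ge_zero[of "D T"] by (simp add: D0 del: inner_ge_zero)
  then show ?thesis by simp
qed

section \<open>Lowest value of the quadratic form\<close>

lemma norm_matrix_vec: "norm (A *v x) \<le> norm (A :: 'a::finite op) * norm x"
proof -
  have e: "cmod ((A *v x) $ i) \<le> norm (A $ i) * norm x" for i
  proof -
    have "cmod ((A *v x) $ i) \<le> (\<Sum>k\<in>UNIV. cmod (A $ i $ k) * cmod (x $ k))"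
      using norm_sum[of "\<lambda>k. A $ i $ k * x $ k" UNIV]
      by (simp add: matrix_vector_mult_def norm_mult)
    also have "\<dots> \<le> L2_set (\<lambda>k. cmod (A $ i $ k)) UNIV * L2_set (\<lambda>k. cmod (x $ k)) UNIV"
      using L2_set_mult_ineq[of "\<lambda>k. cmod (A $ i $ k)" "\<lambda>k. cmod (x $ k)" UNIV] by simp
    finally show ?thesis by (simp add: norm_vec_def)
  qed
  have "(norm (A *v x))\<^sup>2 \<le> (\<Sum>i\<in>UNIV. (norm (A $ i) * norm x)\<^sup>2)"
    unfolding norm_vec_sq by (intro sum_mono power_mono e) auto
  also have "\<dots> = (norm A * norm x)\<^sup>2"
    unfolding power_mult_distrib norm_vec_def[of A] L2_set_def
    by (simp add: sum_nonneg sum_distrib_right)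
  finally show ?thesis
    by (rule power2_le_imp_le) simp
qed

lemma op_scaleR_vec: "A *v (r *\<^sub>R x) = r *\<^sub>R (A *v (x :: complex^'a::finite))"
  by (simp add: vec_eq_iff matrix_vector_mult_def scaleR_sum_right)

text \<open>The lowest eigenvalue of a self-adjoint A. As an infimum over the unit sphere it is
  Lipschitz in A with no need to follow eigenvectors.\<close>

definition min_quad :: "'a::finite op \<Rightarrow> real"
  where "min_quad A = (INF v\<in>{v. norm v = 1}. v \<bullet> (A *v v))"

lemma quadform_bound: "norm v = 1 \<Longrightarrow> \<bar>v \<bullet> (A *v v)\<bar> \<le> norm (A :: 'a::finite op)"
  using Cauchy_Schwarz_ineq2[of v "A *v v"] norm_matrix_vec[of A v] by simp

lemma min_quad_le: "norm v = 1 \<Longrightarrow> min_quad A \<le> v \<bullet> (A *v v)"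
  unfolding min_quad_def
  by (rule cINF_lower) (auto intro!: bdd_belowI2[of _ "- norm A"] dest: quadform_bound[of _ A])

lemma min_quad_ge:
  assumes "\<And>v. norm v = 1 \<Longrightarrow> c \<le> v \<bullet> ((A :: 'a::finite op) *v v)" shows "c \<le> min_quad A"
proof -
  have "norm (axis undefined 1 :: complex^'a) = 1"
    by simp
  then have "{v :: complex^'a. norm v = 1} \<noteq> {}"
    by blast
  then show ?thesis
    unfolding min_quad_def using assms by (intro cINF_greatest) auto
qed

lemma op_le_iff_min_quad:
  assumes "self_adjoint (A :: 'a::finite op)" shows "m *\<^sub>R mat 1 \<preceq> A \<longleftrightarrow> m \<le> min_quad A"
proof
  assume "m *\<^sub>R mat 1 \<preceq> A"
  then show "m \<le> min_quad A"
    unfolding op_le_scaleR_iff by (intro min_quad_ge) (metis mult.right_neutral power_one)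
next
  assume m: "m \<le> min_quad A"
  have "m * (norm x)\<^sup>2 \<le> x \<bullet> (A *v x)" for x
  proof (cases "x = 0")
    case False
    define v where "v = (1 / norm x) *\<^sub>R x"
    have "norm v = 1" using False by (simp add: v_def)
    then have "m \<le> v \<bullet> (A *v v)" using m min_quad_le order_trans by blast
    then have "m * (norm x)\<^sup>2 \<le> (v \<bullet> (A *v v)) * (norm x)\<^sup>2"
      by (intro mult_right_mono) auto
    also have "\<dots> = (norm x *\<^sub>R v) \<bullet> (A *v (norm x *\<^sub>R v))"
      by (simp add: power2_eq_square op_scaleR_vec)
    also have "norm x *\<^sub>R v = x" using False by (simp add: v_def)
    finally show ?thesis .
  qed simp
  then show "m *\<^sub>R mat 1 \<preceq> A"
    using assms by (simp add: op_le_scaleR_iff)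
qed

lemma min_quad_lipschitz: "min_quad B - norm (A - B) \<le> min_quad (A :: 'a::finite op)"
proof (rule min_quad_ge)
  fix v :: "complex^'a" assume v: "norm v = 1"
  have "v \<bullet> (A *v v) = v \<bullet> (B *v v) + v \<bullet> ((A - B) *v v)"
    by (simp add: inner_add_right[symmetric] matrix_vector_mult_diff_rdistrib)
  then show "min_quad B - norm (A - B) \<le> v \<bullet> (A *v v)"
    using min_quad_le[OF v, of B] quadform_bound[OF v, of "A - B"] by linarith
qed

text \<open>With \<open>G = - \<i> H - (1/2) \<Sum> L\<^sup>* L\<close> one has \<open>P + \<delta> gen P = (1 + \<delta> G) P (1 + \<delta> G)\<^sup>* + \<delta> \<Sum> L P L\<^sup>* - \<delta>\<^sup>2 G P G\<^sup>*\<close>.\<close>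

lemma min_quad_gen:
  fixes A H :: "'a::finite op"
  assumes A: "adj A = A" and H: "adj H = H"
    and L: "\<And>k. k \<in> J \<Longrightarrow> L k ** adj (L k) = adj (L k) ** L k"
  obtains C where "0 \<le> C" "\<And>\<delta>. 0 \<le> \<delta> \<Longrightarrow> min_quad A - C * \<delta>\<^sup>2 \<le> min_quad (A + \<delta> *\<^sub>R gen H J L A)"
proof -
  define l where "l = min_quad A"
  have "l *\<^sub>R mat 1 \<preceq> A"
    using A by (simp add: op_le_iff_min_quad self_adjoint_def l_def)
  then obtain Z where Z: "A = l *\<^sub>R mat 1 + adj Z ** Z"
    using op_le_square by blast
  define P where "P = adj Z ** Z"
  define G where "G = (- \<i>) *\<^sub>C H - (1/2) *\<^sub>R (\<Sum>k\<in>J. adj (L k) ** L k)"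
  \<comment> \<open>Splitting off the lowest value leaves the nonnegative P, and the generator does
    not see the difference because the identity is stationary.\<close>
  have genA: "gen H J L A = gen H J L P"
    by (simp add: Z P_def gen_add gen_scaleR gen_one[OF L])
  have genP: "gen H J L P = G ** P + P ** adj G + (\<Sum>k\<in>J. L k ** P ** adj (L k))"
    using H by (simp add: gen_def G_def comm_def dissipator_def adj_simps op_linear matrix_sum_left
        matrix_sum_right sum_subtractf scaleR_sum_right sum.distrib matrix_mul_assoc algebra_simps)
  have eq: "A + \<delta> *\<^sub>R gen H J L A = l *\<^sub>R mat 1 + (mat 1 + \<delta> *\<^sub>R G) ** P ** adj (mat 1 + \<delta> *\<^sub>R G)
      + \<delta> *\<^sub>R (\<Sum>k\<in>J. L k ** P ** adj (L k)) - \<delta>\<^sup>2 *\<^sub>R (G ** P ** adj G)" for \<delta>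
    by (simp add: genA genP) (simp add: Z P_def[symmetric] adj_simps op_linear power2_eq_square algebra_simps)
  have q: "v \<bullet> ((K ** P ** adj K) *v v) = (norm ((Z ** adj K) *v v))\<^sup>2" for v K
    by (simp add: P_def power2_norm_eq_inner matrix_vector_mul_assoc[symmetric] inner_adj_vec adj_mult)
  define C where "C = (norm (Z ** adj G))\<^sup>2"
  have "l - C * \<delta>\<^sup>2 \<le> min_quad (A + \<delta> *\<^sub>R gen H J L A)" if "0 \<le> \<delta>" for \<delta>
  proof (rule min_quad_ge)
    fix v :: "complex^'a" assume v: "norm v = 1"
    have s: "(\<Sum>k\<in>J. B k) *v v = (\<Sum>k\<in>J. B k *v v)" for B :: "_ \<Rightarrow> 'a op"
      by (induction J rule: infinite_finite_induct) (auto simp: matrix_vector_mult_add_rdistrib)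
    have "v \<bullet> ((A + \<delta> *\<^sub>R gen H J L A) *v v) = l + (norm ((Z ** adj (mat 1 + \<delta> *\<^sub>R G)) *v v))\<^sup>2
        + \<delta> * (\<Sum>k\<in>J. (norm ((Z ** adj (L k)) *v v))\<^sup>2) - \<delta>\<^sup>2 * (norm ((Z ** adj G) *v v))\<^sup>2"
      using v unfolding eq q[symmetric]
      by (simp add: matrix_vector_mult_add_rdistrib matrix_vector_mult_diff_rdistrib scaleR_op_vec
          inner_add_right inner_diff_right s inner_sum_right power2_norm_eq_inner[symmetric])
    moreover have "(norm ((Z ** adj G) *v v))\<^sup>2 \<le> C"
      unfolding C_def using norm_matrix_vec[of "Z ** adj G" v] v by (intro power_mono) auto
    then have "\<delta>\<^sup>2 * (norm ((Z ** adj G) *v v))\<^sup>2 \<le> \<delta>\<^sup>2 * C"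
      by (rule mult_left_mono) simp
    moreover have "0 \<le> \<delta> * (\<Sum>k\<in>J. (norm ((Z ** adj (L k)) *v v))\<^sup>2)"
      using that by (intro mult_nonneg_nonneg sum_nonneg) auto
    moreover have "0 \<le> (norm ((Z ** adj (mat 1 + \<delta> *\<^sub>R G)) *v v))\<^sup>2"
      by simp
    ultimately show "l - C * \<delta>\<^sup>2 \<le> v \<bullet> ((A + \<delta> *\<^sub>R gen H J L A) *v v)"
      using mult.commute[of C "\<delta>\<^sup>2"] by linarith
  qed
  moreover have "0 \<le> C" by (simp add: C_def)
  ultimately show thesis using that unfolding l_def by blast
qed

text \<open>By \<open>min_quad_gen\<close> an Euler step lowers \<open>min_quad\<close> only to
  second order, so its decrease has upper right derivative at most 0. The Hamiltonian may depend on
  time to cover the Hartree flow; the bound 0 gives positivity of the N-body state.\<close>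

lemma op_le_preserved:
  fixes A :: "real \<Rightarrow> 'a::finite op"
  assumes A': "\<And>t. 0 \<le> t \<Longrightarrow> (A has_vector_derivative gen (H t) J L (A t)) (at t within {0..})"
    and A: "\<And>t. 0 \<le> t \<Longrightarrow> adj (A t) = A t" and H: "\<And>t. 0 \<le> t \<Longrightarrow> adj (H t) = H t"
    and L: "\<And>k. k \<in> J \<Longrightarrow> L k ** adj (L k) = adj (L k) ** L k"
    and m: "m *\<^sub>R mat 1 \<preceq> A 0" and T: "0 \<le> T"
  shows "m *\<^sub>R mat 1 \<preceq> A T"
proof -
  define g where "g = (\<lambda>t. min_quad (A 0) - min_quad (A t))"
  have lip: "\<bar>min_quad (A s) - min_quad (A t)\<bar> \<le> norm (A s - A t)" for s t
    using min_quad_lipschitz[of "A s" "A t"] min_quad_lipschitz[of "A t" "A s"] by (simp add: norm_minus_commute)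
  have Ac: "continuous_on {0..} A"
    using A' by (auto simp: continuous_on_eq_continuous_within intro: has_vector_derivative_continuous)
  have "continuous_on {0..T} g"
    unfolding continuous_on_iff
  proof (intro ballI allI impI)
    fix x e :: real assume x: "x \<in> {0..T}" and e: "0 < e"
    obtain d where "0 < d" "\<And>y. y \<in> {0..} \<Longrightarrow> dist y x < d \<Longrightarrow> dist (A y) (A x) < e"
      using Ac x e unfolding continuous_on_iff by (metis atLeastAtMost_iff atLeast_iff)
    moreover have "dist (g y) (g x) \<le> dist (A y) (A x)" for y
      using lip[of y x] by (simp add: g_def dist_norm abs_minus_commute)
    ultimately show "\<exists>d>0. \<forall>x'\<in>{0..T}. dist x' x < d \<longrightarrow> dist (g x') (g x) < e"
      by (meson atLeastAtMost_iff atLeast_iff le_less_trans)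
  qed
  then have "g T \<le> exp (0 * T) * g 0"
  proof (rule dini_gronwall[OF T])
    fix t e :: real assume t: "0 \<le> t" "t < T" and e: "0 < e"
    obtain C where C: "0 \<le> C" "\<And>\<delta>. 0 \<le> \<delta> \<Longrightarrow> min_quad (A t) - C * \<delta>\<^sup>2 \<le> min_quad (A t + \<delta> *\<^sub>R gen (H t) J L (A t))"
      by (rule min_quad_gen[OF A[OF t(1)] H[OF t(1)] L]) auto
    obtain d where d: "0 < d" "\<And>\<delta>. 0 \<le> \<delta> \<Longrightarrow> \<delta> < d \<Longrightarrow>
        norm (A (t + \<delta>) - A t - \<delta> *\<^sub>R gen (H t) J L (A t)) \<le> e / 2 * \<delta>"
      using has_vector_derivative_right_approx[OF A'[OF t(1)] t(1), of "e / 2"] e by auto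
    show "\<exists>d>0. \<forall>\<delta>. 0 < \<delta> \<longrightarrow> \<delta> < d \<longrightarrow> g (t + \<delta>) \<le> g t + \<delta> * (0 * g t + e)"
    \<comment> \<open>The second entry makes \<open>C * \<delta>\<^sup>2\<close> at most e/2 times
      \<delta>; the other half of e pays for the remainder of the derivative.\<close>
    proof (intro exI[of _ "min d (e / (2 * (C + 1)))"] conjI allI impI)
      show "0 < min d (e / (2 * (C + 1)))"
        using d e C(1) by simp
      fix \<delta> assume \<delta>: "0 < \<delta>" "\<delta> < min d (e / (2 * (C + 1)))"
      then have "\<delta> * (2 * (C + 1)) \<le> e"
        using C(1) by (simp add: field_simps)
      then have "C * \<delta> \<le> e / 2"
        using \<delta> by (simp add: algebra_simps)
      then have "C * \<delta>\<^sup>2 \<le> e / 2 * \<delta>"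
        using mult_right_mono[of "C * \<delta>" "e / 2" \<delta>] \<delta> by (simp add: power2_eq_square)
      moreover have "min_quad (A t + \<delta> *\<^sub>R gen (H t) J L (A t)) - e / 2 * \<delta> \<le> min_quad (A (t + \<delta>))"
        using min_quad_lipschitz[of "A t + \<delta> *\<^sub>R gen (H t) J L (A t)" "A (t + \<delta>)"] d(2)[of \<delta>] \<delta>
        by (simp add: algebra_simps)
      ultimately show "g (t + \<delta>) \<le> g t + \<delta> * (0 * g t + e)"
        using C(2)[of \<delta>] \<delta> by (simp add: g_def algebra_simps)
    qed
  qed (auto simp: g_def)
  then have "min_quad (A 0) \<le> min_quad (A T)"
    by (simp add: g_def)
  then show ?thesis
    using m A[OF T] A[of 0] by (simp add: op_le_iff_min_quad self_adjoint_def)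
qed

section \<open>Entropy production\<close>

lemma norm_density_le_1:
  assumes "0 *\<^sub>R mat 1 \<preceq> (\<Gamma> :: 'a::finite op)" and "trace \<Gamma> = 1"
  shows "norm \<Gamma> \<le> 1"
proof -
  obtain Q p where Q: "unitary Q" and G: "\<Gamma> = spec Q p"
    using assms spectral[of \<Gamma>] unfolding op_le_scaleR_iff by blast
  have p: "0 \<le> p i" for i
    using assms(1) unfolding G op_le_spec_iff[OF Q] by blast
  have s: "sum p UNIV = 1"
    using assms(2) by (simp add: G trace_spec[OF Q] flip: of_real_sum)
  have "(norm \<Gamma>)\<^sup>2 = (\<Sum>i\<in>UNIV. p i * p i)"
    by (simp add: power2_norm_eq_inner G inner_spec_same[OF Q])
  also have "\<dots> \<le> (\<Sum>i\<in>UNIV. p i * 1)"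
    using member_le_sum[of _ UNIV p] p s by (intro sum_mono mult_left_mono) auto
  finally show ?thesis
    using s by (simp add: power2_le_iff_abs_le flip: power2_eq_square) (simp add: power_le_one_iff)
qed

lemma gen_dual_bounded: 
  obtains c where "0 \<le> c" "\<And>X. norm (gen_dual H J L (X :: 'a::finite op)) \<le> c * norm X"
  using bounded_linear.nonneg_bounded[OF bounded_linear_gen_dual] by (metis mult.commute)

text \<open>The case of generator zero and step length zero in \<open>rel_ent_step\<close>. The
  constant 4 / m arises because density operators have norm at most 1. Continuity of the entropy
  follows without studying \<open>op_log\<close> as a function of the operator.\<close>

lemma rel_ent_lipschitz:
  fixes \<Gamma> \<rho> \<Gamma>' \<rho>' :: "'a::finite op"
  assumes m: "m > 0" and G: "m *\<^sub>R mat 1 \<preceq> \<Gamma>" and r: "m *\<^sub>R mat 1 \<preceq> \<rho>"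
    and G': "m *\<^sub>R mat 1 \<preceq> \<Gamma>'" and r': "m *\<^sub>R mat 1 \<preceq> \<rho>'"
    and tr: "trace \<Gamma> = 1" "trace \<rho> = 1" "trace \<Gamma>' = 1" "trace \<rho>' = 1"
    and e: "norm (\<Gamma>' - \<Gamma>) \<le> \<epsilon>" "norm (\<rho>' - \<rho>) \<le> \<epsilon>"
  shows "rel_ent \<Gamma>' \<rho>' \<le> rel_ent \<Gamma> \<rho> + (4 * (4 / m) + (4 / m)\<^sup>2) * \<epsilon>"
proof -
  obtain c where c: "\<And>X. norm (gen_dual 0 {} (\<lambda>_::unit. 0) (X :: 'a op)) \<le> c * norm X"
    using gen_dual_bounded by blast
  have n: "norm A \<le> 1" if "m *\<^sub>R mat 1 \<preceq> A" "trace A = 1" for A :: "'a op"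
    using op_le_zero_mono[OF _ that(1)] m that(2) by (intro norm_density_le_1) auto
  have "norm (\<rho>' - \<Gamma>') \<le> 2"
    using norm_triangle_ineq4[of \<rho>' \<Gamma>'] n[OF r'] n[OF G'] tr by simp
  then have "2 * norm (\<rho>' - \<Gamma>') / m \<le> 4 / m"
    using m by (simp add: divide_right_mono)
  then show ?thesis
    using rel_ent_step[OF m G r G' r' tr, of 0 0 "{}" "\<lambda>_::unit. 0" \<epsilon> "4 / m" c 1] e c n[OF G] n[OF r] tr
    by simp
qed

lemma continuous_on_rel_ent:
  fixes \<Gamma> \<rho> :: "real \<Rightarrow> 'a::finite op"
  assumes m: "m > 0" and c: "continuous_on S \<Gamma>" "continuous_on S \<rho>"
    and G: "\<And>t. t \<in> S \<Longrightarrow> m *\<^sub>R mat 1 \<preceq> \<Gamma> t" "\<And>t. t \<in> S \<Longrightarrow> trace (\<Gamma> t) = 1"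
    and r: "\<And>t. t \<in> S \<Longrightarrow> m *\<^sub>R mat 1 \<preceq> \<rho> t" "\<And>t. t \<in> S \<Longrightarrow> trace (\<rho> t) = 1"
  shows "continuous_on S (\<lambda>t. rel_ent (\<Gamma> t) (\<rho> t))"
  unfolding continuous_on_iff
proof (intro ballI allI impI)
  fix x e :: real assume x: "x \<in> S" and e: "0 < e"
  define C where "C = 4 * (4 / m) + (4 / m)\<^sup>2"
  have C: "0 < C" using m by (auto simp: C_def intro!: add_pos_nonneg)
  define \<epsilon> where "\<epsilon> = e / (2 * C)"
  have e': "0 < \<epsilon>" and Ce: "C * \<epsilon> = e / 2" using e C by (simp_all add: \<epsilon>_def)
  obtain d1 where d1: "0 < d1" "\<And>y. y \<in> S \<Longrightarrow> dist y x < d1 \<Longrightarrow> dist (\<Gamma> y) (\<Gamma> x) < \<epsilon>"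
    using c(1) x e' unfolding continuous_on_iff by metis
  obtain d2 where d2: "0 < d2" "\<And>y. y \<in> S \<Longrightarrow> dist y x < d2 \<Longrightarrow> dist (\<rho> y) (\<rho> x) < \<epsilon>"
    using c(2) x e' unfolding continuous_on_iff by metis
  have "dist (rel_ent (\<Gamma> y) (\<rho> y)) (rel_ent (\<Gamma> x) (\<rho> x)) < e" if y: "y \<in> S" "dist y x < min d1 d2" for y
  proof -
    have n: "norm (\<Gamma> y - \<Gamma> x) \<le> \<epsilon>" "norm (\<rho> y - \<rho> x) \<le> \<epsilon>"
      using d1(2)[OF y(1)] d2(2)[OF y(1)] y(2) by (auto simp: dist_norm)
    then have n': "norm (\<Gamma> x - \<Gamma> y) \<le> \<epsilon>" "norm (\<rho> x - \<rho> y) \<le> \<epsilon>"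
      by (auto simp: norm_minus_commute)
    have "rel_ent (\<Gamma> y) (\<rho> y) \<le> rel_ent (\<Gamma> x) (\<rho> x) + C * \<epsilon>"
      unfolding C_def using n x y(1) by (intro rel_ent_lipschitz m G r) auto
    moreover have "rel_ent (\<Gamma> x) (\<rho> x) \<le> rel_ent (\<Gamma> y) (\<rho> y) + C * \<epsilon>"
      unfolding C_def using n' x y(1) by (intro rel_ent_lipschitz m G r) auto
    ultimately show ?thesis
      using e by (simp add: dist_real_def Ce)
  qed
  then show "\<exists>d>0. \<forall>x'\<in>S. dist x' x < d \<longrightarrow> dist (rel_ent (\<Gamma> x') (\<rho> x')) (rel_ent (\<Gamma> x) (\<rho> x)) < e"
    using d1(1) d2(1) by (intro exI[of _ "min d1 d2"]) auto
qed

text \<open>The family is exp (- i s K), built on the eigenvalues of K. Its derivative is computed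
  at parameter 0 only, which is where \<open>rel_ent_dini\<close> uses it.\<close>

lemma unitary_flow:
  fixes K :: "'a::finite op"
  assumes "self_adjoint K"
  obtains U where "\<And>s. unitary (U s)" "U 0 = mat 1"
    "\<And>t S. ((\<lambda>s. U (s - t)) has_vector_derivative (- \<i>) *\<^sub>C K) (at t within S)"
proof -
  obtain Q d where Q: "unitary Q" and K: "K = spec Q d"
    using spectral[OF assms] by blast
  define U where "U = (\<lambda>s. Q ** diag (\<lambda>k. cis (- s * d k)) ** adj Q)"
  have diag_sum: "diag f = (\<Sum>k\<in>UNIV. f k *\<^sub>C unit_op k k)" for f :: "'a \<Rightarrow> complex"
  proof -
    have "(\<Sum>k\<in>UNIV. (f k *\<^sub>C unit_op k k) $ i $ j) = (\<Sum>k\<in>UNIV. if k = i then (if i = j then f i else 0) else 0)" for i j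
      by (intro sum.cong) (auto simp: cscale_def)
    then show ?thesis by (simp add: vec_eq_iff)
  qed
  have bl: "bounded_linear (\<lambda>c. c *\<^sub>C A)" for A :: "'a op"
    unfolding linear_conv_bounded_linear[symmetric]
    by unfold_locales (auto simp: cscale_def vec_eq_iff algebra_simps)
  have cis: "((\<lambda>s. cis (- (s - t) * x)) has_vector_derivative - \<i> * complex_of_real x) (at t within S)" for t x S
  proof -
    have "((\<lambda>z. exp (- \<i> * complex_of_real x * (z - complex_of_real t))) has_field_derivative
        - \<i> * complex_of_real x) (at (complex_of_real t))"
      by (auto intro!: derivative_eq_intros)
    from has_vector_derivative_real_field[OF this]
    have "((\<lambda>s. exp (- \<i> * complex_of_real x * (complex_of_real s - complex_of_real t))) has_vector_derivative
        - \<i> * complex_of_real x) (at t within S)" .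
    then show ?thesis
      by (simp add: cis_conv_exp algebra_simps)
  qed
  have "((\<lambda>s. diag (\<lambda>k. cis (- (s - t) * d k))) has_vector_derivative
      diag (\<lambda>k. - \<i> * complex_of_real (d k))) (at t within S)" for t S
    unfolding diag_sum
    by (intro has_vector_derivative_sum bounded_linear.has_vector_derivative[OF bl] cis)
  then have "((\<lambda>s. Q ** diag (\<lambda>k. cis (- (s - t) * d k))) has_vector_derivative
      (Q ** diag (\<lambda>k. - \<i> * complex_of_real (d k)))) (at t within S)" for t S
    by (rule bounded_linear.has_vector_derivative[OF bounded_bilinear.bounded_linear_right[OF bounded_bilinear_op_mult]])
  then have "((\<lambda>s. U (s - t)) has_vector_derivative
      (Q ** diag (\<lambda>k. - \<i> * complex_of_real (d k)) ** adj Q)) (at t within S)" for t S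
    unfolding U_def
    by (rule bounded_linear.has_vector_derivative[OF bounded_bilinear.bounded_linear_left[OF bounded_bilinear_op_mult]])
  moreover have "diag (\<lambda>k. - \<i> * complex_of_real (d k)) = (- \<i>) *\<^sub>C diag (\<lambda>k. complex_of_real (d k))"
    by (simp add: vec_eq_iff cscale_def)
  then have "Q ** diag (\<lambda>k. - \<i> * complex_of_real (d k)) ** adj Q = (- \<i>) *\<^sub>C K"
    by (simp only: K spec_def cscale_left cscale_right)
  moreover have "unitary (U s)" for s
    unfolding U_def by (intro unitary_mult unitary_adj Q unitary_diag) simp
  moreover have "U 0 = mat 1"
    using Q by (simp add: U_def diag_one unitary_def)
  ultimately show thesis using that by metis
qed

lemma inner_commutator:
  assumes "adj K = K"
  shows "((- \<i>) *\<^sub>C comm K A) \<bullet> B = - (((- \<i>) *\<^sub>C comm K B) \<bullet> (A :: 'a::finite op))"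
proof -
  have "B \<bullet> gen K {} (\<lambda>_::unit. 0) A = gen_dual K {} (\<lambda>_::unit. 0) B \<bullet> A"
    by (rule inner_gen[OF assms])
  then show ?thesis
    by (simp add: gen_def gen_dual_def inner_commute cscale_neg)
qed

text \<open>Only the part \<open>- \<i> [K, \<Gamma>]\<close> of the evolution that is not shared with \<open>\<rho>\<close> contributes: the shared
  part is contractive, and \<open>K\<close> moves \<open>\<Gamma>\<close> along a unitary orbit, on which \<open>tr \<Gamma> log \<Gamma>\<close> is constant.\<close>

lemma rel_ent_dini:
  fixes \<Gamma> \<rho> :: "real \<Rightarrow> 'a::finite op"
  assumes m: "m > 0" and t: "0 \<le> t"
    and G: "\<And>s. t \<le> s \<Longrightarrow> m *\<^sub>R mat 1 \<preceq> \<Gamma> s" "\<And>s. t \<le> s \<Longrightarrow> trace (\<Gamma> s) = 1"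
    and r: "\<And>s. t \<le> s \<Longrightarrow> m *\<^sub>R mat 1 \<preceq> \<rho> s" "\<And>s. t \<le> s \<Longrightarrow> trace (\<rho> s) = 1"
    and H: "adj H = H" and K: "adj K = K"
    and G': "(\<Gamma> has_vector_derivative gen H J L (\<Gamma> t) + (- \<i>) *\<^sub>C comm K (\<Gamma> t)) (at t within {0..})"
    and r': "(\<rho> has_vector_derivative gen H J L (\<rho> t)) (at t within {0..})"
    and e: "0 < e"
  shows "\<exists>d>0. \<forall>\<delta>. 0 < \<delta> \<longrightarrow> \<delta> < d \<longrightarrow>
    rel_ent (\<Gamma> (t + \<delta>)) (\<rho> (t + \<delta>)) \<le> rel_ent (\<Gamma> t) (\<rho> t)
      + \<delta> * (((- \<i>) *\<^sub>C comm K (op_log (\<rho> t))) \<bullet> \<Gamma> t + e)"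
proof -
  obtain U where U: "\<And>s. unitary (U s)" and U0: "U 0 = mat 1"
    and U': "\<And>t S. ((\<lambda>s. U (s - t)) has_vector_derivative (- \<i>) *\<^sub>C K) (at t within S)"
    using unitary_flow[of K] K unfolding self_adjoint_def by blast
  \<comment> \<open>R starts at \<Gamma> t and follows the flow of K alone, by unitary
    conjugation.\<close>
  define R where "R = (\<lambda>s. U (s - t) ** \<Gamma> t ** adj (U (s - t)))"
  have Rt: "R t = \<Gamma> t"
    by (simp add: R_def U0)
  have "((\<lambda>s. U (s - t) ** \<Gamma> t) has_vector_derivative (- \<i>) *\<^sub>C K ** \<Gamma> t) (at t within {0..})"
    by (rule bounded_linear.has_vector_derivative[OF bounded_bilinear.bounded_linear_left[OF bounded_bilinear_op_mult] U'])
  moreover have "((\<lambda>s. adj (U (s - t))) has_vector_derivative adj ((- \<i>) *\<^sub>C K)) (at t within {0..})"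
    by (rule bounded_linear.has_vector_derivative[OF bounded_linear_adj U'])
  ultimately have "(R has_vector_derivative (U (t - t) ** \<Gamma> t ** adj ((- \<i>) *\<^sub>C K) + (- \<i>) *\<^sub>C K ** \<Gamma> t ** adj (U (t - t)))) (at t within {0..})"
    unfolding R_def by (rule bounded_bilinear.has_vector_derivative[OF bounded_bilinear_op_mult])
  moreover have "U (t - t) ** \<Gamma> t ** adj ((- \<i>) *\<^sub>C K) + (- \<i>) *\<^sub>C K ** \<Gamma> t ** adj (U (t - t)) = (- \<i>) *\<^sub>C comm K (\<Gamma> t)"
    using K by (simp add: U0 adj_simps op_linear comm_def)
  ultimately have R': "(R has_vector_derivative (- \<i>) *\<^sub>C comm K (\<Gamma> t)) (at t within {0..})"
    by simp
  \<comment> \<open>The splitting error: first the flow of K, then one Euler step of the shared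
    generator. Its derivative at t vanishes, so \<open>rel_ent_step\<close> applies from R to
    \<Gamma> with an error of smaller order than \<delta>.\<close>
  define F where "F = (\<lambda>s. \<Gamma> s - (R s + (s - t) *\<^sub>R gen H J L (R s)))"
  have "((\<lambda>s. gen H J L (R s)) has_vector_derivative gen H J L ((- \<i>) *\<^sub>C comm K (\<Gamma> t))) (at t within {0..})"
    by (rule bounded_linear.has_vector_derivative[OF bounded_linear_gen R'])
  moreover have "((\<lambda>s. s - t) has_vector_derivative 1) (at t within {0..})"
    by (auto intro!: derivative_eq_intros)
  ultimately have "((\<lambda>s. (s - t) *\<^sub>R gen H J L (R s)) has_vector_derivative
      ((t - t) *\<^sub>R gen H J L ((- \<i>) *\<^sub>C comm K (\<Gamma> t)) + 1 *\<^sub>R gen H J L (R t))) (at t within {0..})"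
    by (intro bounded_bilinear.has_vector_derivative[OF bounded_bilinear_scaleR])
  then have "(F has_vector_derivative (gen H J L (\<Gamma> t) + (- \<i>) *\<^sub>C comm K (\<Gamma> t)) - ((- \<i>) *\<^sub>C comm K (\<Gamma> t) +
      ((t - t) *\<^sub>R gen H J L ((- \<i>) *\<^sub>C comm K (\<Gamma> t)) + 1 *\<^sub>R gen H J L (R t)))) (at t within {0..})"
    unfolding F_def by (intro has_vector_derivative_diff has_vector_derivative_add G' R')
  then have F': "(F has_vector_derivative 0) (at t within {0..})"
    by (simp add: Rt)
  have Ft: "F t = 0"
    by (simp add: F_def Rt)
  obtain c where c: "0 \<le> c" "\<And>X. norm (gen_dual H J L (X :: 'a op)) \<le> c * norm X"
    using gen_dual_bounded by blast
  define B where "B = 4 / m"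
  have B: "0 < B" using m by (simp add: B_def)
  define l where "l = op_log (\<rho> t)"
  \<comment> \<open>Half of e is shared by the perturbation of the functional and by the linear term
    in \<open>l\<close>; the other half covers the second-order term, through the last entry in the
    choice of \<open>d\<close>.\<close>
  define e' where "e' = e / (2 * (4 * B + B\<^sup>2 + norm l + 1))"
  have e': "0 < e'"
    unfolding e'_def using e B norm_ge_zero[of l] by (intro divide_pos_pos mult_pos_pos add_nonneg_pos) auto
  obtain d1 where d1: "0 < d1" "\<And>\<delta>. 0 \<le> \<delta> \<Longrightarrow> \<delta> < d1 \<Longrightarrow> norm (F (t + \<delta>) - F t - \<delta> *\<^sub>R 0) \<le> e' * \<delta>"
    using has_vector_derivative_right_approx[OF F' t e'] by blast
  obtain d2 where d2: "0 < d2" "\<And>\<delta>. 0 \<le> \<delta> \<Longrightarrow> \<delta> < d2 \<Longrightarrow> norm (\<rho> (t + \<delta>) - \<rho> t - \<delta> *\<^sub>R gen H J L (\<rho> t)) \<le> e' * \<delta>"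
    using has_vector_derivative_right_approx[OF r' t e'] by blast
  obtain d3 where d3: "0 < d3" "\<And>\<delta>. 0 \<le> \<delta> \<Longrightarrow> \<delta> < d3 \<Longrightarrow> norm (R (t + \<delta>) - R t - \<delta> *\<^sub>R ((- \<i>) *\<^sub>C comm K (\<Gamma> t))) \<le> e' * \<delta>"
    using has_vector_derivative_right_approx[OF R' t e'] by blast
  define d where "d = min (min d1 d2) (min d3 (e / (2 * ((c * B)\<^sup>2 + 1))))"
  have "0 < e / (2 * ((c * B)\<^sup>2 + 1))"
    using e by (intro divide_pos_pos mult_pos_pos add_nonneg_pos) auto
  then have d0: "0 < d"
    using d1(1) d2(1) d3(1) by (simp add: d_def)
  have n: "norm A \<le> 1" if "m *\<^sub>R mat 1 \<preceq> A" "trace A = 1" for A :: "'a op"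
    using op_le_zero_mono[OF _ that(1)] m that(2) by (intro norm_density_le_1) auto
  obtain V p where V: "unitary V" and Gs: "\<Gamma> t = spec V p"
    using G(1)[of t] spectral[of "\<Gamma> t"] unfolding op_le_scaleR_iff by blast
  have "rel_ent (\<Gamma> (t + \<delta>)) (\<rho> (t + \<delta>)) \<le> rel_ent (\<Gamma> t) (\<rho> t)
      + \<delta> * (((- \<i>) *\<^sub>C comm K l) \<bullet> \<Gamma> t + e)" if \<delta>: "0 < \<delta>" "\<delta> < d" for \<delta>
  proof -
    have td: "t \<le> t + \<delta>" "t \<le> t" using \<delta> by auto
    have Rs: "R (t + \<delta>) = spec (U \<delta> ** V) p"
      by (simp add: R_def Gs unitary_conj_spec)
    have UV: "unitary (U \<delta> ** V)"
      by (intro unitary_mult U V)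
    have Rm: "m *\<^sub>R mat 1 \<preceq> R (t + \<delta>)"
      using G(1)[of t] unfolding Rs op_le_spec_iff[OF UV] by (simp add: Gs op_le_spec_iff[OF V])
    have Rtr: "trace (R (t + \<delta>)) = 1"
      using G(2)[of t] by (simp add: Rs trace_spec[OF UV] Gs trace_spec[OF V])
    \<comment> \<open>Conjugation keeps the eigenvalues, so along R only the pairing with the
      logarithm of \<rho> t changes. That pairing is linear in R, and
      \<open>inner_commutator\<close> moves the commutator onto the logarithm.\<close>
    have Rent: "R (t + \<delta>) \<bullet> op_log (R (t + \<delta>)) = \<Gamma> t \<bullet> op_log (\<Gamma> t)"
      by (simp add: Rs Gs op_log_spec[OF UV] op_log_spec[OF V] inner_spec_same[OF UV] inner_spec_same[OF V])
    have "norm (\<rho> (t + \<delta>) - \<Gamma> (t + \<delta>)) \<le> 2"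
      using norm_triangle_ineq4[of "\<rho> (t + \<delta>)" "\<Gamma> (t + \<delta>)"] n[OF r(1) r(2)] n[OF G(1) G(2)] td
      by (smt (verit))
    then have nB: "2 * norm (\<rho> (t + \<delta>) - \<Gamma> (t + \<delta>)) / m \<le> B"
      using m by (simp add: B_def divide_right_mono)
    have "rel_ent (\<Gamma> (t + \<delta>)) (\<rho> (t + \<delta>)) \<le> rel_ent (R (t + \<delta>)) (\<rho> t)
        + ((4 * B + B\<^sup>2) * (e' * \<delta>) + \<delta>\<^sup>2 * (1 * (\<bar>c\<bar> * B)\<^sup>2))"
    proof (rule rel_ent_step[OF m Rm r(1)[OF td(2)] G(1)[OF td(1)] r(1)[OF td(1)] Rtr r(2)[OF td(2)] G(2)[OF td(1)] r(2)[OF td(1)] H])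
      show "norm (\<Gamma> (t + \<delta>) - (R (t + \<delta>) + \<delta> *\<^sub>R gen H J L (R (t + \<delta>)))) \<le> e' * \<delta>"
        using d1(2)[of \<delta>] \<delta> by (simp add: d_def Ft) (simp add: F_def)
      show "norm (\<rho> (t + \<delta>) - (\<rho> t + \<delta> *\<^sub>R gen H J L (\<rho> t))) \<le> e' * \<delta>"
        using d2(2)[of \<delta>] \<delta> by (simp add: d_def algebra_simps)
    qed (use \<delta> nB c n[OF Rm Rtr] n[OF r(1)[OF td(2)] r(2)[OF td(2)]] in auto)
    moreover have "rel_ent (R (t + \<delta>)) (\<rho> t) \<le> rel_ent (\<Gamma> t) (\<rho> t) + \<delta> * (((- \<i>) *\<^sub>C comm K l) \<bullet> \<Gamma> t) + norm l * (e' * \<delta>)"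
    proof -
      define E where "E = R (t + \<delta>) - R t - \<delta> *\<^sub>R ((- \<i>) *\<^sub>C comm K (\<Gamma> t))"
      have "norm E \<le> e' * \<delta>"
        unfolding E_def using d3(2)[of \<delta>] \<delta> by (simp add: d_def)
      then have "- (E \<bullet> l) \<le> norm l * (e' * \<delta>)"
        using Cauchy_Schwarz_ineq2[of E l] mult_right_mono[of "norm E" "e' * \<delta>" "norm l"] by (simp add: mult.commute) 
      moreover have "R (t + \<delta>) = \<Gamma> t + \<delta> *\<^sub>R ((- \<i>) *\<^sub>C comm K (\<Gamma> t)) + E"
        by (simp add: E_def Rt)
      then have "R (t + \<delta>) \<bullet> l = \<Gamma> t \<bullet> l + \<delta> * (((- \<i>) *\<^sub>C comm K (\<Gamma> t)) \<bullet> l) + E \<bullet> l"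
        by (simp only: inner_add_left inner_scaleR_left)
      moreover have "((- \<i>) *\<^sub>C comm K (\<Gamma> t)) \<bullet> l = - (((- \<i>) *\<^sub>C comm K l) \<bullet> \<Gamma> t)"
        by (rule inner_commutator[OF K])
      ultimately show ?thesis
        by (simp add: rel_ent_def inner_diff_right Rent flip: l_def)
    qed
    moreover have "(4 * B + B\<^sup>2) * (e' * \<delta>) + norm l * (e' * \<delta>) \<le> (e / 2) * \<delta>"
    proof -
      have "(4 * B + B\<^sup>2 + norm l) * e' \<le> (4 * B + B\<^sup>2 + norm l + 1) * e'"
        using e' by (intro mult_right_mono) auto
      also have "\<dots> = e / 2"
        unfolding e'_def using B norm_ge_zero[of l] by (simp add: field_simps add_nonneg_eq_0_iff)
      finally have "(4 * B + B\<^sup>2 + norm l) * e' * \<delta> \<le> e / 2 * \<delta>"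
        using \<delta> by (intro mult_right_mono) auto
      then show ?thesis by (simp add: algebra_simps)
    qed
    moreover have "\<delta>\<^sup>2 * (1 * (\<bar>c\<bar> * B)\<^sup>2) \<le> (e / 2) * \<delta>"
    proof -
      have k: "0 < 2 * ((c * B)\<^sup>2 + 1)"
        by (intro mult_pos_pos add_nonneg_pos) auto
      have "\<delta> * (2 * ((c * B)\<^sup>2 + 1)) \<le> e"
        using \<delta> pos_le_divide_eq[OF k, of \<delta> e] by (simp add: d_def)
      then have "\<delta> * (c * B)\<^sup>2 \<le> e / 2"
        using \<delta> by (simp add: algebra_simps)
      then have "\<delta> * (c * B)\<^sup>2 * \<delta> \<le> e / 2 * \<delta>"
        using \<delta> by (intro mult_right_mono) auto
      then show ?thesis
        using c(1) by (simp add: power2_eq_square mult_ac)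
    qed
    ultimately have "rel_ent (\<Gamma> (t + \<delta>)) (\<rho> (t + \<delta>)) \<le> rel_ent (\<Gamma> t) (\<rho> t)
      + \<delta> * (((- \<i>) *\<^sub>C comm K l) \<bullet> \<Gamma> t) + e / 2 * \<delta> + e / 2 * \<delta>"
      by linarith
    then show ?thesis
      by (simp add: algebra_simps)
  qed
  then show ?thesis
    using d0 unfolding l_def by blast
qed

section \<open>Operators on tensor powers\<close>

lemma sum_fun_prod:
  fixes f :: "'n::finite \<Rightarrow> 'd::finite \<Rightarrow> 'b::comm_semiring_1"
  shows "(\<Sum>z\<in>UNIV. \<Prod>k\<in>UNIV. f k (z k)) = (\<Prod>k\<in>UNIV. \<Sum>c\<in>UNIV. f k c)"
  using prod_sum_PiE[of "UNIV :: 'n set" "\<lambda>_. UNIV :: 'd set" f] by (simp add: PiE_UNIV_domain)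

lemma prod_delta:
  fixes x y :: "'n::finite \<Rightarrow> 'd"
  shows "(\<Prod>k\<in>UNIV. if x k = y k then f k else (0 :: 'b::{comm_semiring_1, semiring_1_no_zero_divisors}))
    = (if x = y then \<Prod>k\<in>UNIV. f k else 0)"
proof (cases "x = y")
  case False
  then obtain k where "x k \<noteq> y k" by blast
  then have "(\<Prod>k\<in>UNIV. if x k = y k then f k else 0) = 0"
    by (intro prod_zero) auto
  then show ?thesis using False by simp
qed simp

lemma op_expand: "A = (\<Sum>p\<in>UNIV. \<Sum>q\<in>UNIV. A $ p $ q *\<^sub>C unit_op p (q :: 'a::finite))"
proof -
  have "(\<Sum>p\<in>UNIV. \<Sum>q\<in>UNIV. (A $ p $ q *\<^sub>C unit_op p q) $ i $ j) = A $ i $ j" for i j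
  proof -
    have "(\<Sum>p\<in>UNIV. \<Sum>q\<in>UNIV. (A $ p $ q *\<^sub>C unit_op p q) $ i $ j)
        = (\<Sum>p\<in>UNIV. \<Sum>q\<in>UNIV. if q = j then (if p = i then A $ p $ q else 0) else 0)"
      by (intro sum.cong refl) (auto simp: cscale_def)
    then show ?thesis by simp
  qed
  then show ?thesis by (simp add: vec_eq_iff)
qed

text \<open>Tensor product of possibly different factors. One-body operators and tensor powers are
  instances, so their algebra is done factor by factor with \<open>prod_op_mult\<close>.\<close>

definition prod_op :: "('n \<Rightarrow> 'd::finite op) \<Rightarrow> ('n::finite \<Rightarrow> 'd) op"
  where "prod_op A = (\<chi> x y. \<Prod>k\<in>UNIV. A k $ x k $ y k)"

lemma prod_op_mult: "prod_op A ** prod_op B = prod_op (\<lambda>k. A k ** B k)"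
  by (simp add: vec_eq_iff prod_op_def matrix_matrix_mult_def prod.distrib[symmetric]
      sum_fun_prod[of "\<lambda>k c. A k $ _ k $ c * B k $ c $ _ k"])

lemma adj_prod_op: "adj (prod_op A) = prod_op (\<lambda>k. adj (A k))"
  by (simp add: vec_eq_iff prod_op_def)

lemma trace_prod_op: "trace (prod_op A) = (\<Prod>k\<in>UNIV. trace (A k))"
  by (simp add: trace_def prod_op_def sum_fun_prod[of "\<lambda>k c. A k $ c $ c"])

lemma prod_op_diag: "prod_op (\<lambda>k. diag (d k)) = diag (\<lambda>x. \<Prod>k\<in>UNIV. d k (x k))"
  by (simp add: vec_eq_iff prod_op_def prod_delta)

lemma prod_op_one: "prod_op (\<lambda>_. mat 1) = mat 1"
  using prod_op_diag[of "\<lambda>_ _. 1"] by (simp add: diag_one)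

lemma tensor_power_eq: "tensor_power A = prod_op (\<lambda>_. A)"
  by (simp add: tensor_power_def prod_op_def)

section \<open>One-body and two-body operators\<close>

definition agree_off :: "'n set \<Rightarrow> ('n \<Rightarrow> 'd) \<Rightarrow> ('n \<Rightarrow> 'd) \<Rightarrow> bool"
  where "agree_off I x y \<longleftrightarrow> (\<forall>k. k \<notin> I \<longrightarrow> x k = y k)"

lemma agree_off_commute: "agree_off I x y = agree_off I y x"
  by (auto simp: agree_off_def)

lemma one_body_nth: "one_body j A $ x $ y = (if agree_off {j} x y then A $ x j $ y j else 0)"
  by (simp add: one_body_def agree_off_def)

lemma two_body_nth: "two_body i j W $ x $ y = (if agree_off {i, j} x y then W $ (x i, x j) $ (y i, y j) else 0)"
  by (simp add: two_body_def agree_off_def)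

lemma prod_agree_off:
  fixes x y :: "'n::finite \<Rightarrow> 'd"
  shows "(\<Prod>k\<in>UNIV - I. if x k = y k then 1 else (0 :: 'b::{comm_semiring_1, semiring_1_no_zero_divisors}))
    = (if agree_off I x y then 1 else 0)"
proof (cases "agree_off I x y")
  case False
  then have "(\<Prod>k\<in>UNIV - I. if x k = y k then 1 else (0 :: 'b)) = 0"
    unfolding agree_off_def by (intro prod_zero) auto
  then show ?thesis using False by simp
next
  case True
  then have "(\<Prod>k\<in>UNIV - I. if x k = y k then 1 else (0 :: 'b)) = (\<Prod>k\<in>UNIV - I. 1)"
    unfolding agree_off_def by (intro prod.cong) auto
  then show ?thesis using True by simp
qed

lemma one_body_eq: "one_body j A = prod_op (\<lambda>k. if k = j then A else mat 1)"
proof -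
  have "(\<Prod>k\<in>UNIV. (if k = j then A else mat 1) $ x k $ y k)
      = A $ x j $ y j * (\<Prod>k\<in>UNIV - {j}. if x k = y k then 1 else 0)" for x y
    by (subst prod.remove[of _ j]) (auto simp: mat_def intro!: prod.cong)
  then show ?thesis by (simp add: vec_eq_iff prod_op_def one_body_nth prod_agree_off)
qed

lemma one_body_mult: "one_body j A ** one_body j B = one_body j (A ** B)"
  by (auto simp: one_body_eq prod_op_mult intro!: arg_cong[where f = prod_op])

lemma one_body_commute: "i \<noteq> j \<Longrightarrow> one_body i A ** one_body j B = one_body j B ** one_body i A"
  by (auto simp: one_body_eq prod_op_mult intro!: arg_cong[where f = prod_op])

lemma adj_one_body: "adj (one_body j A) = one_body j (adj A)"
  by (auto simp: one_body_eq adj_prod_op intro!: arg_cong[where f = prod_op])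

lemma one_body_add: "one_body j (A + B) = one_body j A + one_body j B"
  by (simp add: one_body_nth vec_eq_iff)

lemma unitary_tensor_power: "unitary Q \<Longrightarrow> unitary (tensor_power Q)"
  by (simp add: unitary_def tensor_power_eq adj_prod_op prod_op_mult prod_op_one)

lemma tensor_power_spec: "tensor_power (spec Q d) = spec (tensor_power Q) (\<lambda>x. \<Prod>k\<in>UNIV. d (x k))"
  by (simp add: spec_def tensor_power_eq adj_prod_op prod_op_mult
      flip: prod_op_diag[of "\<lambda>_ i. complex_of_real (d i)"])

lemma one_body_spec:
  assumes Q: "unitary Q"
  shows "one_body j (spec Q d) = spec (tensor_power Q) (\<lambda>x. d (x j))"
proof -
  have "diag (\<lambda>x. complex_of_real (d (x j))) = one_body j (diag (\<lambda>i. complex_of_real (d i)))"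
    by (auto simp: vec_eq_iff one_body_nth agree_off_def fun_eq_iff)
  then show ?thesis
    using Q by (auto simp: spec_def tensor_power_eq adj_prod_op prod_op_mult one_body_eq unitary_def
        intro!: arg_cong[where f = prod_op])
qed

lemma spec_sum: "spec Q (\<lambda>x. \<Sum>j\<in>J. e j x) = (\<Sum>j\<in>J. spec Q (e j))"
proof -
  have "diag (\<lambda>i. complex_of_real (\<Sum>j\<in>J. e j i)) = (\<Sum>j\<in>J. diag (\<lambda>i. complex_of_real (e j i)))"
    by (simp add: vec_eq_iff)
  then show ?thesis
    by (simp add: spec_def matrix_sum_left matrix_sum_right)
qed

text \<open>The eigenvalues of the tensor power are products, and the logarithm of a product of
  positive numbers is a sum. Positivity matters here because of the convention
  \<open>ln 0 = 0\<close>.\<close>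

lemma op_log_tensor_power:
  assumes m: "m > 0" and g: "m *\<^sub>R mat 1 \<preceq> \<gamma>"
  shows "op_log (tensor_power \<gamma> :: ('n::finite \<Rightarrow> 'd::finite) op) = (\<Sum>j\<in>UNIV. one_body j (op_log \<gamma>))"
proof -
  obtain Q d where Q: "unitary Q" and gs: "\<gamma> = spec Q d"
    using g spectral[of \<gamma>] unfolding op_le_scaleR_iff by blast
  have d: "d i > 0" for i
    using g less_le_trans[OF m] by (auto simp: gs op_le_spec_iff[OF Q])
  have "ln (\<Prod>k\<in>UNIV. d (x k)) = (\<Sum>k\<in>UNIV. ln (d (x k)))" for x :: "'n \<Rightarrow> 'd"
    using d by (intro ln_prod) (simp_all add: less_imp_neq[OF d, symmetric])
  then show ?thesis
    by (simp add: gs tensor_power_spec op_log_spec unitary_tensor_power Q one_body_spec spec_sum)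
qed

lemma op_le_tensor_power:
  assumes m: "m \<ge> 0" and g: "m *\<^sub>R mat 1 \<preceq> \<gamma>"
  shows "m ^ CARD('n) *\<^sub>R mat 1 \<preceq> (tensor_power \<gamma> :: ('n::finite \<Rightarrow> 'd::finite) op)"
proof -
  obtain Q d where Q: "unitary Q" and gs: "\<gamma> = spec Q d"
    using g spectral[of \<gamma>] unfolding op_le_scaleR_iff by blast
  have d: "m \<le> d i" for i
    using g by (simp add: gs op_le_spec_iff[OF Q])
  have "m ^ CARD('n) \<le> (\<Prod>k\<in>UNIV. d (x k))" for x :: "'n \<Rightarrow> 'd"
    using prod_mono[of "UNIV :: 'n set" "\<lambda>_. m" "\<lambda>k. d (x k)"] d m by simp
  then show ?thesis
    by (simp add: gs tensor_power_spec op_le_spec_iff unitary_tensor_power Q)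
qed

lemma sum_fibre:
  fixes f :: "('n::finite \<Rightarrow> 'd::finite) \<Rightarrow> 'b::comm_monoid_add"
  assumes ij: "i \<noteq> j"
  shows "(\<Sum>y\<in>UNIV. if agree_off {i, j} x y then f y else 0)
    = (\<Sum>p\<in>UNIV. f (x(i := fst p, j := snd p)))"
proof -
  have "(\<Sum>y\<in>UNIV. if agree_off {i, j} x y then f y else 0)
      = sum f {y. agree_off {i, j} x y}"
    by (simp add: sum.If_cases)
  also have "\<dots> = (\<Sum>p\<in>UNIV. f (x(i := fst p, j := snd p)))"
  proof (rule sum.reindex_bij_witness[where j = "\<lambda>y. (y i, y j)" and i = "\<lambda>p. x(i := fst p, j := snd p)"])
    fix y assume "y \<in> {y. agree_off {i, j} x y}"
    then have "x(i := y i, j := y j) = y"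
      by (intro ext) (simp add: agree_off_def)
    then show "x(i := fst (y i, y j), j := snd (y i, y j)) = y"
      and "f (x(i := fst (y i, y j), j := snd (y i, y j))) = f y"
      by simp_all
  qed (use ij in \<open>simp_all add: agree_off_def\<close>)
  finally show ?thesis .
qed

lemma two_body_mult:
  fixes W W' :: "('d::finite \<times> 'd) op"
  assumes ij: "i \<noteq> (j :: 'n::finite)"
  shows "two_body i j W ** two_body i j W' = two_body i j (W ** W')"
proof -
  have "(two_body i j W ** two_body i j W') $ x $ z = two_body i j (W ** W') $ x $ z" for x z :: "'n \<Rightarrow> 'd"
  proof -
    have "(two_body i j W ** two_body i j W') $ x $ z = (\<Sum>y\<in>UNIV. if agree_off {i, j} x y
        then W $ (x i, x j) $ (y i, y j) * (if agree_off {i, j} x z then W' $ (y i, y j) $ (z i, z j) else 0) else 0)"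
      unfolding matrix_matrix_mult_def two_body_nth vec_lambda_beta
      by (intro sum.cong refl) (auto simp: agree_off_def)
    also have "\<dots> = two_body i j (W ** W') $ x $ z"
      unfolding sum_fibre[OF ij] using ij by (simp add: two_body_nth matrix_matrix_mult_def)
    finally show ?thesis .
  qed
  then show ?thesis by (simp add: vec_eq_iff)
qed

lemma two_body_one: "two_body i j (mat 1) = mat 1"
  by (auto simp: vec_eq_iff two_body_nth mat_def agree_off_def)

lemma adj_two_body: "adj (two_body i j W) = two_body i j (adj W)"
  by (simp add: vec_eq_iff two_body_nth agree_off_commute)

lemma two_body_diff: "two_body i j (A - B) = two_body i j A - two_body i j B"
  by (simp add: vec_eq_iff two_body_nth)

lemma two_body_add: "two_body i j (A + B) = two_body i j A + two_body i j B"
  by (simp add: vec_eq_iff two_body_nth)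

lemma two_body_zero: "two_body i j 0 = 0"
  by (simp add: vec_eq_iff two_body_nth)

lemma two_body_sum: "two_body i j (\<Sum>k\<in>J. A k) = (\<Sum>k\<in>J. two_body i j (A k))"
  by (induction J rule: infinite_finite_induct) (auto simp: two_body_add two_body_zero)

lemma two_body_cscale: "two_body i j (c *\<^sub>C A) = c *\<^sub>C two_body i j A"
  by (simp add: vec_eq_iff two_body_nth cscale_def)

lemma two_body_comm: "i \<noteq> j \<Longrightarrow> two_body i j (comm A B) = comm (two_body i j A) (two_body i j B)"
  by (simp add: comm_def two_body_diff two_body_mult)

lemma two_body_tensor:
  fixes A B :: "'d::finite op"
  assumes ij: "i \<noteq> (j :: 'n::finite)"
  shows "two_body i j (A \<otimes>\<^sub>2 B) = one_body i A ** one_body j B"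
proof -
  have "(\<Prod>k\<in>UNIV. (if k = i then A else if k = j then B else mat 1) $ x k $ y k)
      = two_body i j (A \<otimes>\<^sub>2 B) $ x $ y" for x y
  proof -
    have "(\<Prod>k\<in>UNIV. (if k = i then A else if k = j then B else mat 1) $ x k $ y k)
       = A $ x i $ y i * (B $ x j $ y j * (\<Prod>k\<in>UNIV - {i, j}. if x k = y k then 1 else 0))"
      using ij by (subst prod.remove[of _ i], simp, simp, subst prod.remove[of _ j])
        (auto simp: mat_def Diff_insert2[symmetric] insert_commute intro!: prod.cong)
    then show ?thesis
      by (simp add: two_body_nth tensor2_def prod_agree_off)
  qed
  then have "two_body i j (A \<otimes>\<^sub>2 B) = prod_op (\<lambda>k. if k = i then A else if k = j then B else mat 1)"
    by (simp add: vec_eq_iff prod_op_def)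
  then show ?thesis
    using ij by (auto simp: one_body_eq prod_op_mult intro!: arg_cong[where f = prod_op])
qed

lemma one_body_one: "one_body j (mat 1) = mat 1"
  by (simp add: one_body_eq prod_op_one)

lemma two_body_left: "i \<noteq> j \<Longrightarrow> two_body i j (A \<otimes>\<^sub>2 mat 1) = one_body i A"
  by (simp add: two_body_tensor one_body_one)

lemma two_body_right: "i \<noteq> j \<Longrightarrow> two_body i j (mat 1 \<otimes>\<^sub>2 B) = one_body j B"
  by (simp add: two_body_tensor one_body_one)

lemma unit_op_tensor: "unit_op P Q = unit_op (fst P) (fst Q) \<otimes>\<^sub>2 unit_op (snd P) (snd Q)"
  by (auto simp: vec_eq_iff tensor2_def prod_eq_iff)

text \<open>Expansion in matrix units, which are elementary tensors; claims about pair operators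
  reduce to products of one-body operators.\<close>

lemma two_body_expand:
  fixes W :: "('d::finite \<times> 'd) op"
  assumes "i \<noteq> (j :: 'n::finite)"
  shows "two_body i j W = (\<Sum>P\<in>UNIV. \<Sum>Q\<in>UNIV. W $ P $ Q *\<^sub>C
    (one_body i (unit_op (fst P) (fst Q)) ** one_body j (unit_op (snd P) (snd Q))))"
  by (subst op_expand[of W]) (simp add: two_body_sum two_body_cscale unit_op_tensor two_body_tensor[OF assms])

lemma two_body_one_body_commute:
  fixes W :: "('d::finite \<times> 'd) op"
  assumes ij: "i \<noteq> (j :: 'n::finite)" and a: "a \<noteq> i" "a \<noteq> j"
  shows "two_body i j W ** one_body a B = one_body a B ** two_body i j W"
proof -
  have "one_body i A ** one_body j A' ** one_body a B = one_body a B ** (one_body i A ** one_body j A')" for A A'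
    by (metis a one_body_commute matrix_mul_assoc)
  then show ?thesis
    by (simp add: two_body_expand[OF ij] matrix_sum_left matrix_sum_right cscale_left cscale_right)
qed

lemma swap_op_mult_nth: "(swap_op ** W) $ p $ q = W $ prod.swap p $ q"
  by (simp add: swap_op_def matrix_matrix_mult_def if_distrib if_distribR cong: if_cong)

lemma mult_swap_op_nth: "(W ** swap_op) $ p $ q = W $ p $ prod.swap q"
proof -
  have "q = prod.swap k \<longleftrightarrow> k = prod.swap q" for k :: "'a \<times> 'a"
    by (cases k; cases q) auto
  then show ?thesis
    by (simp add: swap_op_def matrix_matrix_mult_def if_distrib if_distribR cong: if_cong)
qed

lemma two_body_swap:
  assumes "swap_op ** W ** swap_op = W"
  shows "two_body j i W = two_body i j W"
proof -
  have "W $ (a, b) $ (c, d) = W $ (b, a) $ (d, c)" for a b c d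
    by (subst assms[symmetric]) (simp add: swap_op_mult_nth mult_swap_op_nth)
  then show ?thesis
    by (simp add: vec_eq_iff two_body_nth insert_commute)
qed

section \<open>Time derivative of tensor powers\<close>

definition slot :: "'d::finite op \<Rightarrow> 'n \<Rightarrow> 'd op \<Rightarrow> ('n::finite \<Rightarrow> 'd) op"
  where "slot \<gamma> j X = prod_op (\<lambda>k. if k = j then X else \<gamma>)"

lemma slot_nth: "slot \<gamma> j X $ x $ y = X $ x j $ y j * (\<Prod>k\<in>UNIV - {j}. \<gamma> $ x k $ y k)"
  by (simp add: slot_def prod_op_def prod.remove[of UNIV j])

lemma slot_mult: "slot \<gamma> j (A ** \<gamma> ** B) = one_body j A ** tensor_power \<gamma> ** one_body j B"
  by (auto simp: slot_def one_body_eq tensor_power_eq prod_op_mult intro!: arg_cong[where f = prod_op])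

lemma slot_linear:
  "slot \<gamma> j (A + B) = slot \<gamma> j A + slot \<gamma> j B"
  "slot \<gamma> j (A - B) = slot \<gamma> j A - slot \<gamma> j B"
  "slot \<gamma> j (r *\<^sub>R A) = r *\<^sub>R slot \<gamma> j A"
  "slot \<gamma> j (c *\<^sub>C A) = c *\<^sub>C slot \<gamma> j A"
  by (simp_all add: vec_eq_iff slot_nth algebra_simps cscale_def)

text \<open>The product rule holds for each entry, a product of scalars; the entries are then
  reassembled with matrix units.\<close>

lemma tensor_power_derivative:
  fixes \<gamma> :: "real \<Rightarrow> 'd::finite op"
  assumes "(\<gamma> has_vector_derivative \<gamma>') (at t within S)"
  shows "((\<lambda>s. tensor_power (\<gamma> s) :: ('n::finite \<Rightarrow> 'd) op) has_vector_derivative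
    (\<Sum>j\<in>UNIV. slot (\<gamma> t) j \<gamma>')) (at t within S)"
proof -
  have bl: "bounded_linear (\<lambda>c. c *\<^sub>C A)" for A :: "('n \<Rightarrow> 'd) op"
    unfolding linear_conv_bounded_linear[symmetric]
    by unfold_locales (auto simp: cscale_def vec_eq_iff algebra_simps)
  have e: "((\<lambda>s. \<gamma> s $ a $ b) has_derivative (\<lambda>h. h *\<^sub>R (\<gamma>' $ a $ b))) (at t within S)" for a b
    using bounded_linear.has_vector_derivative[OF bounded_linear_vec_nth
        bounded_linear.has_vector_derivative[OF bounded_linear_vec_nth assms]]
    by (simp add: has_vector_derivative_def)
  have p: "((\<lambda>s. \<Prod>k\<in>UNIV. \<gamma> s $ x k $ y k) has_vector_derivative
      (\<Sum>j\<in>UNIV. slot (\<gamma> t) j \<gamma>' $ x $ y)) (at t within S)" for x y :: "'n \<Rightarrow> 'd"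
    unfolding has_vector_derivative_def
    by (rule has_derivative_eq_rhs[OF has_derivative_prod[OF e]])
      (simp add: fun_eq_iff slot_nth scaleR_sum_right)
  have "((\<lambda>s. \<Sum>x\<in>UNIV. \<Sum>y\<in>UNIV. (\<Prod>k\<in>UNIV. \<gamma> s $ x k $ y k) *\<^sub>C unit_op x y) has_vector_derivative
      (\<Sum>x\<in>UNIV. \<Sum>y\<in>UNIV. (\<Sum>j\<in>UNIV. slot (\<gamma> t) j \<gamma>' $ x $ y) *\<^sub>C (unit_op x y :: ('n \<Rightarrow> 'd) op))) (at t within S)"
    by (intro has_vector_derivative_sum bounded_linear.has_vector_derivative[OF bl] p)
  moreover have "(\<Sum>x\<in>UNIV. \<Sum>y\<in>UNIV. (\<Prod>k\<in>UNIV. \<gamma> s $ x k $ y k) *\<^sub>C unit_op x y) = (tensor_power (\<gamma> s) :: ('n \<Rightarrow> 'd) op)" for s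
    by (subst (2) op_expand) (simp add: tensor_power_def)
  moreover have "(\<Sum>x\<in>UNIV. \<Sum>y\<in>UNIV. (\<Sum>j\<in>UNIV. slot (\<gamma> t) j \<gamma>' $ x $ y) *\<^sub>C (unit_op x y :: ('n \<Rightarrow> 'd) op))
      = (\<Sum>j\<in>UNIV. slot (\<gamma> t) j \<gamma>')"
    by (subst (2) op_expand) simp
  ultimately show ?thesis by simp
qed

text \<open>The tensor power of a Hartree solution follows an N-body Lindblad equation with the same
  jump operators as \<Gamma>, so the two generators differ in the Hamiltonian only. The parameter h
  stands for the one-body Hamiltonian including the mean field.\<close>

lemma slot_gen:
  "(\<Sum>j\<in>UNIV. slot \<gamma> j ((- \<i>) *\<^sub>C comm h \<gamma> + dissipator L \<gamma>))
    = gen (\<Sum>j\<in>UNIV. one_body j h) UNIV (\<lambda>j. one_body j L) (tensor_power \<gamma> :: ('n::finite \<Rightarrow> 'd::finite) op)"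
proof -
  have l: "slot \<gamma> j (A ** \<gamma>) = one_body j A ** tensor_power \<gamma>" for A and j :: 'n
    using slot_mult[of \<gamma> j A "mat 1"] by (simp add: one_body_one)
  have r: "slot \<gamma> j (\<gamma> ** A) = tensor_power \<gamma> ** one_body j A" for A and j :: 'n
    using slot_mult[of \<gamma> j "mat 1" A] by (simp add: one_body_one)
  have "slot \<gamma> j ((- \<i>) *\<^sub>C comm h \<gamma> + dissipator L \<gamma>)
      = (- \<i>) *\<^sub>C comm (one_body j h) (tensor_power \<gamma>) + dissipator (one_body j L) (tensor_power \<gamma>)" for j :: 'n
    using l[of j "adj L ** L"] r[of j "adj L ** L"]
    by (simp add: comm_def dissipator_def slot_linear l r slot_mult adj_one_body one_body_mult matrix_mul_assoc)
      (simp add: one_body_mult flip: matrix_mul_assoc)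
  then show ?thesis
    by (simp add: gen_def sum.distrib comm_def matrix_sum_left matrix_sum_right sum_subtractf op_linear flip: cscale_sum)
qed

lemma sum_offdiag:
  fixes f :: "'n::{finite,linorder} \<Rightarrow> 'n \<Rightarrow> 'b::comm_monoid_add"
  shows "(\<Sum>(i, j)\<in>{(i, j). i \<noteq> j}. f i j) = (\<Sum>(i, j)\<in>{(i, j). i < j}. f i j + f j i)"
proof -
  have "{(i, j). i \<noteq> (j :: 'n)} = {(i, j). i < j} \<union> {(i, j). j < i}"
    by auto
  then have "(\<Sum>(i, j)\<in>{(i, j). i \<noteq> j}. f i j) = (\<Sum>(i, j)\<in>{(i, j). i < j}. f i j) + (\<Sum>(i, j)\<in>{(i, j). j < i}. f i j)"
    by (simp only:) (rule sum.union_disjoint, auto)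
  also have "(\<Sum>(i, j)\<in>{(i, j). j < i}. f i j) = (\<Sum>(i, j)\<in>{(i, j). i < j}. f j i)"
    by (rule sum.reindex_bij_witness[where i = prod.swap and j = prod.swap]) auto
  finally show ?thesis
    by (simp add: sum.distrib case_prod_unfold)
qed

lemma comm_linear:
  "comm (A + B) C = comm A C + comm B C" "comm (A - B) C = comm A C - comm B C"
  "comm (r *\<^sub>R A) C = r *\<^sub>R comm A (C :: 'a::finite op)"
  "comm (\<Sum>i\<in>I. F i) C = (\<Sum>i\<in>I. comm (F i) C)" "comm C (\<Sum>i\<in>I. F i) = (\<Sum>i\<in>I. comm C (F i))"
  by (simp_all add: comm_def op_linear matrix_sum_left matrix_sum_right sum_subtractf algebra_simps)

text \<open>The terms in h cancel. A pair operator commutes with all logarithms except those at i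
  and j, and by the swap symmetry these two give both orderings of the pair. The mean-field term of
  particle i is repeated for its N - 1 partners, which the prefactor compensates.\<close>

lemma comm_hamiltonian_mean_field:
  fixes W :: "('d::finite \<times> 'd) op" and h V l :: "'d op"
  assumes W: "swap_op ** W ** swap_op = W" and N: "CARD('n::{finite,linorder}) \<ge> 2"
  defines "K \<equiv> hamiltonian h W - (\<Sum>j\<in>UNIV. one_body j (h + V)) :: ('n \<Rightarrow> 'd) op"
  shows "comm K (\<Sum>j\<in>UNIV. one_body j l) = (1 / (real CARD('n) - 1)) *\<^sub>R
    (\<Sum>(i, j)\<in>{(i, j). i \<noteq> j}. two_body i j (comm (W - V \<otimes>\<^sub>2 mat 1) (l \<otimes>\<^sub>2 mat 1)))"
proof -
  let ?c = "1 / (real CARD('n) - 1)"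
  let ?l = "\<Sum>k\<in>UNIV. one_body k l :: ('n \<Rightarrow> 'd) op"
  have V: "comm (one_body j V) ?l = comm (one_body j V) (one_body j l)" for j :: 'n
  proof -
    have "comm (one_body j V) ?l = (\<Sum>k\<in>UNIV. if k = j then comm (one_body j V) (one_body j l) else 0)"
      unfolding comm_linear by (intro sum.cong refl) (auto simp: comm_def one_body_commute)
    then show ?thesis by simp
  qed
  have W2: "comm (two_body i j W) ?l = comm (two_body i j W) (one_body i l) + comm (two_body j i W) (one_body j l)"
    if "i < j" for i j :: 'n
  proof -
    have "comm (two_body i j W) ?l = (\<Sum>k\<in>UNIV. (if k = i then comm (two_body i j W) (one_body i l) else 0)
        + (if k = j then comm (two_body i j W) (one_body j l) else 0))"
      unfolding comm_linear using that
      by (intro sum.cong refl) (auto simp: comm_def two_body_one_body_commute)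
    then show ?thesis by (simp add: sum.distrib two_body_swap[OF W, of i j])
  qed
  have pairs: "(\<Sum>(i, j)\<in>{(i, j). i \<noteq> j}. F i) = (real CARD('n) - 1) *\<^sub>R (\<Sum>i\<in>UNIV. F i)" for F :: "'n \<Rightarrow> ('n \<Rightarrow> 'd) op"
  proof -
    have "{(i, j). i \<noteq> (j :: 'n)} = Sigma UNIV (\<lambda>i. UNIV - {i})" by auto
    then have "(\<Sum>(i, j)\<in>{(i, j). i \<noteq> j}. F i) = (\<Sum>i\<in>UNIV. \<Sum>j\<in>UNIV - {i}. F i)"
      by (simp add: sum.Sigma del: sum_constant)
    moreover have "(\<Sum>j\<in>UNIV - {i}. F i) = (real CARD('n) - 1) *\<^sub>R F i" for i
      using N by (simp add: sum_constant_scaleR card_Diff_singleton of_nat_diff del: sum_constant)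
    ultimately show ?thesis
      by (simp add: scaleR_sum_right del: sum_constant)
  qed
  have "comm K ?l = ?c *\<^sub>R (\<Sum>(i, j)\<in>{(i, j). i < j}. comm (two_body i j W) ?l) - (\<Sum>j\<in>UNIV. comm (one_body j V) ?l)"
    unfolding K_def hamiltonian_def one_body_add sum.distrib comm_linear(1-4) case_prod_unfold
    by simp
  also have "(\<Sum>(i, j)\<in>{(i, j). i < j}. comm (two_body i j W) ?l)
      = (\<Sum>(i, j)\<in>{(i, j). i \<noteq> j}. comm (two_body i j W) (one_body i l))"
    unfolding sum_offdiag using W2 by (intro sum.cong) auto
  also have "(\<Sum>j\<in>UNIV. comm (one_body j V) ?l)
      = ?c *\<^sub>R (\<Sum>(i, j)\<in>{(i, j). i \<noteq> j}. comm (one_body i V) (one_body i l))"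
    unfolding V pairs using N by simp
  also have "?c *\<^sub>R (\<Sum>(i, j)\<in>{(i, j). i \<noteq> j}. comm (two_body i j W) (one_body i l))
      - ?c *\<^sub>R (\<Sum>(i, j)\<in>{(i, j). i \<noteq> j}. comm (one_body i V) (one_body i l))
      = ?c *\<^sub>R (\<Sum>(i, j)\<in>{(i, j). i \<noteq> j}. two_body i j (comm (W - V \<otimes>\<^sub>2 mat 1) (l \<otimes>\<^sub>2 mat 1)))"
    unfolding scaleR_diff_right[symmetric] sum_subtractf[symmetric]
    by (intro arg_cong[where f = "\<lambda>z. ?c *\<^sub>R z"] sum.cong)
      (auto simp: two_body_comm two_body_diff two_body_left comm_linear)
  finally show ?thesis .
qed

section \<open>The exponential moment estimate\<close>

lemma commute_mult:
  fixes A B C :: "'a::finite op"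
  assumes "A ** B = B ** A" "C ** B = B ** C"
  shows "(A ** C) ** B = B ** (A ** C)"
proof -
  have "(A ** C) ** B = A ** (C ** B)"
    by (simp only: matrix_mul_assoc)
  also have "\<dots> = (A ** B) ** C"
    by (simp only: assms matrix_mul_assoc)
  finally show ?thesis
    by (simp only: assms matrix_mul_assoc)
qed

lemma one_body_zero: "one_body a 0 = 0"
  by (simp add: vec_eq_iff one_body_nth)

text \<open>If M commutes with everything acting on factor a, then tracing M against an operator on
  that factor is a tracial functional, hence a multiple of the trace: zero on off-diagonal units and
  constant on diagonal ones.\<close>

lemma trace_commutant:
  assumes M: "\<And>B. M ** one_body a B = one_body a B ** M"
  shows "trace (M ** one_body a (unit_op p q)) = (if p = q then trace (M ** one_body a (unit_op r r)) else 0)"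
proof -
  have cyc: "trace (M ** one_body a (A ** B)) = trace (M ** one_body a (B ** A))" for A B
  proof -
    have "trace (M ** one_body a A ** one_body a B) = trace (one_body a B ** (M ** one_body a A))"
      by (rule trace_mul_sym)
    also have "one_body a B ** (M ** one_body a A) = M ** (one_body a B ** one_body a A)"
      by (simp only: matrix_mul_assoc M[symmetric])
    finally show ?thesis
      by (simp add: one_body_mult flip: matrix_mul_assoc)
  qed
  show ?thesis
  proof (cases "p = q")
    case True
    then show ?thesis
      using cyc[of "unit_op p r" "unit_op r p"] by (simp add: unit_op_mult)
  next
    case False
    show ?thesis
      using cyc[of "unit_op p p" "unit_op p q"] False by (simp add: unit_op_mult one_body_zero matrix_zero_right trace_def)
  qed
qed

lemma sum_UNIV_prod: "(\<Sum>P\<in>UNIV. f P) = (\<Sum>a\<in>UNIV. \<Sum>b\<in>UNIV. f (a :: 'a::finite, b :: 'b::finite))"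
  by (simp add: sum.cartesian_product)

text \<open>After expansion in matrix units, factor i contributes only its trace by
  \<open>trace_commutant\<close>; what is left is the partial trace of Z over that factor.\<close>

lemma trace_two_body_eq_0:
  fixes Z :: "('d::finite \<times> 'd) op"
  assumes ij: "i \<noteq> j" and M: "\<And>B. M ** one_body i B = one_body i B ** M"
    and Z: "\<And>b d. (\<Sum>a\<in>UNIV. Z $ (a, b) $ (a, d)) = 0"
  shows "trace (M ** two_body i j Z) = 0"
proof -
  \<comment> \<open>The index \<open>undefined\<close> is an arbitrary choice: all diagonal units in
    factor i give the same value.\<close>
  define k where "k = (\<lambda>b d. trace (one_body j (unit_op b d) ** M ** one_body i (unit_op undefined undefined)))"
  have e: "trace (M ** (one_body i (unit_op a c) ** one_body j (unit_op b d))) = (if a = c then k b d else 0)" for a b c d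
  proof -
    have "trace (M ** one_body i (unit_op a c) ** one_body j (unit_op b d))
        = trace (one_body j (unit_op b d) ** (M ** one_body i (unit_op a c)))"
      by (rule trace_mul_sym)
    moreover have "(one_body j (unit_op b d) ** M) ** one_body i B = one_body i B ** (one_body j (unit_op b d) ** M)" for B
      by (intro commute_mult M one_body_commute) (use ij in simp)
    ultimately show ?thesis
      unfolding k_def using trace_commutant[of "one_body j (unit_op b d) ** M" i a c undefined]
      by (simp add: matrix_mul_assoc)
  qed
  have "trace (M ** two_body i j Z) = (\<Sum>a\<in>UNIV. \<Sum>b\<in>UNIV. \<Sum>c\<in>UNIV. \<Sum>d\<in>UNIV. Z $ (a, b) $ (c, d) * (if a = c then k b d else 0))"
    unfolding two_body_expand[OF ij] by (simp add: matrix_sum_right trace_sum cscale_right trace_cscale e sum_UNIV_prod)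
  also have "\<dots> = (\<Sum>a\<in>UNIV. \<Sum>b\<in>UNIV. \<Sum>d\<in>UNIV. k b d * Z $ (a, b) $ (a, d))"
  proof (rule sum.cong[OF refl], rule sum.cong[OF refl])
    fix a b
    have "(\<Sum>c\<in>UNIV. \<Sum>d\<in>UNIV. Z $ (a, b) $ (c, d) * (if a = c then k b d else 0))
        = (\<Sum>c\<in>UNIV. if c = a then (\<Sum>d\<in>UNIV. k b d * Z $ (a, b) $ (a, d)) else 0)"
      by (intro sum.cong refl) (auto simp: mult.commute)
    then show "(\<Sum>c\<in>UNIV. \<Sum>d\<in>UNIV. Z $ (a, b) $ (c, d) * (if a = c then k b d else 0))
        = (\<Sum>d\<in>UNIV. k b d * Z $ (a, b) $ (a, d))"
      by simp
  qed
  also have "\<dots> = (\<Sum>b\<in>UNIV. \<Sum>d\<in>UNIV. k b d * (\<Sum>a\<in>UNIV. Z $ (a, b) $ (a, d)))"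
    unfolding sum_distrib_left by (rule trans[OF sum.swap]) (rule sum.cong[OF refl], rule sum.swap)
  finally show ?thesis by (simp add: Z)
qed

lemma trace_two_body_eq_0':
  fixes Z :: "('d::finite \<times> 'd) op"
  assumes ij: "i \<noteq> j" and M: "\<And>B. M ** one_body j B = one_body j B ** M"
    and Z: "\<And>b d. (\<Sum>a\<in>UNIV. Z $ (b, a) $ (d, a)) = 0"
  shows "trace (M ** two_body i j Z) = 0"
proof -
  define Z' where "Z' = (\<chi> p q. Z $ prod.swap p $ prod.swap q)"
  have "two_body i j Z = two_body j i Z'"
    by (simp add: vec_eq_iff two_body_nth Z'_def insert_commute)
  then show ?thesis
    using trace_two_body_eq_0[of j i M Z'] ij M Z by (simp add: Z'_def)
qed

section \<open>Words of pair operators and their expectations\<close>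

primrec word_op :: "('d::finite \<times> 'd) op \<Rightarrow> ('n \<times> 'n) list \<Rightarrow> ('n::finite \<Rightarrow> 'd) op"
  where
    "word_op R [] = mat 1"
  | "word_op R (p # w) = two_body (fst p) (snd p) R ** word_op R w"

lemma word_op_append: "word_op R (u @ v) = word_op R u ** word_op R v"
  by (induction u) (auto simp: matrix_mul_assoc)

text \<open>Flattening a word is injective by \<open>inj_letters\<close>, so counting words of
  length n becomes counting lists of 2 n labels.\<close>

definition letters :: "('n \<times> 'n) list \<Rightarrow> 'n list"
  where "letters w = concat (map (\<lambda>p. [fst p, snd p]) w)"

lemma letters_simps [simp]: "letters [] = []" "letters (p # w) = fst p # snd p # letters w"
  "letters (u @ v) = letters u @ letters v"
  by (simp_all add: letters_def)

lemma length_letters: "length (letters w) = 2 * length w"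
  by (induction w) auto

lemma inj_letters: "letters u = letters v \<Longrightarrow> u = v"
proof (induction u arbitrary: v)
  case Nil
  then show ?case by (cases v) auto
next
  case (Cons p u)
  then show ?case by (cases v) (auto simp: prod_eq_iff)
qed

definition off_diagonal :: "('n \<times> 'n) set"
  where "off_diagonal = {(i, j). i \<noteq> j}"

lemma word_op_commute:
  assumes "set w \<subseteq> off_diagonal" "a \<notin> set (letters w)"
  shows "word_op R w ** one_body a B = one_body a B ** word_op R w"
  using assms
proof (induction w)
  case (Cons p w)
  then have "two_body (fst p) (snd p) R ** one_body a B = one_body a B ** two_body (fst p) (snd p) R"
    by (intro two_body_one_body_commute) (auto simp: off_diagonal_def)
  moreover have "word_op R w ** one_body a B = one_body a B ** word_op R w"
    using Cons by auto
  ultimately show ?case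
    by (simp only: word_op.simps commute_mult)
qed simp

text \<open>The label a touches a single pair operator. All other factors of the word, and \<gamma>
  in the other slots, commute with operators on factor a. By cyclicity the \<gamma> of slot a is
  brought next to that pair operator, and the partial trace over slot a vanishes by R1 or R2,
  according to the position of a in the pair.\<close>

lemma trace_word_eq_0:
  fixes R :: "('d::finite \<times> 'd) op" and \<gamma> :: "'d op"
  assumes w: "set w \<subseteq> off_diagonal" and a: "count_list (letters w) a = 1"
    and R1: "\<And>b d. (\<Sum>a\<in>UNIV. ((\<gamma> \<otimes>\<^sub>2 mat 1) ** R) $ (a, b) $ (a, d)) = 0"
    and R2: "\<And>b d. (\<Sum>a\<in>UNIV. ((mat 1 \<otimes>\<^sub>2 \<gamma>) ** R) $ (b, a) $ (d, a)) = 0"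
  shows "trace (tensor_power \<gamma> ** word_op R w :: ('n::finite \<Rightarrow> 'd) op) = 0"
proof -
  have "\<exists>u i j v. w = u @ (i, j) # v \<and> (a = i \<or> a = j) \<and> i \<noteq> j \<and> a \<notin> set (letters u) \<and> a \<notin> set (letters v)"
    using w a
  proof (induction w)
    case (Cons p w)
    show ?case
    proof (cases "a = fst p \<or> a = snd p")
      case True
      then have "a \<notin> set (letters w)" "fst p \<noteq> snd p"
        using Cons.prems by (auto simp: count_list_0_iff off_diagonal_def split: if_splits)
      then show ?thesis
        using True by (intro exI[of _ "[]"] exI[of _ "fst p"] exI[of _ "snd p"] exI[of _ w]) auto
    next
      case False
      then have "count_list (letters w) a = 1" "set w \<subseteq> off_diagonal"
        using Cons.prems by auto
      then obtain u i j v where "w = u @ (i, j) # v \<and> (a = i \<or> a = j) \<and> i \<noteq> j \<and> a \<notin> set (letters u) \<and> a \<notin> set (letters v)"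
        using Cons.IH by blast
      then show ?thesis
        using False by (intro exI[of _ "p # u"] exI[of _ i] exI[of _ j] exI[of _ v]) auto
    qed
  qed simp
  then obtain u i j v where ws: "w = u @ (i, j) # v" and ai: "a = i \<or> a = j" and ij: "i \<noteq> j"
    and uv: "a \<notin> set (letters u)" "a \<notin> set (letters v)"
    by blast
  let ?O = "\<lambda>B. one_body a B :: ('n \<Rightarrow> 'd) op"
  define \<rho>' where "\<rho>' = (prod_op (\<lambda>k. if k = a then mat 1 else \<gamma>) :: ('n \<Rightarrow> 'd) op)"
  have \<rho>: "tensor_power \<gamma> = \<rho>' ** ?O \<gamma>"
    by (auto simp: \<rho>'_def one_body_eq tensor_power_eq prod_op_mult intro!: arg_cong[where f = prod_op])
  have c1: "\<rho>' ** ?O B = ?O B ** \<rho>'" for B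
    by (auto simp: \<rho>'_def one_body_eq prod_op_mult intro!: arg_cong[where f = prod_op])
  have cu: "word_op R u ** ?O B = ?O B ** word_op R u" and cv: "word_op R v ** ?O B = ?O B ** word_op R v" for B
    using w uv by (auto simp: ws intro!: word_op_commute)
  \<comment> \<open>Everything except the pair operator and the \<gamma> of slot a, in the order
    produced by cyclicity.\<close>
  define M where "M = word_op R v ** \<rho>' ** word_op R u"
  have M: "M ** ?O B = ?O B ** M" for B
    unfolding M_def by (intro commute_mult c1 cu cv)
  have "trace (tensor_power \<gamma> ** word_op R w) = trace ((\<rho>' ** ?O \<gamma> ** word_op R u ** two_body i j R) ** word_op R v)"
    by (simp add: ws word_op_append \<rho> matrix_mul_assoc)
  also have "\<dots> = trace (word_op R v ** (\<rho>' ** ?O \<gamma> ** word_op R u ** two_body i j R))"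
    by (rule trace_mul_sym)
  also have "word_op R v ** (\<rho>' ** ?O \<gamma> ** word_op R u ** two_body i j R)
      = word_op R v ** \<rho>' ** (?O \<gamma> ** word_op R u) ** two_body i j R"
    by (simp only: matrix_mul_assoc)
  also have "\<dots> = M ** (?O \<gamma> ** two_body i j R)"
    unfolding cu[symmetric] M_def by (simp only: matrix_mul_assoc)
  also have "trace \<dots> = 0"
    using ai
  proof
    assume a: "a = i"
    have "?O \<gamma> ** two_body i j R = two_body i j ((\<gamma> \<otimes>\<^sub>2 mat 1) ** R)"
      unfolding a two_body_mult[OF ij, symmetric] two_body_left[OF ij] ..
    then show ?thesis
      using trace_two_body_eq_0[OF ij, of M "(\<gamma> \<otimes>\<^sub>2 mat 1) ** R"] M R1 a by simp
  next
    assume a: "a = j"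
    have "?O \<gamma> ** two_body i j R = two_body i j ((mat 1 \<otimes>\<^sub>2 \<gamma>) ** R)"
      unfolding a two_body_mult[OF ij, symmetric] two_body_right[OF ij] ..
    then show ?thesis
      using trace_two_body_eq_0'[OF ij, of M "(mat 1 \<otimes>\<^sub>2 \<gamma>) ** R"] M R2 a by simp
  qed
  finally show ?thesis .
qed

section \<open>Powers of the pair sum, and bounds on words\<close>

definition op_power :: "'a::finite op \<Rightarrow> nat \<Rightarrow> 'a op"
  where "op_power A n = (((**) A) ^^ n) (mat 1)"

lemma op_power_simps [simp]: "op_power A 0 = mat 1" "op_power A (Suc n) = A ** op_power A n"
  by (simp_all add: op_power_def)

lemma op_power_spec: "unitary Q \<Longrightarrow> op_power (spec Q a) n = spec Q (\<lambda>k. a k ^ n)"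
  by (induction n) (auto simp: spec_mult spec_one)

lemma op_power_scaleR: "op_power (c *\<^sub>R A) n = c ^ n *\<^sub>R op_power A n"
  by (induction n) (auto simp: op_linear)

lemma op_power_words:
  "op_power (\<Sum>p\<in>S. two_body (fst p) (snd p) R) n = (\<Sum>w | set w \<subseteq> S \<and> length w = n. word_op R w)"
proof (induction n)
  case 0
  have "{w. set w \<subseteq> S \<and> length w = 0} = {[]}" by auto
  then show ?case by simp
next
  case (Suc n)
  have "{w. set w \<subseteq> S \<and> length w = Suc n} = (\<lambda>(p, w). p # w) ` (S \<times> {w. set w \<subseteq> S \<and> length w = n})"
    by (auto simp: length_Suc_conv image_iff)
  moreover have "inj_on (\<lambda>(p, w). p # w) (S \<times> {w. set w \<subseteq> S \<and> length w = n})"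
    by (auto simp: inj_on_def)
  ultimately have "(\<Sum>w | set w \<subseteq> S \<and> length w = Suc n. word_op R w)
      = (\<Sum>(p, w)\<in>S \<times> {w. set w \<subseteq> S \<and> length w = n}. word_op R (p # w))"
    by (simp add: sum.reindex case_prod_unfold)
  also have "\<dots> = (\<Sum>p\<in>S. \<Sum>w | set w \<subseteq> S \<and> length w = n. two_body (fst p) (snd p) R ** word_op R w)"
    by (simp add: sum.cartesian_product)
  also have "\<dots> = op_power (\<Sum>p\<in>S. two_body (fst p) (snd p) R) (Suc n)"
    by (simp add: Suc matrix_sum_left matrix_sum_right) (rule sum.swap)
  finally show ?case ..
qed

text \<open>Placing an operator on the pair (i, j) respects products, adjoints and the identity, so
  it carries a spectral decomposition to one with the same eigenvalues and does not increase the
  operator norm.\<close>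

lemma two_body_spec:
  assumes ij: "i \<noteq> j" and Q: "unitary Q"
  shows "two_body i j (spec Q d) = spec (two_body i j Q) (\<lambda>x. d (x i, x j))" and "unitary (two_body i j Q)"
proof -
  have "diag (\<lambda>x. complex_of_real (d (x i, x j))) = two_body i j (diag (\<lambda>p. complex_of_real (d p)))"
    by (auto simp: vec_eq_iff two_body_nth agree_off_def)
  then show "two_body i j (spec Q d) = spec (two_body i j Q) (\<lambda>x. d (x i, x j))"
    by (simp add: spec_def two_body_mult[OF ij, symmetric] adj_two_body)
  show "unitary (two_body i j Q)"
    using Q by (simp add: unitary_def two_body_mult[OF ij] adj_two_body two_body_one)
qed

lemma norm_word_op_vec_le:
  fixes R :: "('d::finite \<times> 'd) op"
  assumes R: "self_adjoint R" and C: "op_norm R \<le> C" and w: "set w \<subseteq> off_diagonal"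
  shows "norm (word_op R w *v x) \<le> C ^ length w * norm x"
  using w
proof (induction w)
  case (Cons p w)
  obtain Q d where Q: "unitary Q" and Rs: "R = spec Q d"
    using spectral[OF R] by blast
  have ij: "fst p \<noteq> snd p"
    using Cons.prems by (auto simp: off_diagonal_def)
  have "\<bar>d q\<bar> \<le> C" for q
    using spec_bound_op_norm[OF Q, of d q] C Rs by simp
  then have n: "op_norm (two_body (fst p) (snd p) R) \<le> C"
    unfolding Rs two_body_spec(1)[OF ij Q] by (intro op_norm_spec_le two_body_spec(2)[OF ij Q])
  have "norm (two_body (fst p) (snd p) R *v (word_op R w *v x)) \<le> op_norm (two_body (fst p) (snd p) R) * norm (word_op R w *v x)"
    by (rule norm_op_vec_le)
  also have "\<dots> \<le> C * (C ^ length w * norm x)"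
    using n Cons \<open>\<bar>d undefined\<bar> \<le> C\<close> by (intro mult_mono) auto
  finally show ?case
    by (simp add: matrix_vector_mul_assoc mult.assoc)
qed simp

text \<open>An expectation is a convex combination of quadratic forms at unit vectors. It is applied
  to words, which in general are not self-adjoint.\<close>

lemma inner_density_le:
  fixes \<rho> M :: "'a::finite op"
  assumes r: "0 *\<^sub>R mat 1 \<preceq> \<rho>" and tr: "trace \<rho> = 1" and M: "\<And>x. norm (M *v x) \<le> C * norm x"
  shows "\<rho> \<bullet> M \<le> C"
proof -
  obtain Q p where Q: "unitary Q" and rs: "\<rho> = spec Q p"
    using r spectral[of \<rho>] unfolding op_le_scaleR_iff by blast
  have p: "0 \<le> p i" for i
    using r unfolding rs op_le_spec_iff[OF Q] by blast
  have s: "sum p UNIV = 1"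
    using tr by (simp add: rs trace_spec[OF Q] flip: of_real_sum)
  have "\<rho> \<bullet> M \<le> (\<Sum>k\<in>UNIV. p k * C)"
    unfolding rs inner_spec_op
  proof (intro sum_mono mult_left_mono p)
    fix k
    have n: "norm (Q *v axis k 1) = 1"
      using norm_unitary_vec[OF Q] by simp
    show "(Q *v axis k 1) \<bullet> (M *v (Q *v axis k 1)) \<le> C"
      using norm_cauchy_schwarz[of "Q *v axis k 1" "M *v (Q *v axis k 1)"] M[of "Q *v axis k 1"] n by simp
  qed
  also have "\<dots> = C"
    using s by (simp flip: sum_distrib_right)
  finally show ?thesis .
qed

text \<open>A list of 2 n entries in which every occurring label occurs at least twice has at most n
  labels. If n is at most N, these lie in some set of exactly n labels, and the list is one of the
  free fillings from that set; otherwise all lists are counted.\<close>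

lemma card_lists_no_singleton:
  "card {l :: 'n::finite list. length l = 2 * n \<and> (\<forall>a. count_list l a \<noteq> 1)}
    \<le> (if n \<le> CARD('n) then (CARD('n) choose n) * n ^ (2 * n) else CARD('n) ^ (2 * n))"
proof (cases "n \<le> CARD('n)")
  case True
  have fin: "finite {l :: 'n list. set l \<subseteq> S \<and> length l = 2 * n}" for S
    by (rule finite_lists_length_eq) simp
  have "{l :: 'n list. length l = 2 * n \<and> (\<forall>a. count_list l a \<noteq> 1)}
      \<subseteq> (\<Union>S\<in>{S. card S = n}. {l. set l \<subseteq> S \<and> length l = 2 * n})"
  proof
    fix l :: "'n list" assume "l \<in> {l. length l = 2 * n \<and> (\<forall>a. count_list l a \<noteq> 1)}"
    then have l: "length l = 2 * n" and c: "\<And>a. count_list l a \<noteq> 1" by auto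
    have "(\<Sum>a\<in>set l. 2) \<le> (\<Sum>a\<in>set l. count_list l a)"
    proof (rule sum_mono)
      fix a assume "a \<in> set l"
      then have "count_list l a \<noteq> 0" by (simp add: count_list_0_iff)
      then show "2 \<le> count_list l a" using c[of a] by linarith
    qed
    also have "\<dots> = 2 * n"
      using sum_count_set[of l "set l"] l by simp
    finally have "card (set l) \<le> n" by simp
    then obtain S where "set l \<subseteq> S" "card S = n"
      using True exists_subset_between[of "set l" n UNIV] by auto
    then show "l \<in> (\<Union>S\<in>{S. card S = n}. {l. set l \<subseteq> S \<and> length l = 2 * n})"
      using l by auto
  qed
  then have "card {l :: 'n list. length l = 2 * n \<and> (\<forall>a. count_list l a \<noteq> 1)}
      \<le> card (\<Union>S\<in>{S :: 'n set. card S = n}. {l. set l \<subseteq> S \<and> length l = 2 * n})"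
    by (rule card_mono[rotated]) (use fin in auto)
  also have "\<dots> \<le> (\<Sum>S\<in>{S :: 'n set. card S = n}. card {l. set l \<subseteq> S \<and> length l = 2 * n})"
    by (rule card_UN_le) simp
  also have "\<dots> = (\<Sum>S\<in>{S :: 'n set. card S = n}. n ^ (2 * n))"
    by (intro sum.cong refl) (simp add: card_lists_length_eq)
  also have "\<dots> = (CARD('n) choose n) * n ^ (2 * n)"
    using n_subsets[of "UNIV :: 'n set" n] by simp
  finally show ?thesis using True by simp
next
  case False
  have "card {l :: 'n list. length l = 2 * n \<and> (\<forall>a. count_list l a \<noteq> 1)} \<le> card {l :: 'n list. set l \<subseteq> UNIV \<and> length l = 2 * n}"
    by (intro card_mono finite_lists_length_eq) auto
  then show ?thesis using False by (simp only: card_lists_length_eq[OF finite_class.finite_UNIV]) simp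
qed

text \<open>The left side is a single term of the exponential series of n.\<close>

lemma power_div_fact_le: "real n ^ n / fact n \<le> exp 1 ^ n"
proof -
  have "real n ^ n /\<^sub>R fact n \<le> exp (real n)"
    using sum_le_suminf[OF summable_exp_generic[of "real n"], of "{n}"] by (simp add: exp_def)
  then show ?thesis
    by (simp add: exp_of_nat_mult[symmetric] divide_inverse mult.commute)
qed

text \<open>The binomial coefficient is at most N^n / n!, which leaves two factors n^n / n!, each at
  most e^n; the base 8 exceeds the square of e. For n > N, half of the factors N are replaced by n
  and one such quotient remains.\<close>

lemma card_no_singleton_div_fact_le:
  "real (card {l :: 'n::finite list. length l = 2 * n \<and> (\<forall>a. count_list l a \<noteq> 1)}) / fact n \<le> (8 * real CARD('n)) ^ n"
proof -
  let ?N = "CARD('n)" and ?c = "card {l :: 'n list. length l = 2 * n \<and> (\<forall>a. count_list l a \<noteq> 1)}"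
  have e: "exp 1 ^ n * exp 1 ^ n \<le> (8 :: real) ^ n" "exp 1 ^ n \<le> (8 :: real) ^ n"
  proof -
    have "exp 1 * exp 1 \<le> (272 / 100) * (272 / 100 :: real)"
      using e_less_272 by (intro mult_mono) auto
    then have "(exp 1 * exp 1) ^ n \<le> (8 :: real) ^ n"
      by (intro power_mono) auto
    then show "exp 1 ^ n * exp 1 ^ n \<le> (8 :: real) ^ n"
      by (simp add: power_mult_distrib)
    show "exp 1 ^ n \<le> (8 :: real) ^ n"
      using e_less_272 by (intro power_mono) auto
  qed
  show ?thesis
  proof (cases "n \<le> ?N")
    case True
    have "real ?c \<le> real ((?N choose n) * n ^ (2 * n))"
      using card_lists_no_singleton[where 'n = 'n, of n] True by (simp del: of_nat_mult of_nat_power)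
    also have "\<dots> = real (?N choose n) * (real n ^ n * real n ^ n)"
      by (simp add: mult_2 power_add)
    also have "real (?N choose n) * (real n ^ n * real n ^ n) \<le> (real ?N ^ n / fact n) * (real n ^ n * real n ^ n)"
    proof (rule mult_right_mono)
      have "real ((?N choose n) * fact n) \<le> real (?N ^ n)"
        using binomial_fact_pow[of ?N n] of_nat_le_iff by blast
      then show "real (?N choose n) \<le> real ?N ^ n / fact n"
        by (simp add: field_simps)
    qed simp
    finally have "real ?c / fact n \<le> (real ?N ^ n / fact n) * (real n ^ n * real n ^ n) / fact n"
      by (rule divide_right_mono) simp
    also have "\<dots> = real ?N ^ n * ((real n ^ n / fact n) * (real n ^ n / fact n))"
      by simp
    also have "\<dots> \<le> real ?N ^ n * (exp 1 ^ n * exp 1 ^ n)"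
      by (intro mult_left_mono mult_mono power_div_fact_le) auto
    also have "\<dots> \<le> real ?N ^ n * 8 ^ n"
      by (intro mult_left_mono e) auto
    finally show ?thesis by (simp add: power_mult_distrib mult.commute)
  next
    case False
    have "real ?c \<le> real (?N ^ (2 * n))"
      using card_lists_no_singleton[where 'n = 'n, of n] False by (simp del: of_nat_mult of_nat_power)
    also have "\<dots> = real ?N ^ n * real ?N ^ n"
      by (simp add: mult_2 power_add)
    also have "\<dots> \<le> real ?N ^ n * real n ^ n"
      using False by (intro mult_left_mono power_mono) auto
    finally have "real ?c / fact n \<le> real ?N ^ n * real n ^ n / fact n"
      by (rule divide_right_mono) simp
    also have "\<dots> = real ?N ^ n * (real n ^ n / fact n)"
      by simp
    also have "\<dots> \<le> real ?N ^ n * 8 ^ n"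
      by (intro mult_left_mono order_trans[OF power_div_fact_le e(2)]) auto
    finally show ?thesis by (simp add: power_mult_distrib mult.commute)
  qed
qed

text \<open>The exponential moment estimate of Jabin and Wang: only words in which every label occurs zero or
  at least two times contribute to the \<open>k\<close>-th moment, and there are at most \<open>k! (8 N)\<^sup>k\<close> of them.
  This is where the constant \<open>32 = 2 \<cdot> 2 \<cdot> 8\<close> comes from.\<close>

lemma exponential_moment_le_2:
  fixes R :: "('d::finite \<times> 'd) op" and \<gamma> :: "'d op" and V :: "('n::finite \<Rightarrow> 'd) op"
  assumes N: "CARD('n) \<ge> 2" and g: "0 *\<^sub>R mat 1 \<preceq> \<gamma>" and tr: "trace \<gamma> = 1"
    and R: "self_adjoint R" and C: "op_norm R \<le> C" "0 < C"
    and R1: "\<And>b d. (\<Sum>a\<in>UNIV. ((\<gamma> \<otimes>\<^sub>2 mat 1) ** R) $ (a, b) $ (a, d)) = 0"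
    and R2: "\<And>b d. (\<Sum>a\<in>UNIV. ((mat 1 \<otimes>\<^sub>2 \<gamma>) ** R) $ (b, a) $ (d, a)) = 0"
    and V: "unitary V"
    and A: "spec V a = (1 / (32 * C * (real CARD('n) - 1))) *\<^sub>R (\<Sum>p\<in>off_diagonal. two_body (fst p) (snd p) R)"
  shows "spec V (\<lambda>k. exp (a k)) \<bullet> tensor_power \<gamma> \<le> 2"
proof -
  let ?N = "real CARD('n)"
  let ?\<rho> = "tensor_power \<gamma> :: ('n \<Rightarrow> 'd) op"
  define c where "c = 1 / (32 * C * (?N - 1))"
  have N1: "?N - 1 \<ge> 1" using N by simp
  have c: "0 \<le> c" using C N1 by (simp add: c_def)
  have \<rho>0: "0 *\<^sub>R mat 1 \<preceq> ?\<rho>"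
    using op_le_tensor_power[OF _ g, where 'n = 'n] by (simp add: power_0_left)
  have \<rho>tr: "trace ?\<rho> = 1"
    by (simp add: tensor_power_eq trace_prod_op tr)
  define q where "q = (\<lambda>k. (V *v axis k 1) \<bullet> (?\<rho> *v (V *v axis k 1)))"
  have iq: "spec V x \<bullet> ?\<rho> = (\<Sum>k\<in>UNIV. x k * q k)" for x
    unfolding inner_spec_op q_def ..
  have moment: "spec V (\<lambda>k. a k ^ n) \<bullet> ?\<rho> / fact n \<le> (1 / 2) ^ n" for n
  proof -
    define G where "G = {w :: ('n \<times> 'n) list. set w \<subseteq> off_diagonal \<and> length w = n}"
    define G' where "G' = {w \<in> G. \<forall>a. count_list (letters w) a \<noteq> 1}"
    have finG: "finite G"
      unfolding G_def by (rule finite_lists_length_eq) simp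
    have \<rho>sa: "adj ?\<rho> = ?\<rho>"
      using \<rho>0 unfolding op_le_scaleR_iff self_adjoint_def by blast
    have "spec V (\<lambda>k. a k ^ n) = c ^ n *\<^sub>R (\<Sum>w\<in>G. word_op R w)"
      unfolding op_power_spec[OF V, symmetric] A G_def op_power_words[symmetric] c_def
      by (rule op_power_scaleR)
    then have "spec V (\<lambda>k. a k ^ n) \<bullet> ?\<rho> = c ^ n * (\<Sum>w\<in>G. ?\<rho> \<bullet> word_op R w)"
      by (simp add: inner_sum_right inner_commute)
    also have "(\<Sum>w\<in>G. ?\<rho> \<bullet> word_op R w) = (\<Sum>w\<in>G'. ?\<rho> \<bullet> word_op R w)"
    proof (rule sum.mono_neutral_right[OF finG])
      show "\<forall>w\<in>G - G'. ?\<rho> \<bullet> word_op R w = 0"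
      proof
        fix w assume "w \<in> G - G'"
        then obtain a where "set w \<subseteq> off_diagonal" "count_list (letters w) a = 1"
          by (auto simp: G_def G'_def)
        then have "trace (?\<rho> ** word_op R w) = 0"
          using R1 R2 by (rule trace_word_eq_0)
        then show "?\<rho> \<bullet> word_op R w = 0"
          by (simp add: inner_op_eq \<rho>sa)
      qed
    qed (auto simp: G'_def)
    also have "c ^ n * (\<Sum>w\<in>G'. ?\<rho> \<bullet> word_op R w) \<le> c ^ n * (\<Sum>w\<in>G'. C ^ n)"
    proof (intro mult_left_mono sum_mono)
      fix w assume "w \<in> G'"
      then have w: "set w \<subseteq> off_diagonal" "length w = n"
        by (auto simp: G_def G'_def)
      show "?\<rho> \<bullet> word_op R w \<le> C ^ n"
        using norm_word_op_vec_le[OF R C(1) w(1)] by (intro inner_density_le \<rho>0 \<rho>tr) (simp add: w(2))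
    qed (use c in simp)
    also have "\<dots> = (c * C) ^ n * card G'"
      by (simp add: power_mult_distrib)
    finally have m: "spec V (\<lambda>k. a k ^ n) \<bullet> ?\<rho> / fact n \<le> (c * C) ^ n * card G' / fact n"
      by (rule divide_right_mono) simp
    have "card G' = card (letters ` G')"
      by (rule card_image[symmetric]) (auto intro: inj_onI inj_letters)
    also have "\<dots> \<le> card {l :: 'n list. length l = 2 * n \<and> (\<forall>a. count_list l a \<noteq> 1)}"
    proof (rule card_mono)
      have "{l :: 'n list. length l = 2 * n \<and> (\<forall>a. count_list l a \<noteq> 1)} \<subseteq> {l. set l \<subseteq> UNIV \<and> length l = 2 * n}"
        by auto
      then show "finite {l :: 'n list. length l = 2 * n \<and> (\<forall>a. count_list l a \<noteq> 1)}"
        by (rule finite_subset) (intro finite_lists_length_eq, simp)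
    qed (auto simp: G'_def G_def length_letters)
    finally have "real (card G') / fact n \<le> (8 * ?N) ^ n"
      using card_no_singleton_div_fact_le[where 'n = 'n, of n]
      by (meson divide_right_mono fact_ge_zero of_nat_le_iff order_trans)
    then have "(c * C) ^ n * (card G' / fact n) \<le> (c * C) ^ n * (8 * ?N) ^ n"
      using c C by (intro mult_left_mono) auto
    also have "\<dots> = (?N / (4 * (?N - 1))) ^ n"
    proof -
      have "c * C * (8 * ?N) = ?N / (4 * (?N - 1))"
      proof -
        have "1 / (32 * C * x) * C * (8 * ?N) = ?N / (4 * x)" if "0 < x" for x
          using that C by (simp add: field_simps)
        then show ?thesis
          unfolding c_def using N1 by simp
      qed
      then show ?thesis
        by (simp only: power_mult_distrib[symmetric])
    qed
    \<comment> \<open>N / (N - 1) is at most 2 because N is at least 2. The ratio 1/2 then makes the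
      geometric series sum to 2.\<close>
    also have "\<dots> \<le> (1 / 2) ^ n"
      using N1 by (intro power_mono) (auto simp: field_simps)
    finally show ?thesis using m by simp
  qed
  \<comment> \<open>The exponential series is taken eigenvalue by eigenvalue, so no series of
    operators has to converge.\<close>
  have "(\<lambda>n. \<Sum>k\<in>UNIV. (a k ^ n /\<^sub>R fact n) * q k) sums (\<Sum>k\<in>UNIV. exp (a k) * q k)"
    by (intro sums_sum sums_mult2 exp_converges)
  moreover have "(\<Sum>k\<in>UNIV. (a k ^ n /\<^sub>R fact n) * q k) = spec V (\<lambda>k. a k ^ n) \<bullet> ?\<rho> / fact n" for n
    unfolding iq sum_divide_distrib by (intro sum.cong refl) (simp add: divide_inverse mult_ac)
  ultimately have s: "(\<lambda>n. spec V (\<lambda>k. a k ^ n) \<bullet> ?\<rho> / fact n) sums (spec V (\<lambda>k. exp (a k)) \<bullet> ?\<rho>)"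
    by (simp add: iq)
  have "(\<lambda>n. (1 / 2) ^ n) sums (1 / (1 - 1 / 2 :: real))"
    by (rule geometric_sums) simp
  from sums_le[OF moment s this] show ?thesis by simp
qed

section \<open>The mean-field correlation operator\<close>

lemma tensor2_mult: "(A \<otimes>\<^sub>2 B) ** (C \<otimes>\<^sub>2 D) = (A ** C) \<otimes>\<^sub>2 (B ** D)"
  by (simp add: vec_eq_iff tensor2_def matrix_matrix_mult_def sum_UNIV_prod sum_product mult_ac)

lemma adj_tensor2: "adj (A \<otimes>\<^sub>2 B) = adj A \<otimes>\<^sub>2 adj B"
  by (simp add: vec_eq_iff tensor2_def)

lemma tensor2_one: "mat 1 \<otimes>\<^sub>2 mat 1 = mat 1"
  by (auto simp: vec_eq_iff tensor2_def mat_def prod_eq_iff)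

lemma tensor2_diag: "diag d \<otimes>\<^sub>2 diag e = diag (\<lambda>p. d (fst p) * e (snd p))"
  by (auto simp: vec_eq_iff tensor2_def prod_eq_iff)

lemma unitary_tensor2: "unitary P \<Longrightarrow> unitary Q \<Longrightarrow> unitary (P \<otimes>\<^sub>2 Q)"
  by (simp add: unitary_def tensor2_mult adj_tensor2 tensor2_one)

lemma tensor2_spec: "spec P d \<otimes>\<^sub>2 spec Q e = spec (P \<otimes>\<^sub>2 Q) (\<lambda>p. d (fst p) * e (snd p))"
  by (simp add: spec_def tensor2_mult[symmetric] adj_tensor2 tensor2_diag)

lemma tensor2_left_mult_nth:
  "((A \<otimes>\<^sub>2 mat 1) ** M) $ (a, b) $ Q = (\<Sum>e\<in>UNIV. A $ a $ e * M $ (e, b) $ Q)"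
  by (simp add: matrix_matrix_mult_def tensor2_def mat_def sum_UNIV_prod if_distrib if_distribR cong: if_cong)

lemma mult_tensor2_left_nth:
  "(M ** (A \<otimes>\<^sub>2 mat 1)) $ P $ (c, d) = (\<Sum>e\<in>UNIV. M $ P $ (e, d) * A $ e $ c)"
  by (simp add: matrix_matrix_mult_def tensor2_def mat_def sum_UNIV_prod if_distrib if_distribR cong: if_cong)

lemma tensor2_right_mult_nth:
  "((mat 1 \<otimes>\<^sub>2 B) ** M) $ (a, b) $ Q = (\<Sum>e\<in>UNIV. B $ b $ e * M $ (a, e) $ Q)"
proof -
  have "((mat 1 \<otimes>\<^sub>2 B) ** M) $ (a, b) $ Q = (\<Sum>c\<in>UNIV. if c = a then \<Sum>e\<in>UNIV. B $ b $ e * M $ (a, e) $ Q else 0)"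
    unfolding matrix_matrix_mult_def tensor2_def sum_UNIV_prod vec_lambda_beta
    by (intro sum.cong refl) (auto simp: mat_def)
  then show ?thesis by simp
qed

lemma mean_field_nth: "mean_field W \<gamma> $ a $ b = (\<Sum>c\<in>UNIV. \<Sum>e\<in>UNIV. \<gamma> $ c $ e * W $ (a, e) $ (b, c))"
  by (simp add: mean_field_def ptrace2_def tensor2_right_mult_nth)

lemma linear_mean_field: "linear (mean_field W)"
  by unfold_locales (simp_all add: vec_eq_iff mean_field_nth algebra_simps sum.distrib scaleR_sum_right)

lemma mean_field_diff: "mean_field W (A - B) = mean_field W A - mean_field W B"
  by (rule linear_diff[OF linear_mean_field])

lemma adj_mean_field:
  assumes "adj W = W"
  shows "adj (mean_field W \<gamma>) = mean_field W (adj \<gamma>)"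
proof -
  have "cnj (W $ P $ Q) = W $ Q $ P" for P Q
    using assms by (metis adj_nth)
  then have "adj (mean_field W \<gamma>) $ a $ b = (\<Sum>c\<in>UNIV. \<Sum>e\<in>UNIV. cnj (\<gamma> $ c $ e) * W $ (a, c) $ (b, e))" for a b
    by (simp add: mean_field_nth)
  also have "\<dots> a b = mean_field W (adj \<gamma>) $ a $ b" for a b
    by (subst sum.swap) (simp add: mean_field_nth)
  finally show ?thesis by (simp add: vec_eq_iff)
qed

text \<open>The mean field is dual to tensoring with \<gamma>: its expectations are expectations of
  W in product states.\<close>

lemma inner_mean_field:
  assumes "adj \<gamma> = \<gamma>"
  shows "A \<bullet> mean_field W \<gamma> = (A \<otimes>\<^sub>2 \<gamma>) \<bullet> W"
proof -
  have g: "cnj (\<gamma> $ e $ c) = \<gamma> $ c $ e" for c e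
    using assms by (metis adj_nth)
  have "(A \<otimes>\<^sub>2 \<gamma>) \<bullet> W = (\<Sum>a\<in>UNIV. \<Sum>e\<in>UNIV. \<Sum>b\<in>UNIV. \<Sum>c\<in>UNIV. Re (cnj (A $ a $ b) * (\<gamma> $ c $ e * W $ (a, e) $ (b, c))))"
    by (simp add: inner_op_entries sum_UNIV_prod tensor2_def g mult.assoc del: times_complex.sel)
  also have "\<dots> = (\<Sum>a\<in>UNIV. \<Sum>b\<in>UNIV. \<Sum>c\<in>UNIV. \<Sum>e\<in>UNIV. Re (cnj (A $ a $ b) * (\<gamma> $ c $ e * W $ (a, e) $ (b, c))))"
    by (rule sum.cong[OF refl], rule trans[OF sum.swap], rule sum.cong[OF refl], rule sum.swap)
  also have "\<dots> = A \<bullet> mean_field W \<gamma>"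
    by (simp add: inner_op_entries mean_field_nth sum_distrib_left del: times_complex.sel)
  finally show ?thesis ..
qed

lemma density_op_iff: "density_op \<gamma> \<longleftrightarrow> 0 *\<^sub>R mat 1 \<preceq> \<gamma> \<and> trace \<gamma> = 1"
  by (simp add: density_op_def nonneg_op_iff)

lemma density_eigenvalues:
  assumes g: "density_op (spec Q d)" and Q: "unitary (Q :: 'a::finite op)"
  shows "0 \<le> d i" "d i \<le> 1" "sum d UNIV = 1"
proof -
  have d: "0 \<le> d k" for k
    using g unfolding density_op_iff op_le_spec_iff[OF Q] by blast
  then show "0 \<le> d i" .
  show s: "sum d UNIV = 1"
    using g by (simp add: density_op_iff trace_spec[OF Q] flip: of_real_sum)
  show "d i \<le> 1"
    using member_le_sum[of i UNIV d] d s by simp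
qed

lemma op_norm_le: "(\<And>x. norm (A *v x) \<le> C * norm x) \<Longrightarrow> op_norm A \<le> C"
  unfolding op_norm_def by (rule onorm_le)

lemma norm_tensor2_vec_le:
  fixes A :: "'d::finite op"
  assumes A: "self_adjoint A" and C: "op_norm A \<le> C"
  shows "norm ((A \<otimes>\<^sub>2 mat 1 :: ('d \<times> 'd) op) *v x) \<le> C * norm x"
proof -
  obtain Q d where Q: "unitary Q" and As: "A = spec Q d"
    using spectral[OF A] by blast
  have one: "unitary (mat 1 :: 'd op)" by (simp add: unitary_def)
  have t: "A \<otimes>\<^sub>2 mat 1 = spec (Q \<otimes>\<^sub>2 mat 1) (\<lambda>p. d (fst p))"
    using tensor2_spec[of Q d "mat 1" "\<lambda>_. 1"] by (simp add: As spec_one[OF one])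
  have "op_norm (A \<otimes>\<^sub>2 mat 1 :: ('d \<times> 'd) op) \<le> C"
    unfolding t using spec_bound_op_norm[OF Q, of d] C As
    by (intro op_norm_spec_le unitary_tensor2 Q one) (auto intro: order_trans)
  then show ?thesis
    by (intro order_trans[OF norm_op_vec_le] mult_right_mono) auto
qed

text \<open>Each eigenvalue of the mean field is the expectation of W in the tensor product of an
  eigenprojection with \<gamma>, which is a density operator on the pair.\<close>

lemma op_norm_mean_field_le:
  fixes W :: "('d::finite \<times> 'd) op"
  assumes W: "adj W = W" and g: "density_op \<gamma>"
  shows "op_norm (mean_field W \<gamma>) \<le> op_norm W"
proof -
  have gs: "adj \<gamma> = \<gamma>"
    using g by (simp add: density_op_def nonneg_op_def self_adjoint_def)
  obtain Q p where Q: "unitary Q" and gq: "\<gamma> = spec Q p"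
    using spectral[of \<gamma>] gs unfolding self_adjoint_def by blast
  note p = density_eigenvalues[OF g[unfolded gq] Q]
  have "self_adjoint (mean_field W \<gamma>)"
    by (simp add: self_adjoint_def adj_mean_field[OF W] gs)
  then obtain P v where P: "unitary P" and v: "mean_field W \<gamma> = spec P v"
    using spectral by blast
  have PQ: "unitary (P \<otimes>\<^sub>2 Q)"
    by (rule unitary_tensor2[OF P Q])
  have "\<bar>v i\<bar> \<le> op_norm W" for i
  proof -
    define e where "e = (\<lambda>k. if k = i then 1 else (0 :: real))"
    define E where "E = spec P e \<otimes>\<^sub>2 \<gamma>"
    have Es: "E = spec (P \<otimes>\<^sub>2 Q) (\<lambda>q. e (fst q) * p (snd q))"
      by (simp add: E_def gq tensor2_spec)
    have "(\<Sum>q\<in>UNIV. e (fst q) * p (snd q)) = 1"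
      using p(3) by (simp add: sum_UNIV_prod e_def flip: sum_distrib_left)
    then have Etr: "trace E = 1"
      by (simp only: Es trace_spec[OF PQ] of_real_1)
    have E0: "0 *\<^sub>R mat 1 \<preceq> E"
      unfolding Es op_le_spec_iff[OF PQ] using p(1) by (simp add: e_def)
    have "v i = spec P e \<bullet> mean_field W \<gamma>"
      by (simp add: v inner_spec_same[OF P] e_def mult_delta_left)
    also have "\<dots> = E \<bullet> W"
      unfolding E_def by (rule inner_mean_field[OF gs])
    finally have vi: "v i = E \<bullet> W" .
    have "E \<bullet> W \<le> op_norm W"
      by (rule inner_density_le[OF E0 Etr norm_op_vec_le])
    moreover have "E \<bullet> (- W) \<le> op_norm W"
    proof (rule inner_density_le[OF E0 Etr])
      fix x
      have "(- W) *v x = - (W *v x)"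
        by (simp add: vec_eq_iff matrix_vector_mult_def sum_negf)
      then show "norm ((- W) *v x) \<le> op_norm W * norm x"
        using norm_op_vec_le[of W x] by simp
    qed
    ultimately show ?thesis
      by (simp add: vi abs_le_iff)
  qed
  then show ?thesis
    unfolding v by (rule op_norm_spec_le[OF P])
qed

definition correlation :: "('d \<times> 'd) op \<Rightarrow> 'd::finite op \<Rightarrow> ('d \<times> 'd) op"
  where "correlation W \<gamma> = (- \<i>) *\<^sub>C comm (W - mean_field W \<gamma> \<otimes>\<^sub>2 mat 1) (op_log \<gamma> \<otimes>\<^sub>2 mat 1)"

text \<open>The commutator gives a factor 2, and W minus its mean field has norm at most twice that
  of W. The eigenvalues of \<gamma> lie between m and 1, so their logarithms are bounded by ln (1 /
  m), hence by 1 / m.\<close>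

lemma op_norm_correlation_le:
  fixes W :: "('d::finite \<times> 'd) op"
  assumes W: "adj W = W" and g: "density_op \<gamma>" and m: "0 < m" and mg: "m *\<^sub>R mat 1 \<preceq> \<gamma>"
  shows "op_norm (correlation W \<gamma>) \<le> 4 * op_norm W / m"
proof (rule op_norm_le)
  fix x :: "complex^('d \<times> 'd)"
  let ?w = "op_norm W" and ?V = "mean_field W \<gamma> \<otimes>\<^sub>2 mat 1 :: ('d \<times> 'd) op" and ?l = "op_log \<gamma> \<otimes>\<^sub>2 mat 1 :: ('d \<times> 'd) op"
  have gs: "adj \<gamma> = \<gamma>"
    using g by (simp add: density_op_def nonneg_op_def self_adjoint_def)
  obtain Q p where Q: "unitary Q" and gq: "\<gamma> = spec Q p"
    using spectral[of \<gamma>] gs unfolding self_adjoint_def by blast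
  note p = density_eigenvalues[OF g[unfolded gq] Q]
  have mp: "m \<le> p i" for i
    using mg by (simp add: gq op_le_spec_iff[OF Q])
  have lp: "\<bar>ln (p i)\<bar> \<le> 1 / m" for i
  proof -
    have "ln m \<le> ln (p i)" "ln (p i) \<le> 0"
      using m mp[of i] p(2)[of i] by auto
    moreover have "ln (1 / m) \<le> 1 / m - 1"
      using m by (intro ln_le_minus_one) auto
    ultimately show ?thesis
      using m by (simp add: ln_div)
  qed
  have w0: "0 \<le> ?w"
    unfolding op_norm_def by (rule onorm_pos_le) (rule matrix_vector_mul_bounded_linear)
  have l: "norm (?l *v y) \<le> 1 / m * norm y" for y
    using lp by (intro norm_tensor2_vec_le) (simp_all add: gq op_log_spec[OF Q] op_norm_spec_le[OF Q])
  have V: "norm (?V *v y) \<le> ?w * norm y" for y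
    by (intro norm_tensor2_vec_le op_norm_mean_field_le W g) (simp add: self_adjoint_def adj_mean_field[OF W] gs)
  have X: "norm ((W - ?V) *v y) \<le> 2 * ?w * norm y" for y
    using norm_triangle_ineq4[of "W *v y" "?V *v y"] norm_op_vec_le[of W y] V[of y]
    unfolding matrix_vector_mult_diff_rdistrib by linarith
  have c: "norm ((c *\<^sub>C A) *v y) = cmod c * norm (A *v y)" for c and A :: "('d \<times> 'd) op" and y
  proof -
    have "(c *\<^sub>C A) *v y = c *s (A *v y)"
      by (simp add: vec_eq_iff cscale_def matrix_vector_mult_def sum_distrib_left mult.assoc)
    moreover have "(norm (c *s z))\<^sup>2 = (cmod c * norm z)\<^sup>2" for z :: "complex^('d \<times> 'd)"
      by (simp add: norm_vec_sq norm_mult power_mult_distrib sum_distrib_left)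
    then have "norm (c *s z) = cmod c * norm z" for z :: "complex^('d \<times> 'd)"
      by (simp add: power2_eq_iff_nonneg)
    ultimately show ?thesis by simp
  qed
  have "norm (correlation W \<gamma> *v x) = norm ((W - ?V) *v (?l *v x) - ?l *v ((W - ?V) *v x))"
    unfolding correlation_def c comm_def matrix_vector_mul_assoc
    by (simp only: matrix_vector_mult_diff_rdistrib[of "(W - ?V) ** ?l"]) simp
  also have "\<dots> \<le> norm ((W - ?V) *v (?l *v x)) + norm (?l *v ((W - ?V) *v x))"
    by (rule norm_triangle_ineq4)
  also have "\<dots> \<le> 2 * ?w * (1 / m * norm x) + 1 / m * (2 * ?w * norm x)"
    using w0 m by (intro add_mono order_trans[OF X] order_trans[OF l] mult_left_mono l X) auto
  also have "\<dots> = 4 * ?w / m * norm x"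
    by simp
  finally show "norm (correlation W \<gamma> *v x) \<le> 4 * ?w / m * norm x" .
qed

lemma adj_op_log: "self_adjoint A \<Longrightarrow> adj (op_log A) = op_log A"
  by (metis adj_spec op_log_spec spectral)

lemma self_adjoint_correlation:
  assumes W: "adj W = W" and g: "adj \<gamma> = \<gamma>"
  shows "self_adjoint (correlation W \<gamma>)"
  using W g
  by (simp add: self_adjoint_def correlation_def comm_def adj_simps adj_tensor2 adj_mean_field
      adj_op_log op_linear algebra_simps)

text \<open>By definition of the mean field and normalisation of \<gamma>, the operator Y has zero
  partial trace over the second factor. The logarithm acts on the first factor and passes through
  that trace on either side.\<close>

lemma correlation_ptrace2:
  assumes tr: "trace \<gamma> = 1"
  shows "(\<Sum>a\<in>UNIV. ((mat 1 \<otimes>\<^sub>2 \<gamma>) ** correlation W \<gamma>) $ (b, a) $ (d, a)) = 0"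
proof -
  define l where "l = op_log \<gamma>"
  define X where "X = W - mean_field W \<gamma> \<otimes>\<^sub>2 mat 1"
  define Y where "Y = (mat 1 \<otimes>\<^sub>2 \<gamma>) ** X"
  have Y0: "(\<Sum>a\<in>UNIV. Y $ (b, a) $ (d, a)) = 0" for b d
  proof -
    have "(\<Sum>a\<in>UNIV. Y $ (b, a) $ (d, a)) = mean_field W \<gamma> $ b $ d
        - (\<Sum>a\<in>UNIV. ((mat 1 ** mean_field W \<gamma>) \<otimes>\<^sub>2 (\<gamma> ** mat 1)) $ (b, a) $ (d, a))"
      unfolding tensor2_mult[symmetric]
      by (simp add: Y_def X_def mean_field_def ptrace2_def matrix_diff_ldistrib sum_subtractf)
    also have "(\<Sum>a\<in>UNIV. ((mat 1 ** mean_field W \<gamma>) \<otimes>\<^sub>2 (\<gamma> ** mat 1)) $ (b, a) $ (d, a)) = mean_field W \<gamma> $ b $ d * trace \<gamma>"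
      by (simp add: tensor2_def trace_def sum_distrib_left)
    finally show ?thesis using tr by simp
  qed
  have "(mat 1 \<otimes>\<^sub>2 \<gamma>) ** correlation W \<gamma>
      = (- \<i>) *\<^sub>C (Y ** (l \<otimes>\<^sub>2 mat 1) - (mat 1 \<otimes>\<^sub>2 \<gamma>) ** (l \<otimes>\<^sub>2 mat 1) ** X)"
    by (simp add: correlation_def comm_def op_linear X_def[symmetric] l_def[symmetric] Y_def matrix_mul_assoc)
  also have "(mat 1 \<otimes>\<^sub>2 \<gamma>) ** (l \<otimes>\<^sub>2 mat 1) = (l \<otimes>\<^sub>2 mat 1) ** (mat 1 \<otimes>\<^sub>2 \<gamma>)"
    by (simp add: tensor2_mult)
  also have "(l \<otimes>\<^sub>2 mat 1) ** (mat 1 \<otimes>\<^sub>2 \<gamma>) ** X = (l \<otimes>\<^sub>2 mat 1) ** Y"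
    by (simp add: Y_def matrix_mul_assoc)
  finally have "(\<Sum>a\<in>UNIV. ((mat 1 \<otimes>\<^sub>2 \<gamma>) ** correlation W \<gamma>) $ (b, a) $ (d, a))
      = - \<i> * ((\<Sum>a\<in>UNIV. (Y ** (l \<otimes>\<^sub>2 mat 1)) $ (b, a) $ (d, a)) - (\<Sum>a\<in>UNIV. ((l \<otimes>\<^sub>2 mat 1) ** Y) $ (b, a) $ (d, a)))"
    by (simp add: cscale_def sum_subtractf sum_negf sum_distrib_left right_diff_distrib)
  also have "(\<Sum>a\<in>UNIV. (Y ** (l \<otimes>\<^sub>2 mat 1)) $ (b, a) $ (d, a)) = (\<Sum>e\<in>UNIV. (\<Sum>a\<in>UNIV. Y $ (b, a) $ (e, a)) * l $ e $ d)"
    unfolding mult_tensor2_left_nth sum_distrib_right by (rule sum.swap)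
  also have "(\<Sum>a\<in>UNIV. ((l \<otimes>\<^sub>2 mat 1) ** Y) $ (b, a) $ (d, a)) = (\<Sum>e\<in>UNIV. l $ b $ e * (\<Sum>a\<in>UNIV. Y $ (e, a) $ (d, a)))"
    unfolding tensor2_left_mult_nth sum_distrib_left by (rule sum.swap)
  finally show ?thesis by (simp add: Y0)
qed

text \<open>Since \<gamma> commutes with its logarithm, multiplying by \<gamma> on the first factor
  again gives a commutator with an operator on that factor; cyclicity of the partial trace
  annihilates it.\<close>

lemma correlation_ptrace1:
  assumes g: "self_adjoint \<gamma>"
  shows "(\<Sum>a\<in>UNIV. ((\<gamma> \<otimes>\<^sub>2 mat 1) ** correlation W \<gamma>) $ (a, b) $ (a, d)) = 0"
proof -
  obtain Q p where Q: "unitary Q" and gq: "\<gamma> = spec Q p"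
    using spectral[OF g] by blast
  define l where "l = op_log \<gamma>"
  have gl: "\<gamma> ** l = l ** \<gamma>"
    by (simp add: l_def gq op_log_spec[OF Q] spec_mult[OF Q] mult.commute)
  define X where "X = W - mean_field W \<gamma> \<otimes>\<^sub>2 mat 1"
  define Y where "Y = (\<gamma> \<otimes>\<^sub>2 mat 1) ** X"
  have "(\<gamma> \<otimes>\<^sub>2 mat 1) ** correlation W \<gamma>
      = (- \<i>) *\<^sub>C (Y ** (l \<otimes>\<^sub>2 mat 1) - (\<gamma> \<otimes>\<^sub>2 mat 1) ** (l \<otimes>\<^sub>2 mat 1) ** X)"
    by (simp add: correlation_def comm_def op_linear X_def[symmetric] l_def[symmetric] Y_def matrix_mul_assoc)
  also have "(\<gamma> \<otimes>\<^sub>2 mat 1) ** (l \<otimes>\<^sub>2 mat 1) = (l \<otimes>\<^sub>2 mat 1) ** (\<gamma> \<otimes>\<^sub>2 mat 1)"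
    by (simp add: tensor2_mult gl)
  also have "(l \<otimes>\<^sub>2 mat 1) ** (\<gamma> \<otimes>\<^sub>2 mat 1) ** X = (l \<otimes>\<^sub>2 mat 1) ** Y"
    by (simp add: Y_def matrix_mul_assoc)
  finally have "(\<Sum>a\<in>UNIV. ((\<gamma> \<otimes>\<^sub>2 mat 1) ** correlation W \<gamma>) $ (a, b) $ (a, d))
      = - \<i> * ((\<Sum>a\<in>UNIV. (Y ** (l \<otimes>\<^sub>2 mat 1)) $ (a, b) $ (a, d)) - (\<Sum>a\<in>UNIV. ((l \<otimes>\<^sub>2 mat 1) ** Y) $ (a, b) $ (a, d)))"
    by (simp add: cscale_def sum_subtractf sum_negf sum_distrib_left right_diff_distrib)
  also have "(\<Sum>a\<in>UNIV. (Y ** (l \<otimes>\<^sub>2 mat 1)) $ (a, b) $ (a, d)) = (\<Sum>a\<in>UNIV. ((l \<otimes>\<^sub>2 mat 1) ** Y) $ (a, b) $ (a, d))"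
    unfolding tensor2_left_mult_nth mult_tensor2_left_nth by (subst sum.swap) (simp add: mult.commute)
  finally show ?thesis by simp
qed

text \<open>The Gibbs inequality is applied to the pair sum divided by 32 C, the scale at which its
  exponential moment is at most 2; multiplying back yields the factor 32 C.\<close>

lemma correlation_entropy_bound:
  fixes W :: "('d::finite \<times> 'd) op" and \<Gamma> :: "('n::finite \<Rightarrow> 'd) op"
  assumes N: "CARD('n) \<ge> 2" and W: "adj W = W" and g: "density_op \<gamma>" and m: "0 < m" and mg: "m *\<^sub>R mat 1 \<preceq> \<gamma>"
    and m': "0 < m'" and mr: "m' *\<^sub>R mat 1 \<preceq> (tensor_power \<gamma> :: ('n \<Rightarrow> 'd) op)"
    and mG: "m' *\<^sub>R mat 1 \<preceq> \<Gamma>" and trG: "trace \<Gamma> = 1"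
    and C: "op_norm (correlation W \<gamma>) \<le> C" "0 < C"
  shows "((1 / (real CARD('n) - 1)) *\<^sub>R (\<Sum>p\<in>off_diagonal. two_body (fst p) (snd p) (correlation W \<gamma>))) \<bullet> \<Gamma>
    \<le> 32 * C * (rel_ent \<Gamma> (tensor_power \<gamma>) + ln 2)"
proof -
  let ?B = "\<Sum>p\<in>off_diagonal. two_body (fst p) (snd p) (correlation W \<gamma>) :: ('n \<Rightarrow> 'd) op"
  have gs: "self_adjoint \<gamma>" and g0: "0 *\<^sub>R mat 1 \<preceq> \<gamma>" and trg: "trace \<gamma> = 1"
    using g unfolding density_op_iff by (auto simp only: op_le_scaleR_iff)
  have R: "self_adjoint (correlation W \<gamma>)"
    using self_adjoint_correlation[OF W] gs by (simp add: self_adjoint_def)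
  let ?A = "(1 / (32 * C * (real CARD('n) - 1))) *\<^sub>R ?B"
  have "self_adjoint ?A"
    using R by (simp add: self_adjoint_def adj_simps adj_two_body)
  then obtain V a where V: "unitary V" and A': "?A = spec V a"
    by (rule spectral)
  note A = A'[symmetric]
  have "spec V a \<bullet> \<Gamma> \<le> rel_ent \<Gamma> (tensor_power \<gamma>) + ln (spec V (\<lambda>k. exp (a k)) \<bullet> tensor_power \<gamma>)"
    by (rule gibbs_variational[OF m' mG mr trG _ V]) (simp add: tensor_power_eq trace_prod_op trg)
  moreover have "spec V (\<lambda>k. exp (a k)) \<bullet> tensor_power \<gamma> \<le> 2"
    by (rule exponential_moment_le_2[OF N g0 trg R C correlation_ptrace1[OF gs] correlation_ptrace2[OF trg] V A])
  moreover have "0 < spec V (\<lambda>k. exp (a k)) \<bullet> (tensor_power \<gamma> :: ('n \<Rightarrow> 'd) op)"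
    unfolding inner_spec_op
  proof (intro sum_pos mult_pos_pos)
    fix k
    have "m' * (norm (V *v axis k 1))\<^sup>2 \<le> (V *v axis k 1) \<bullet> (tensor_power \<gamma> *v (V *v axis k 1))"
      using mr unfolding op_le_scaleR_iff by blast
    then show "0 < (V *v axis k 1) \<bullet> (tensor_power \<gamma> *v (V *v axis k 1))"
      using m' by (simp add: norm_unitary_vec[OF V])
  qed auto
  ultimately have "spec V a \<bullet> \<Gamma> \<le> rel_ent \<Gamma> (tensor_power \<gamma>) + ln 2"
    by (smt (verit) ln_le_cancel_iff)
  then have "32 * C * (spec V a \<bullet> \<Gamma>) \<le> 32 * C * (rel_ent \<Gamma> (tensor_power \<gamma>) + ln 2)"
    using C by (intro mult_left_mono) auto
  moreover have "32 * C * (spec V a \<bullet> \<Gamma>) = ((1 / (real CARD('n) - 1)) *\<^sub>R ?B) \<bullet> \<Gamma>"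
    unfolding A using C by simp
  ultimately show ?thesis by simp
qed

section \<open>Solutions of the two equations\<close>

lemma norm_minus_i_cscale: "norm ((- \<i>) *\<^sub>C A) = norm (A :: 'a::finite op)"
proof -
  have "cnj (- \<i>) *\<^sub>C (- \<i>) *\<^sub>C A = A"
    by (simp add: vec_eq_iff cscale_def)
  then show ?thesis
    by (simp add: norm_eq_sqrt_inner inner_cscale)
qed

lemma norm_comm_le: "norm (comm A B) \<le> 2 * norm A * norm (B :: 'a::finite op)"
  unfolding comm_def using norm_triangle_ineq4[of "A ** B" "B ** A"] matrix_norm_mult[of A B] matrix_norm_mult[of B A]
  by (simp add: mult.commute[of "norm B"])

lemma trace_preserved:
  fixes A :: "real \<Rightarrow> 'a::finite op"
  assumes A': "\<And>t. 0 \<le> t \<Longrightarrow> (A has_vector_derivative gen (H t) J L (A t)) (at t within {0..})"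
    and T: "0 \<le> T"
  shows "trace (A T) = trace (A 0)"
proof -
  have "((\<lambda>t. trace (A t) - trace (A 0)) has_vector_derivative 0) (at t within {0..})" if "0 \<le> t" for t
    using has_vector_derivative_diff[OF bounded_linear.has_vector_derivative[OF bounded_linear_trace A'[OF that]]
        has_vector_derivative_const[of "trace (A 0)"]]
    by (simp add: trace_gen)
  then have "trace (A T) - trace (A 0) = 0"
    using ode_zero_unique[OF T, where K = 0 and D' = "\<lambda>_. 0" and D = "\<lambda>t. trace (A t) - trace (A 0)"] by simp
  then show ?thesis by simp
qed

lemma hartree_gen:
  "(- \<i>) *\<^sub>C comm H A + dissipator L A = gen H {()} (\<lambda>_. L) A"
  by (simp add: gen_def)

text \<open>The right-hand side commutes with taking adjoints, so \<gamma> and its adjoint solve the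
  same equation. The right-hand side is locally Lipschitz and \<gamma> is bounded on [0, T], hence
  the difference stays zero. Only then is the mean-field Hamiltonian known to be
  self-adjoint.\<close>

lemma hartree_self_adjoint:
  fixes \<gamma> :: "real \<Rightarrow> 'd::finite op"
  assumes h: "adj h = h" and W: "adj W = W" and sol: "hartree_lindblad_solution h L W \<gamma>"
    and g0: "adj (\<gamma> 0) = \<gamma> 0" and T: "0 \<le> T"
  shows "adj (\<gamma> T) = \<gamma> T"
proof -
  let ?rhs = "\<lambda>A. (- \<i>) *\<^sub>C comm (h + mean_field W A) A + dissipator L A"
  have g': "(\<gamma> has_vector_derivative ?rhs (\<gamma> t)) (at t within {0..})" if "0 \<le> t" for t
    using sol that by (simp add: hartree_lindblad_solution_def)
  have adj_rhs: "adj (?rhs A) = ?rhs (adj A)" for A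
    by (simp add: adj_simps comm_def adj_dissipator adj_mean_field[OF W] h op_linear algebra_simps)
  define D where "D = (\<lambda>t. \<gamma> t - adj (\<gamma> t))"
  have D': "(D has_vector_derivative ?rhs (\<gamma> t) - ?rhs (adj (\<gamma> t))) (at t within {0..})" if "0 \<le> t" for t
    unfolding D_def adj_rhs[symmetric]
    by (intro has_vector_derivative_diff g' that bounded_linear.has_vector_derivative[OF bounded_linear_adj])
  \<comment> \<open>The quadratic term is telescoped: one copy of the unknown is replaced at a
    time.\<close>
  have diff: "?rhs A - ?rhs B = (- \<i>) *\<^sub>C comm (h + mean_field W A) (A - B)
      + (- \<i>) *\<^sub>C comm (mean_field W (A - B)) B + dissipator L (A - B)" for A B
    by (simp add: comm_def mean_field_diff dissipator_linear op_linear algebra_simps)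
  have "continuous_on {0..} \<gamma>"
    using g' by (auto simp: continuous_on_eq_continuous_within intro: has_vector_derivative_continuous)
  then have "continuous_on {0..T} \<gamma>"
    by (rule continuous_on_subset) auto
  then have "bounded (\<gamma> ` {0..T})"
    by (intro compact_imp_bounded compact_continuous_image) auto
  then obtain M where M: "0 < M" "\<And>t. t \<in> {0..T} \<Longrightarrow> norm (\<gamma> t) \<le> M"
    unfolding bounded_pos by auto
  obtain c where c: "0 \<le> c" "\<And>A. norm (mean_field W A) \<le> c * norm A"
    using bounded_linear.nonneg_bounded[of "mean_field W"] linear_mean_field
    by (metis linear_conv_bounded_linear mult.commute)
  have "linear (dissipator L)"
    by unfold_locales (auto simp: dissipator_linear)
  then obtain c' where c': "\<And>A. norm (dissipator L A) \<le> c' * norm A"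
    using bounded_linear.bounded[of "dissipator L"] by (metis linear_conv_bounded_linear mult.commute)
  have K: "norm (?rhs (\<gamma> t) - ?rhs (adj (\<gamma> t))) \<le> (2 * (norm h + c * M) + 2 * c * M + c') * norm (D t)"
    if t: "0 \<le> t" "t \<le> T" for t
  proof -
    have Dt: "\<gamma> t - adj (\<gamma> t) = D t" by (simp add: D_def)
    have n: "norm (\<gamma> t) \<le> M" using M t by simp
    have "norm (h + mean_field W (\<gamma> t)) \<le> norm h + c * M"
      using n c by (intro order_trans[OF norm_triangle_ineq] add_mono order_trans[OF c(2)] mult_left_mono) auto
    then have 1: "norm ((- \<i>) *\<^sub>C comm (h + mean_field W (\<gamma> t)) (D t)) \<le> 2 * (norm h + c * M) * norm (D t)"
      unfolding norm_minus_i_cscale by (intro order_trans[OF norm_comm_le] mult_right_mono mult_left_mono) auto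
    have 2: "norm ((- \<i>) *\<^sub>C comm (mean_field W (D t)) (adj (\<gamma> t))) \<le> 2 * (c * norm (D t)) * M"
      unfolding norm_minus_i_cscale using n c
      by (intro order_trans[OF norm_comm_le] mult_mono) auto
    have "norm (?rhs (\<gamma> t) - ?rhs (adj (\<gamma> t))) \<le> 2 * (norm h + c * M) * norm (D t) + 2 * (c * norm (D t)) * M + c' * norm (D t)"
      unfolding diff Dt
      by (intro order_trans[OF norm_triangle_ineq] add_mono 1 2 c')
    then show ?thesis by (simp add: algebra_simps)
  qed
  have "D T = 0"
    by (rule ode_zero_unique[OF T D' K]) (simp_all add: D_def g0)
  then show ?thesis by (simp add: D_def)
qed

lemma lindblad_self_adjoint:
  fixes A :: "real \<Rightarrow> 'a::finite op"
  assumes H: "adj H = H" and A': "\<And>t. 0 \<le> t \<Longrightarrow> (A has_vector_derivative gen H J L (A t)) (at t within {0..})"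
    and A0: "adj (A 0) = A 0" and T: "0 \<le> T"
  shows "adj (A T) = A T"
proof -
  define D where "D = (\<lambda>t. A t - adj (A t))"
  have D': "(D has_vector_derivative gen H J L (D t)) (at t within {0..})" if "0 \<le> t" for t
    unfolding D_def gen_diff adj_gen[OF H, symmetric]
    by (intro has_vector_derivative_diff A' that bounded_linear.has_vector_derivative[OF bounded_linear_adj])
  obtain c where c: "\<And>A. norm (gen H J L A) \<le> c * norm A"
    using bounded_linear.bounded[OF bounded_linear_gen] by (metis mult.commute)
  have "D T = 0"
    by (rule ode_zero_unique[OF T D' c]) (simp_all add: D_def A0)
  then show ?thesis by (simp add: D_def)
qed

lemma op_le_mono: "m' \<le> m \<Longrightarrow> m *\<^sub>R mat 1 \<preceq> A \<Longrightarrow> m' *\<^sub>R mat 1 \<preceq> A"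
  unfolding op_le_scaleR_iff by (meson mult_right_mono order_trans zero_le_power2)

lemma adj_hamiltonian:
  assumes "adj h = h" "adj W = W"
  shows "adj (hamiltonian h W) = hamiltonian h W"
  using assms by (simp add: hamiltonian_def adj_simps adj_one_body adj_two_body case_prod_unfold)

lemma comm_hamiltonian_log:
  fixes W :: "('d::finite \<times> 'd) op"
  assumes W: "swap_op ** W ** swap_op = W" and N: "CARD('n::{finite,linorder}) \<ge> 2"
    and m: "m > 0" and g: "m *\<^sub>R mat 1 \<preceq> \<gamma>"
  shows "(- \<i>) *\<^sub>C comm (hamiltonian h W - (\<Sum>j\<in>UNIV. one_body j (h + mean_field W \<gamma>))) (op_log (tensor_power \<gamma>))
    = (1 / (real CARD('n) - 1)) *\<^sub>R (\<Sum>p\<in>off_diagonal. two_body (fst p) (snd p) (correlation W \<gamma>) :: ('n \<Rightarrow> 'd) op)"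
  unfolding op_log_tensor_power[OF m g] comm_hamiltonian_mean_field[OF W N]
  by (simp add: correlation_def two_body_cscale cscale_scaleR off_diagonal_def case_prod_unfold flip: cscale_sum)

section \<open>Regularisation by the maximally mixed state\<close>

definition mix :: "real \<Rightarrow> 'a::finite op \<Rightarrow> 'a op"
  where "mix \<epsilon> A = (1 - \<epsilon>) *\<^sub>R A + (\<epsilon> / real CARD('a)) *\<^sub>R mat 1"

lemma mix_spec:
  assumes "unitary (Q :: 'a::finite op)"
  shows "mix \<epsilon> (spec Q p) = spec Q (\<lambda>i. (1 - \<epsilon>) * p i + \<epsilon> / real CARD('a))"
  by (simp add: mix_def spec_one[OF assms, symmetric] spec_scaleR spec_add)

lemma op_le_mix:
  assumes A: "0 *\<^sub>R mat 1 \<preceq> (A :: 'a::finite op)" and e: "0 \<le> \<epsilon>" "\<epsilon> \<le> 1"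
  shows "(\<epsilon> / real CARD('a)) *\<^sub>R mat 1 \<preceq> mix \<epsilon> A"
proof -
  obtain Q p where Q: "unitary Q" and As: "A = spec Q p"
    using A spectral[of A] unfolding op_le_scaleR_iff by blast
  then show ?thesis
    using A e unfolding As mix_spec[OF Q] op_le_spec_iff[OF Q] by simp
qed

lemma trace_mix: "trace A = 1 \<Longrightarrow> trace (mix \<epsilon> (A :: 'a::finite op)) = 1"
  unfolding mix_def trace_add trace_scaleR trace_I by (simp add: scaleR_conv_of_real)

text \<open>At x = 0 the limit y ln y -> 0 matches the convention \<open>ln 0 = 0\<close>;
  positivity of f makes its approach to 0 one-sided.\<close>

lemma tendsto_mult_ln:
  fixes f :: "real \<Rightarrow> real"
  assumes f: "(f \<longlongrightarrow> x) (at_right 0)" and pos: "eventually (\<lambda>e. 0 < f e) (at_right 0)"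
  shows "((\<lambda>e. f e * ln (f e)) \<longlongrightarrow> x * ln x) (at_right 0)"
proof (cases "x = 0")
  case True
  have "((\<lambda>y :: real. y * ln y) \<longlongrightarrow> 0) (at_right 0)"
    by real_asymp
  moreover have "filterlim f (at_right 0) (at_right 0)"
    using f pos True by (auto simp: filterlim_at elim: eventually_mono)
  ultimately show ?thesis
    using True filterlim_compose by fastforce
next
  case False
  then show ?thesis
    by (intro tendsto_intros f)
qed

text \<open>Mixing keeps the eigenbasis, so the entropy term converges eigenvalue by eigenvalue,
  zero eigenvalues included; the pairing with the logarithm of \<rho> is affine in
  \<epsilon>.\<close>

lemma rel_ent_mix_tendsto:
  fixes A \<rho> :: "'a::finite op"
  assumes A: "0 *\<^sub>R mat 1 \<preceq> A"
  shows "((\<lambda>\<epsilon>. rel_ent (mix \<epsilon> A) \<rho>) \<longlongrightarrow> rel_ent A \<rho>) (at_right 0)"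
proof -
  obtain Q p where Q: "unitary Q" and As: "A = spec Q p"
    using A spectral[of A] unfolding op_le_scaleR_iff by blast
  have p: "0 \<le> p i" for i
    using A unfolding As op_le_spec_iff[OF Q] by blast
  define f where "f = (\<lambda>i \<epsilon>. (1 - \<epsilon>) * p i + \<epsilon> / real CARD('a))"
  have f0: "f i 0 = p i" for i by (simp add: f_def)
  have f: "(f i \<longlongrightarrow> p i) (at_right 0)" for i
  proof -
    have "(f i \<longlongrightarrow> f i 0) (at 0)"
      unfolding f_def by (intro tendsto_eq_intros refl) auto
    then show ?thesis
      unfolding f0 by (rule filterlim_mono) (auto simp: at_le)
  qed
  have pos: "eventually (\<lambda>e. 0 < f i e) (at_right 0)" for i
  proof (rule eventually_mono)
    show "eventually (\<lambda>e :: real. e \<in> {0<..<1}) (at_right 0)"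
      by (rule eventually_at_right_real) simp
    fix e :: real assume "e \<in> {0<..<1}"
    then show "0 < f i e"
      unfolding f_def using p[of i] by (intro add_nonneg_pos mult_nonneg_nonneg) auto
  qed
  have "((\<lambda>\<epsilon>. (\<Sum>i\<in>UNIV. f i \<epsilon> * ln (f i \<epsilon>)) - ((1 - \<epsilon>) *\<^sub>R A + (\<epsilon> / real CARD('a)) *\<^sub>R mat 1) \<bullet> op_log \<rho>) \<longlongrightarrow>
      (\<Sum>i\<in>UNIV. p i * ln (p i)) - ((1 - 0) *\<^sub>R A + (0 / real CARD('a)) *\<^sub>R mat 1) \<bullet> op_log \<rho>) (at_right 0)"
    by (intro tendsto_intros tendsto_mult_ln f pos) auto
  moreover have "rel_ent (mix \<epsilon> A) \<rho> = (\<Sum>i\<in>UNIV. f i \<epsilon> * ln (f i \<epsilon>)) - ((1 - \<epsilon>) *\<^sub>R A + (\<epsilon> / real CARD('a)) *\<^sub>R mat 1) \<bullet> op_log \<rho>" for \<epsilon>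
  proof -
    have m: "mix \<epsilon> A = spec Q (\<lambda>i. f i \<epsilon>)"
      unfolding f_def As by (rule mix_spec[OF Q])
    have "mix \<epsilon> A \<bullet> op_log (mix \<epsilon> A) = (\<Sum>i\<in>UNIV. f i \<epsilon> * ln (f i \<epsilon>))"
      by (simp add: m op_log_spec[OF Q] inner_spec_same[OF Q])
    then show ?thesis
      by (simp add: rel_ent_def inner_diff_right mix_def)
  qed
  moreover have "rel_ent A \<rho> = (\<Sum>i\<in>UNIV. p i * ln (p i)) - A \<bullet> op_log \<rho>"
    by (simp add: rel_ent_def inner_diff_right As op_log_spec[OF Q] inner_spec_same[OF Q])
  ultimately show ?thesis by simp
qed

lemma rel_entropy_eq:
  fixes \<Gamma> \<rho> :: "'a::finite op"
  assumes G: "adj \<Gamma> = \<Gamma>" and m: "m > 0" and r: "m *\<^sub>R mat 1 \<preceq> \<rho>"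
  shows "rel_entropy \<Gamma> \<rho> = ereal (rel_ent \<Gamma> \<rho>)"
proof -
  have "v = 0" if "\<rho> *v v = 0" for v
  proof -
    have "m * (norm v)\<^sup>2 \<le> v \<bullet> (\<rho> *v v)"
      using r unfolding op_le_scaleR_iff by blast
    then show ?thesis
      using that m by (simp add: mult_le_0_iff)
  qed
  then have "op_ker \<rho> \<subseteq> {0}"
    unfolding op_ker_def by blast
  moreover have "0 \<in> op_ker \<Gamma>"
    by (simp add: op_ker_def)
  ultimately have "op_ker \<rho> \<subseteq> op_ker \<Gamma>"
    by blast
  then show ?thesis
    by (simp add: rel_entropy_def rel_ent_def inner_op_eq G)
qed

text \<open>Adding ln 2 to the entropy makes the differential inequality homogeneous: the upper
  right derivative of the sum is at most 32 C times the sum. The lower bound \<mu> keeps \<Gamma> in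
  the range of the variational formulas.\<close>

lemma relative_entropy_gronwall:
  fixes h L :: "'d::finite op" and W :: "('d \<times> 'd) op"
    and \<Gamma> :: "real \<Rightarrow> ('n::{finite,linorder} \<Rightarrow> 'd) op" and \<gamma> :: "real \<Rightarrow> 'd op"
  assumes h: "adj h = h" and W: "adj W = W" and sw: "swap_op ** W ** swap_op = W"
    and N: "CARD('n) \<ge> 2" and m: "m > 0"
    and \<Gamma>': "\<And>t. 0 \<le> t \<Longrightarrow> (\<Gamma> has_vector_derivative gen (hamiltonian h W) UNIV (\<lambda>j. one_body j L) (\<Gamma> t)) (at t within {0..})"
    and \<gamma>': "\<And>t. 0 \<le> t \<Longrightarrow> (\<gamma> has_vector_derivative gen (h + mean_field W (\<gamma> t)) {()} (\<lambda>_. L) (\<gamma> t)) (at t within {0..})"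
    and \<Gamma>: "\<And>t. 0 \<le> t \<Longrightarrow> \<mu> *\<^sub>R mat 1 \<preceq> \<Gamma> t" "\<And>t. 0 \<le> t \<Longrightarrow> trace (\<Gamma> t) = 1" and \<mu>: "0 < \<mu>"
    and \<gamma>: "\<And>t. 0 \<le> t \<Longrightarrow> m *\<^sub>R mat 1 \<preceq> \<gamma> t" "\<And>t. 0 \<le> t \<Longrightarrow> trace (\<gamma> t) = 1"
    and C: "\<And>t. 0 \<le> t \<Longrightarrow> op_norm (correlation W (\<gamma> t)) \<le> C" "0 < C" and T: "0 \<le> T"
  shows "rel_ent (\<Gamma> T) (tensor_power (\<gamma> T)) + ln 2
    \<le> exp (32 * C * T) * (rel_ent (\<Gamma> 0) (tensor_power (\<gamma> 0)) + ln 2)"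
proof -
  define \<rho> where "\<rho> = (\<lambda>t. tensor_power (\<gamma> t) :: ('n \<Rightarrow> 'd) op)"
  \<comment> \<open>The variational lemmas use one lower bound for both states; the product state
    has the N-th power of m.\<close>
  define m' where "m' = min \<mu> (m ^ CARD('n))"
  have m': "0 < m'" using m \<mu> by (simp add: m'_def)
  have \<Gamma>m: "m' *\<^sub>R mat 1 \<preceq> \<Gamma> t" and \<rho>m: "m' *\<^sub>R mat 1 \<preceq> \<rho> t" and \<rho>tr: "trace (\<rho> t) = 1" if "0 \<le> t" for t
  proof -
    show "m' *\<^sub>R mat 1 \<preceq> \<Gamma> t"
      by (rule op_le_mono[OF _ \<Gamma>(1)[OF that]]) (simp add: m'_def)
    have "m ^ CARD('n) *\<^sub>R mat 1 \<preceq> \<rho> t"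
      unfolding \<rho>_def using m by (intro op_le_tensor_power \<gamma> that) auto
    then show "m' *\<^sub>R mat 1 \<preceq> \<rho> t"
      by (rule op_le_mono[rotated]) (simp add: m'_def)
    show "trace (\<rho> t) = 1"
      using \<gamma>(2)[OF that] by (simp add: \<rho>_def tensor_power_eq trace_prod_op)
  qed
  define H where "H = (\<lambda>t. \<Sum>j\<in>UNIV. one_body j (h + mean_field W (\<gamma> t)) :: ('n \<Rightarrow> 'd) op)"
  have \<rho>': "(\<rho> has_vector_derivative gen (H t) UNIV (\<lambda>j. one_body j L) (\<rho> t)) (at t within {0..})" if "0 \<le> t" for t
    using tensor_power_derivative[OF \<gamma>'[OF that], where 'n = 'n]
    unfolding hartree_gen[symmetric] slot_gen \<rho>_def H_def .
  have gsa: "adj (\<gamma> t) = \<gamma> t" if "0 \<le> t" for t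
    using \<gamma>(1)[OF that] unfolding op_le_scaleR_iff self_adjoint_def by blast
  have Hsa: "adj (H t) = H t" if "0 \<le> t" for t
    by (simp add: H_def adj_simps adj_one_body adj_mean_field[OF W] h gsa[OF that])
  have Ksa: "adj (hamiltonian h W - H t) = hamiltonian h W - H t" if "0 \<le> t" for t
    by (simp add: adj_diff Hsa[OF that] adj_hamiltonian h W)
  \<comment> \<open>The N-body generator is the generator of the product state, frozen at time t,
    plus the commutator with the Hamiltonian difference.\<close>
  have split: "gen (hamiltonian h W) UNIV (\<lambda>j. one_body j L) A
      = gen (H t) UNIV (\<lambda>j. one_body j L) A + (- \<i>) *\<^sub>C comm (hamiltonian h W - H t) A" for A t
    by (simp add: gen_def comm_linear op_linear)
  define g where "g = (\<lambda>t. rel_ent (\<Gamma> t) (\<rho> t) + ln 2)"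
  have "continuous_on {0..T} (\<lambda>t. rel_ent (\<Gamma> t) (\<rho> t))"
  proof (rule continuous_on_rel_ent[OF m'])
    have "continuous_on {0..} \<Gamma>" "continuous_on {0..} \<rho>"
      using \<Gamma>' \<rho>' by (auto simp: continuous_on_eq_continuous_within intro: has_vector_derivative_continuous)
    then show "continuous_on {0..T} \<Gamma>" "continuous_on {0..T} \<rho>"
      by (auto elim: continuous_on_subset)
  qed (use \<Gamma>m \<rho>m \<rho>tr \<Gamma>(2) in auto)
  then have cont: "continuous_on {0..T} g"
    unfolding g_def by (intro continuous_intros)
  have "g T \<le> exp (32 * C * T) * g 0"
  proof (rule dini_gronwall[OF T cont])
    show "0 \<le> 32 * C" using C(2) by simp
    show "0 \<le> g 0"
      unfolding g_def using rel_ent_nonneg[OF m' \<Gamma>m[of 0] \<rho>m[of 0]] \<Gamma>(2)[of 0] \<rho>tr[of 0] by simp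
    fix t e :: real assume t: "0 \<le> t" "t < T" and e: "0 < e"
    have dens: "density_op (\<gamma> t)"
      unfolding density_op_iff using op_le_zero_mono[OF _ \<gamma>(1)[OF t(1)]] \<gamma>(2)[OF t(1)] m by simp
    have b: "((- \<i>) *\<^sub>C comm (hamiltonian h W - H t) (op_log (\<rho> t))) \<bullet> \<Gamma> t \<le> 32 * C * g t"
      unfolding g_def H_def \<rho>_def comm_hamiltonian_log[OF sw N m \<gamma>(1)[OF t(1)]]
      by (rule correlation_entropy_bound[OF N W dens m \<gamma>(1)[OF t(1)] m' \<rho>m[OF t(1), unfolded \<rho>_def]
            \<Gamma>m[OF t(1)] \<Gamma>(2)[OF t(1)] C(1)[OF t(1)] C(2)])
    have "\<exists>d>0. \<forall>\<delta>. 0 < \<delta> \<longrightarrow> \<delta> < d \<longrightarrow>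
      rel_ent (\<Gamma> (t + \<delta>)) (\<rho> (t + \<delta>)) \<le> rel_ent (\<Gamma> t) (\<rho> t)
        + \<delta> * (((- \<i>) *\<^sub>C comm (hamiltonian h W - H t) (op_log (\<rho> t))) \<bullet> \<Gamma> t + e)"
      using t(1) \<Gamma>m \<rho>m \<rho>tr \<Gamma>(2)
      by (intro rel_ent_dini[OF m' t(1) _ _ _ _ Hsa[OF t(1)] Ksa[OF t(1)] \<Gamma>'[OF t(1), unfolded split[where t = t]] \<rho>'[OF t(1)] e])
        auto
    then obtain d where d: "0 < d" "\<And>\<delta>. 0 < \<delta> \<Longrightarrow> \<delta> < d \<Longrightarrow>
      rel_ent (\<Gamma> (t + \<delta>)) (\<rho> (t + \<delta>)) \<le> rel_ent (\<Gamma> t) (\<rho> t)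
        + \<delta> * (((- \<i>) *\<^sub>C comm (hamiltonian h W - H t) (op_log (\<rho> t))) \<bullet> \<Gamma> t + e)"
      by blast
    have "g (t + \<delta>) \<le> g t + \<delta> * (32 * C * g t + e)" if "0 < \<delta>" "\<delta> < d" for \<delta>
    proof -
      have "\<delta> * (((- \<i>) *\<^sub>C comm (hamiltonian h W - H t) (op_log (\<rho> t))) \<bullet> \<Gamma> t + e) \<le> \<delta> * (32 * C * g t + e)"
        using b that by (intro mult_left_mono) auto
      then show ?thesis
        using d(2)[OF that] by (simp add: g_def)
    qed
    then show "\<exists>d>0. \<forall>\<delta>. 0 < \<delta> \<longrightarrow> \<delta> < d \<longrightarrow> g (t + \<delta>) \<le> g t + \<delta> * (32 * C * g t + e)"
      using d(1) by blast
  qed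
  then show ?thesis by (simp add: g_def \<rho>_def)
qed

theorem theorem3:
  fixes h L \<gamma>\<^sub>0 :: "complex^'d^'d"
    and W :: "complex^('d \<times> 'd)^('d \<times> 'd)"
    and m\<^sub>0 :: real
    and \<Gamma> :: "real \<Rightarrow> complex^('n::{finite,linorder} \<Rightarrow> 'd)^('n \<Rightarrow> 'd)"
    and \<gamma> :: "real \<Rightarrow> complex^'d^'d"
  assumes "self_adjoint h"
    and "self_adjoint W"
    and "swap_op ** W ** swap_op = W"
    and "L ** adj L = adj L ** L"
    and "density_op \<gamma>\<^sub>0"
    and "m\<^sub>0 > 0"
    and "m\<^sub>0 *\<^sub>R mat 1 \<preceq> \<gamma>\<^sub>0"
    and "CARD('n) \<ge> 2"
    and "lindblad_solution h L W \<Gamma>"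
    and "sym_density (\<Gamma> 0)"
    and "hartree_lindblad_solution h L W \<gamma>"
    and "\<gamma> 0 = \<gamma>\<^sub>0"
  shows "C_const W m\<^sub>0 < \<infinity>
    \<and> (\<forall>t\<ge>0. rel_entropy (\<Gamma> t) (tensor_power (\<gamma> t))
          \<le> ereal (exp (32 * real_of_ereal (C_const W m\<^sub>0) * t))
             * (rel_entropy (\<Gamma> 0) (tensor_power \<gamma>\<^sub>0) + ereal (ln 2)))
    \<and> C_const W m\<^sub>0 \<le> ereal (4 * op_norm W / m\<^sub>0)
    \<and> (\<forall>t\<ge>0. rel_entropy (\<Gamma> t) (tensor_power (\<gamma> t))
          \<le> ereal (exp (128 * op_norm W * t / m\<^sub>0))
             * (rel_entropy (\<Gamma> 0) (tensor_power \<gamma>\<^sub>0) + ereal (ln 2)))"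
proof -
  note h = assms(1)[unfolded self_adjoint_def] and W = assms(2)[unfolded self_adjoint_def]
    and sw = assms(3) and L = assms(4) and m0 = assms(6) and N = assms(8)
  let ?H = "hamiltonian h W :: ('n \<Rightarrow> 'd) op" and ?L = "\<lambda>j. one_body j L :: ('n \<Rightarrow> 'd) op"

  have \<gamma>': "(\<gamma> has_vector_derivative gen (h + mean_field W (\<gamma> t)) {()} (\<lambda>_. L) (\<gamma> t)) (at t within {0..})" if "0 \<le> t" for t
    using assms(11) that by (simp add: hartree_lindblad_solution_def hartree_gen)
  have g0sa: "adj (\<gamma> 0) = \<gamma> 0"
    using assms(5,12) by (simp add: density_op_def nonneg_op_def self_adjoint_def)
  have gsa: "adj (\<gamma> t) = \<gamma> t" if "0 \<le> t" for t
    by (rule hartree_self_adjoint[OF h W assms(11) g0sa that])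
  have gtr: "trace (\<gamma> t) = 1" if "0 \<le> t" for t
    using trace_preserved[OF \<gamma>' that] assms(5,12) by (simp add: density_op_def)
  \<comment> \<open>The Hartree flow is treated as a flow with time-dependent Hamiltonian. The
    persistent lower bound keeps \<gamma> in the set over which \<open>C_const\<close> takes its
    supremum.\<close>
  have gm: "m\<^sub>0 *\<^sub>R mat 1 \<preceq> \<gamma> t" if "0 \<le> t" for t
    using L assms(7,12) by (intro op_le_preserved[OF \<gamma>' gsa _ _ _ that]) (auto simp: adj_add h adj_mean_field[OF W] gsa)
  have gd: "density_op (\<gamma> t)" if "0 \<le> t" for t
    unfolding density_op_iff using op_le_zero_mono[OF _ gm[OF that]] gtr[OF that] m0 by simp

  have \<Gamma>': "(\<Gamma> has_vector_derivative gen ?H UNIV ?L (\<Gamma> t)) (at t within {0..})" if "0 \<le> t" for t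
    using assms(9) that by (simp add: lindblad_solution_def gen_def)
  have L': "?L j ** adj (?L j) = adj (?L j) ** ?L j" for j
    using L by (simp add: adj_one_body one_body_mult)
  have Hsa: "adj ?H = ?H"
    by (rule adj_hamiltonian[OF h W])
  have G0: "density_op (\<Gamma> 0)"
    using assms(10) by (simp add: sym_density_def)
  have Gsa: "adj (\<Gamma> t) = \<Gamma> t" if "0 \<le> t" for t
    using G0 by (intro lindblad_self_adjoint[OF Hsa \<Gamma>' _ that]) (simp_all add: density_op_def nonneg_op_def self_adjoint_def)
  have Gtr: "trace (\<Gamma> t) = 1" if "0 \<le> t" for t
    using trace_preserved[OF \<Gamma>' that] G0 by (simp add: density_op_def)
  have Gpos: "0 *\<^sub>R mat 1 \<preceq> \<Gamma> t" if "0 \<le> t" for t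
    using L' G0 unfolding density_op_iff by (intro op_le_preserved[OF \<Gamma>' Gsa Hsa _ _ that]) auto

  define \<rho> where "\<rho> = (\<lambda>t. tensor_power (\<gamma> t) :: ('n \<Rightarrow> 'd) op)"
  have \<rho>m: "m\<^sub>0 ^ CARD('n) *\<^sub>R mat 1 \<preceq> \<rho> t" if "0 \<le> t" for t
    unfolding \<rho>_def using m0 by (intro op_le_tensor_power gm that) auto
  have ent: "rel_entropy (\<Gamma> t) (\<rho> t) = ereal (rel_ent (\<Gamma> t) (\<rho> t))" if "0 \<le> t" for t
    using m0 by (intro rel_entropy_eq[OF Gsa[OF that] _ \<rho>m[OF that]]) simp

  \<comment> \<open>The mixture of \<Gamma> with the identity solves the same linear equation and is
    bounded below; the estimate for it passes to the limit \<epsilon> -> 0.\<close>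
  have main: "rel_ent (\<Gamma> t) (\<rho> t) + ln 2 \<le> exp (32 * C * t) * (rel_ent (\<Gamma> 0) (\<rho> 0) + ln 2)"
    if C: "\<And>t. 0 \<le> t \<Longrightarrow> op_norm (correlation W (\<gamma> t)) \<le> C" "0 < C" and t: "0 \<le> t" for C t
  proof -
    have "rel_ent (mix \<epsilon> (\<Gamma> t)) (\<rho> t) + ln 2 \<le> exp (32 * C * t) * (rel_ent (mix \<epsilon> (\<Gamma> 0)) (\<rho> 0) + ln 2)"
      if \<epsilon>: "0 < \<epsilon>" "\<epsilon> < 1" for \<epsilon>
      unfolding \<rho>_def
    proof (rule relative_entropy_gronwall[OF h W sw N m0 _ \<gamma>' _ _ _ gm gtr C t])
      fix s :: real assume s: "0 \<le> s"
      have "((\<lambda>s. mix \<epsilon> (\<Gamma> s)) has_vector_derivative (1 - \<epsilon>) *\<^sub>R gen ?H UNIV ?L (\<Gamma> s) + 0) (at s within {0..})"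
        unfolding mix_def
        by (intro has_vector_derivative_add has_vector_derivative_const
            bounded_linear.has_vector_derivative[OF bounded_linear_scaleR_right] \<Gamma>' s)
      then show "((\<lambda>s. mix \<epsilon> (\<Gamma> s)) has_vector_derivative gen ?H UNIV ?L (mix \<epsilon> (\<Gamma> s))) (at s within {0..})"
        by (simp add: mix_def gen_add gen_scaleR gen_one[OF L'])
      show "(\<epsilon> / real CARD('n \<Rightarrow> 'd)) *\<^sub>R mat 1 \<preceq> mix \<epsilon> (\<Gamma> s)"
        using \<epsilon> by (intro op_le_mix Gpos s) auto
      show "trace (mix \<epsilon> (\<Gamma> s)) = 1"
        by (rule trace_mix[OF Gtr[OF s]])
    next
      show "0 < \<epsilon> / real CARD('n \<Rightarrow> 'd)"
        using \<epsilon> by simp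
    qed
    then have ev: "eventually (\<lambda>\<epsilon>. rel_ent (mix \<epsilon> (\<Gamma> t)) (\<rho> t) + ln 2
        \<le> exp (32 * C * t) * (rel_ent (mix \<epsilon> (\<Gamma> 0)) (\<rho> 0) + ln 2)) (at_right 0)"
      by (intro eventually_mono[OF eventually_at_right_real[of 0 1]]) auto
    show ?thesis
      by (rule tendsto_le[OF _ _ _ ev])
        (auto intro!: tendsto_intros rel_ent_mix_tendsto Gpos t)
  qed
  \<comment> \<open>\<Gamma> 0 may be singular, so Klein's inequality is used for the mixture.
    Nonnegativity is what allows the exponent to be enlarged in \<open>two\<close>.\<close>
  have nonneg: "0 \<le> rel_ent (\<Gamma> 0) (\<rho> 0)"
  proof -
    have "0 \<le> rel_ent (mix \<epsilon> (\<Gamma> 0)) (\<rho> 0)" if \<epsilon>: "0 < \<epsilon>" "\<epsilon> < 1" for \<epsilon>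
    proof (rule rel_ent_nonneg)
      show "min (\<epsilon> / real CARD('n \<Rightarrow> 'd)) (m\<^sub>0 ^ CARD('n)) *\<^sub>R mat 1 \<preceq> mix \<epsilon> (\<Gamma> 0)"
        using \<epsilon> by (intro op_le_mono[OF min.cobounded1] op_le_mix Gpos) auto
      show "min (\<epsilon> / real CARD('n \<Rightarrow> 'd)) (m\<^sub>0 ^ CARD('n)) *\<^sub>R mat 1 \<preceq> \<rho> 0"
        by (intro op_le_mono[OF min.cobounded2] \<rho>m) auto
      show "0 < min (\<epsilon> / real CARD('n \<Rightarrow> 'd)) (m\<^sub>0 ^ CARD('n))"
        using \<epsilon> m0 by simp
      show "Re (trace (mix \<epsilon> (\<Gamma> 0))) = Re (trace (\<rho> 0))"
        using trace_mix[OF Gtr[of 0]] gtr[of 0] by (simp add: \<rho>_def tensor_power_eq trace_prod_op)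
    qed
    then have "eventually (\<lambda>\<epsilon>. 0 \<le> rel_ent (mix \<epsilon> (\<Gamma> 0)) (\<rho> 0)) (at_right 0)"
      by (intro eventually_mono[OF eventually_at_right_real[of 0 1]]) auto
    then show ?thesis
      by (intro tendsto_lowerbound[OF rel_ent_mix_tendsto[OF Gpos]]) auto
  qed

  define S where "S = {\<gamma> :: 'd op. density_op \<gamma> \<and> m\<^sub>0 *\<^sub>R mat 1 \<preceq> \<gamma>}"
  have Cdef: "C_const W m\<^sub>0 = (SUP \<gamma>\<in>S. ereal (op_norm (correlation W \<gamma>)))"
    by (simp add: C_const_def correlation_def S_def)
  have Cle: "C_const W m\<^sub>0 \<le> ereal (4 * op_norm W / m\<^sub>0)"
    unfolding Cdef using op_norm_correlation_le[OF W _ m0] by (intro SUP_least) (auto simp: S_def)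
  have gS: "\<gamma> t \<in> S" if "0 \<le> t" for t
    using gd[OF that] gm[OF that] by (simp add: S_def)
  have Cge: "ereal (op_norm (correlation W (\<gamma> t))) \<le> C_const W m\<^sub>0" if "0 \<le> t" for t
    unfolding Cdef by (rule SUP_upper[OF gS[OF that]])
  define c where "c = real_of_ereal (C_const W m\<^sub>0)"
  \<comment> \<open>The supremum is a real number: bounded above by \<open>Cle\<close>, and not
    minus infinity because \<gamma> 0 belongs to the index set.\<close>
  have Cc: "C_const W m\<^sub>0 = ereal c"
    using Cle Cge[of 0] unfolding c_def by (cases "C_const W m\<^sub>0") auto
  have cge: "op_norm (correlation W (\<gamma> t)) \<le> c" if "0 \<le> t" for t
    using Cge[OF that] Cc by simp
  have c0: "0 \<le> c"
  proof -
    have "0 \<le> op_norm (correlation W (\<gamma> 0))"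
      unfolding op_norm_def by (rule onorm_pos_le) (rule matrix_vector_mul_bounded_linear)
    then show ?thesis using cge[of 0] by simp
  qed
  have cle: "c \<le> 4 * op_norm W / m\<^sub>0"
    using Cle Cc by simp
  \<comment> \<open>\<open>main\<close> is stated for C > 0 while c may vanish, for instance when W
    = 0; so C decreases to c.\<close>
  have bound: "rel_ent (\<Gamma> t) (\<rho> t) + ln 2 \<le> exp (32 * c * t) * (rel_ent (\<Gamma> 0) (\<rho> 0) + ln 2)" if t: "0 \<le> t" for t
  proof -
    have "((\<lambda>C. exp (32 * C * t) * (rel_ent (\<Gamma> 0) (\<rho> 0) + ln 2)) \<longlongrightarrow>
        exp (32 * c * t) * (rel_ent (\<Gamma> 0) (\<rho> 0) + ln 2)) (at_right c)"
      by (intro tendsto_intros)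
    moreover have "eventually (\<lambda>C. rel_ent (\<Gamma> t) (\<rho> t) + ln 2 \<le> exp (32 * C * t) * (rel_ent (\<Gamma> 0) (\<rho> 0) + ln 2)) (at_right c)"
    proof (rule eventually_mono[OF eventually_at_right_less[of c]])
      fix C assume "c < C"
      then show "rel_ent (\<Gamma> t) (\<rho> t) + ln 2 \<le> exp (32 * C * t) * (rel_ent (\<Gamma> 0) (\<rho> 0) + ln 2)"
        using c0 by (intro main t) (auto intro: order_trans[OF cge])
    qed
    ultimately show ?thesis
      by (rule tendsto_lowerbound) simp
  qed
  have one: "rel_entropy (\<Gamma> t) (tensor_power (\<gamma> t)) \<le> ereal (exp (32 * c * t))
             * (rel_entropy (\<Gamma> 0) (tensor_power \<gamma>\<^sub>0) + ereal (ln 2))" if t: "0 \<le> t" for t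
  proof -
    have "rel_ent (\<Gamma> t) (\<rho> t) \<le> exp (32 * c * t) * (rel_ent (\<Gamma> 0) (\<rho> 0) + ln 2)"
      using bound[OF t] ln_gt_zero[of 2] by linarith
    then show ?thesis
      using ent[OF t] ent[of 0] assms(12) by (simp add: \<rho>_def)
  qed
  have two: "ereal (exp (32 * c * t)) * (rel_entropy (\<Gamma> 0) (tensor_power \<gamma>\<^sub>0) + ereal (ln 2))
     \<le> ereal (exp (128 * op_norm W * t / m\<^sub>0)) * (rel_entropy (\<Gamma> 0) (tensor_power \<gamma>\<^sub>0) + ereal (ln 2))" if t: "0 \<le> t" for t
  proof -
    have "32 * c * t \<le> 32 * (4 * op_norm W / m\<^sub>0) * t"
      using cle t by (intro mult_right_mono mult_left_mono) auto
    then have "exp (32 * c * t) \<le> exp (128 * op_norm W * t / m\<^sub>0)"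
      by (simp add: mult.assoc)
    then have "exp (32 * c * t) * (rel_ent (\<Gamma> 0) (\<rho> 0) + ln 2)
        \<le> exp (128 * op_norm W * t / m\<^sub>0) * (rel_ent (\<Gamma> 0) (\<rho> 0) + ln 2)"
      using nonneg by (intro mult_right_mono) auto
    then show ?thesis
      using ent[of 0] assms(12) by (simp add: \<rho>_def)
  qed
  show ?thesis
    using one order_trans[OF one two] Cle unfolding c_def[symmetric] by (simp add: Cc)
qed

end
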